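(* Let $k\geqslant 1$ and $n\geqslant 2$, and let $\Omega\subset\mathbb{R}^{4n}\cong\mathbb{H}^n$ be a domain with $X=\Omega\cap\{q_0=0\}\neq\emptyset$. If the map $\widetilde{\mathcal{L}}_1^{(k)}:H^1(\Omega,\mathcal{R}^{(k+2)})\to H^1(\Omega,\mathcal{R}^{(k+1)}\oplus\mathcal{R}^{(k+1)})$ is surjective and the map $\widetilde{\mathcal{L}}_2^{(k)}:H^2(\Omega,\mathcal{R}^{(k+2)})\to H^2(\Omega,\mathcal{R}^{(k+1)}\oplus\mathcal{R}^{(k+1)})$ is injective, then every $k$-regular function on $X$ admits a $k$-regular extension to $\Omega$.
   Context: Identify $\mathbb{H}^n$ with $\mathbb{R}^{4n}$ via $q_t=x_{4t}+\mathbf{i}x_{4t+1}+\mathbf{j}x_{4t+2}+\mathbf{k}x_{4t+3}$, $t=0,\dots,n-1$. With $\partial_m=\partial/\partial x_m$ and $i\in\mathbb{C}$ the imaginary unit, put $\nabla_{2t}^{0'}=-\partial_{4t+2}-i\partial_{4t+3}$, $\nabla_{2t}^{1'}=-\partial_{4t}-i\partial_{4t+1}$, $\nabla_{2t+1}^{0'}=\partial_{4t}-i\partial_{4t+1}$, $\nabla_{2t+1}^{1'}=-\partial_{4t+2}+i\partial_{4t+3}$. Fix a basis $\omega^0,\dots,\omega^{2n-1}$ of $\mathbb{C}^{2n}$. For $A'\in\{0',1'\}$ and a smooth $\Lambda^p\mathbb{C}^{2n}$-valued function $f=\sum_I f_I\,\omega^I$ put $d^{A'}f=\sum_{A=0}^{2n-1}\sum_I\nabla_A^{A'}f_I\;\omega^A\wedge\omega^I$.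 Forms. For $m\geqslant0$ let $V_j^{(m)}=\odot^{m-j}\mathbb{C}^2\otimes\Lambda^j\mathbb{C}^{2n}$ for $0\leqslant j\leqslant m$ and $V_{m+1}^{(m)}=\Lambda^{m+2}\mathbb{C}^{2n}$ (exterior powers of degree $>2n$ are $0$; $\odot^0\mathbb{C}^2=\mathbb{C}$). Elements of $\odot^{p}\mathbb{C}^2\otimes\Lambda^j\mathbb{C}^{2n}$ are families $(f_{A_0'\cdots A_{p-1}'})$ of elements of $\Lambda^j\mathbb{C}^{2n}$, indices in $\{0',1'\}$, symmetric in the indices. The operators $\mathscr{D}_j^{(m)}:C^\infty(\Omega,V_j^{(m)})\to C^\infty(\Omega,V_{j+1}^{(m)})$ are $(\mathscr{D}_j^{(m)}f)_{\mathbf{A}'}=d^{0'}f_{0'\mathbf{A}'}+d^{1'}f_{1'\mathbf{A}'}$ for $0\leqslant j\leqslant m-1$ ($\mathbf{A}'$ a string of $m-j-1$ indices), and $\mathscr{D}_m^{(m)}f=d^{0'}d^{1'}f$. They form the beginning of a complex which is an acyclic resolution of the sheaf $\mathcal{R}^{(m)}=\ker\mathscr{D}_0^{(m)}$ of $m$-regular functions. Accordingly, for $0\leqslant j\leqslant m$, $H^j(\Omega,\mathcal{R}^{(m)})$ (sheaf cohomology) is represented as $\ker\mathscr{D}_j^{(m)}/\operatorname{Im}\mathscr{D}_{j-1}^{(m)}$ on $\Omega$; $H^j(\Omega,\mathcal{R}^{(m)}\oplus\mathcal{R}^{(m)})$ is the direct sum of two copies. $k$-regular functions on $X$: $X$ is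 regarded as an open subset of $\mathbb{H}^{n-1}\cong\mathbb{R}^{4n-4}$ with coordinates $(q_1,\dots,q_{n-1})$; for $k\geqslant1$ a function $f:X\to\odot^k\mathbb{C}^2$ is $k$-regular on $X$ if it is $C^1$ and $\nabla_A^{0'}f_{0'A_1'\cdots A_{k-1}'}+\nabla_A^{1'}f_{1'A_1'\cdots A_{k-1}'}=0$ for all $A=2,\dots,2n-1$ and all $A_1',\dots,A_{k-1}'$. A $k$-regular extension of $f$ to $\Omega$ is $F\in\mathcal{R}^{(k)}(\Omega)$ with $F|_X=f$. Maps. Put $z_{0}^{0'}=x_{2}+ix_{3}$, $z_{0}^{1'}=x_{0}+ix_{1}$, $z_{1}^{0'}=-x_{0}+ix_{1}$, $z_{1}^{1'}=x_{2}-ix_{3}$. For $0\leqslant j\leqslant k+1$, $\widetilde{\mathcal{L}}_j^{(k)}:C^\infty(\Omega,V_j^{(k+2)})\to C^\infty(\Omega,V_j^{(k+1)}\oplus V_j^{(k+1)})$ is $(\widetilde{\mathcal{L}}_j^{(k)}h)_{\mathbf{A}'}=\bigl(-z_1^{0'}h_{0'\mathbf{A}'}-z_1^{1'}h_{1'\mathbf{A}'},\ z_0^{0'}h_{0'\mathbf{A}'}+z_0^{1'}h_{1'\mathbf{A}'}\bigr)^T$. These commute with the operators $\mathscr{D}$ and the same symbol denotes the induced map on cohomology. *)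

theory Defs
  imports "HOL-Analysis.Analysis" "HOL-Library.Multiset"
begin

text \<open>Only meant for open \<open>S\<close>.  All directions \<open>v\<close> are taken, so this is being r times continuously
  differentiable in finite dimension.\<close>

fun Ck_on :: "nat \<Rightarrow> 'a::real_normed_vector set \<Rightarrow> ('a \<Rightarrow> 'b::real_normed_vector) \<Rightarrow> bool" where
  "Ck_on 0 S f \<longleftrightarrow> continuous_on S f"
| "Ck_on (Suc r) S f \<longleftrightarrow>
     (\<forall>x\<in>S. f differentiable (at x)) \<and>
     (\<forall>v. Ck_on r S (\<lambda>x. frechet_derivative f (at x) v))"

definition smooth_on :: "'a::real_normed_vector set \<Rightarrow> ('a \<Rightarrow> 'b::real_normed_vector) \<Rightarrow> bool" where
  "smooth_on S f \<longleftrightarrow> (\<forall>r. Ck_on r S f)"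

text \<open>
  The space of n quaternionic variables is split as \<open>real^4 \<times> real^4^'m\<close>: the first factor carries
  \<open>q\<^sub>0\<close>, the second one \<open>q\<^sub>1, \<dots>, q\<^sub>n\<^sub>-\<^sub>1\<close>, where an enumeration \<open>\<sigma>\<close>, a bijection from
  \<open>{1..<n}\<close> onto \<open>'m\<close>, says which component is \<open>q\<^sub>t\<close>.  \<open>frame \<sigma> m\<close> is the unit vector of the real
  coordinate \<open>x\<^sub>m\<close>, \<open>m < 4n\<close>; \<open>frame' \<sigma> m\<close>, \<open>4 \<le> m < 4n\<close>, is the corresponding vector of the
  second factor.  The components of \<open>real^4\<close> are numbered 0, 1, 2, 3 by the type \<open>4\<close>.
\<close>

type_synonym 'm hspace' = "real^4^'m"
type_synonym 'm hspace = "(real^4) \<times> 'm hspace'"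

definition frame' :: "(nat \<Rightarrow> 'm::finite) \<Rightarrow> nat \<Rightarrow> 'm hspace'" where
  "frame' \<sigma> m = axis (\<sigma> (m div 4)) (axis (of_nat (m mod 4)) 1)"

definition frame :: "(nat \<Rightarrow> 'm::finite) \<Rightarrow> nat \<Rightarrow> 'm hspace" where
  "frame \<sigma> m = (if m < 4 then (axis (of_nat m) 1, 0) else (0, frame' \<sigma> m))"

datatype pidx = P0 | P1  \<comment> \<open>the primed indices 0' and 1'\<close>

text \<open>\<open>nabla e a A\<close> is the operator with lower index \<open>A\<close> and upper index \<open>a\<close>, where the m-th partial
  derivative is taken along \<open>e m\<close>.\<close>

definition nabla ::
  "(nat \<Rightarrow> 'v::real_normed_vector) \<Rightarrow> pidx \<Rightarrow> nat \<Rightarrow> ('v \<Rightarrow> complex) \<Rightarrow> 'v \<Rightarrow> complex" where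
  "nabla e a A f x =
    (let D = (\<lambda>m. frechet_derivative f (at x) (e m)); t = A div 2 in
     if even A then
       (case a of P0 \<Rightarrow> - D (4*t+2) - \<i> * D (4*t+3)
                | P1 \<Rightarrow> - D (4*t) - \<i> * D (4*t+1))
     else
       (case a of P0 \<Rightarrow> D (4*t) - \<i> * D (4*t+1)
                | P1 \<Rightarrow> - D (4*t+2) + \<i> * D (4*t+3)))"

text \<open>
  An element of the exterior algebra on \<open>\<omega>\<^sup>0, \<dots>, \<omega>\<^sup>2\<^sup>n\<^sup>-\<^sup>1\<close> is given by its coefficients with respect to
  the basis of all \<open>\<omega>\<^sup>I\<close>, \<open>I \<subseteq> {..<2n}\<close>, where \<open>\<omega>\<^sup>I\<close> is the product of the \<open>\<omega>\<^sup>A\<close>, \<open>A \<in> I\<close>, taken in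
  increasing order.  Sorting \<open>\<omega>\<^sup>I \<and> \<omega>\<^sup>K\<close> costs one sign for each pair \<open>(i, l) \<in> I \<times> K\<close> with \<open>l < i\<close>.
\<close>

type_synonym form = "nat set \<Rightarrow> complex"

definition basis_form :: "nat set \<Rightarrow> form" where
  "basis_form I = (\<lambda>J. if J = I then 1 else 0)"

definition wedge :: "form \<Rightarrow> form \<Rightarrow> form" where
  "wedge a b J =
     (\<Sum>I\<in>Pow J. (-1) ^ card {(i, l). i \<in> I \<and> l \<in> J - I \<and> l < i} * a I * b (J - I))"

definition d_op ::
  "nat \<Rightarrow> (nat \<Rightarrow> 'm::finite) \<Rightarrow> pidx \<Rightarrow> ('m hspace \<Rightarrow> form) \<Rightarrow> 'm hspace \<Rightarrow> form" where
  "d_op n \<sigma> a f x J =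
     (\<Sum>A<2*n. \<Sum>I\<in>Pow {..<2*n}.
        nabla (frame \<sigma>) a A (\<lambda>y. f y I) x * wedge (basis_form {A}) (basis_form I) J)"

definition sym_tensors :: "nat \<Rightarrow> (pidx list \<Rightarrow> complex) set" where
  "sym_tensors p =
     {v. (\<forall>B. length B \<noteq> p \<longrightarrow> v B = 0) \<and> (\<forall>B C. mset B = mset C \<longrightarrow> v B = v C)}"

type_synonym tensor_form = "pidx list \<Rightarrow> form"

text \<open>In \<open>m - j\<close> the subtraction is truncated, so that no symmetric indices are left for \<open>j = m + 1\<close>.\<close>

definition V_space :: "nat \<Rightarrow> nat \<Rightarrow> nat \<Rightarrow> tensor_form set" where
  "V_space n m j =
     {v. (\<forall>I. (\<lambda>B. v B I) \<in> sym_tensors (m - j)) \<and>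
         (\<forall>B I. \<not> (I \<subseteq> {..<2*n} \<and> card I = (if j \<le> m then j else m + 2)) \<longrightarrow> v B I = 0)}"

definition smooth_sections ::
  "nat \<Rightarrow> 'm::finite hspace set \<Rightarrow> nat \<Rightarrow> nat \<Rightarrow> ('m hspace \<Rightarrow> tensor_form) set" where
  "smooth_sections n \<Omega> m j =
     {f. (\<forall>x\<in>\<Omega>. f x \<in> V_space n m j) \<and> (\<forall>B I. smooth_on \<Omega> (\<lambda>x. f x B I))}"

definition D_op ::
  "nat \<Rightarrow> (nat \<Rightarrow> 'm::finite) \<Rightarrow> nat \<Rightarrow> nat \<Rightarrow>
   ('m hspace \<Rightarrow> tensor_form) \<Rightarrow> 'm hspace \<Rightarrow> tensor_form" where
  "D_op n \<sigma> m j f x B I =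
     (if j < m then
        d_op n \<sigma> P0 (\<lambda>y. f y (P0 # B)) x I + d_op n \<sigma> P1 (\<lambda>y. f y (P1 # B)) x I
      else if B = [] then d_op n \<sigma> P0 (d_op n \<sigma> P1 (\<lambda>y. f y [])) x I
      else 0)"

text \<open>Functions are total; their values outside \<open>\<Omega>\<close> never matter.  In particular cohomologous cocycles
  need to differ by a coboundary on \<open>\<Omega>\<close> only.\<close>

definition cocycles ::
  "nat \<Rightarrow> (nat \<Rightarrow> 'm::finite) \<Rightarrow> 'm hspace set \<Rightarrow> nat \<Rightarrow> nat \<Rightarrow>
   ('m hspace \<Rightarrow> tensor_form) set" where
  "cocycles n \<sigma> \<Omega> m j =
     {f \<in> smooth_sections n \<Omega> m j. \<forall>x\<in>\<Omega>. \<forall>B I. D_op n \<sigma> m j f x B I = 0}"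

definition regular_functions ::
  "nat \<Rightarrow> (nat \<Rightarrow> 'm::finite) \<Rightarrow> 'm hspace set \<Rightarrow> nat \<Rightarrow> ('m hspace \<Rightarrow> tensor_form) set" where
  "regular_functions n \<sigma> \<Omega> m = cocycles n \<sigma> \<Omega> m 0"

definition cohomologous ::
  "nat \<Rightarrow> (nat \<Rightarrow> 'm::finite) \<Rightarrow> 'm hspace set \<Rightarrow> nat \<Rightarrow> nat \<Rightarrow>
   (('m hspace \<Rightarrow> tensor_form) \<times> ('m hspace \<Rightarrow> tensor_form)) set" where
  "cohomologous n \<sigma> \<Omega> m j =
     {(f, g). f \<in> cocycles n \<sigma> \<Omega> m j \<and> g \<in> cocycles n \<sigma> \<Omega> m j \<and>
        (if j = 0 then \<forall>x\<in>\<Omega>. f x = g x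
         else \<exists>u\<in>smooth_sections n \<Omega> m (j - 1).
                \<forall>x\<in>\<Omega>. \<forall>B I. f x B I - g x B I = D_op n \<sigma> m (j - 1) u x B I)}"

definition cohomology ::
  "nat \<Rightarrow> (nat \<Rightarrow> 'm::finite) \<Rightarrow> 'm hspace set \<Rightarrow> nat \<Rightarrow> nat \<Rightarrow>
   ('m hspace \<Rightarrow> tensor_form) set set" where
  "cohomology n \<sigma> \<Omega> m j = cocycles n \<sigma> \<Omega> m j // cohomologous n \<sigma> \<Omega> m j"

definition z_coord :: "nat \<Rightarrow> pidx \<Rightarrow> 'm::finite hspace \<Rightarrow> complex" where
  "z_coord A a p =
    (let x = fst p in
     if A = 0 then
       (case a of P0 \<Rightarrow> complex_of_real (x $ 2) + \<i> * complex_of_real (x $ 3)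
                | P1 \<Rightarrow> complex_of_real (x $ 0) + \<i> * complex_of_real (x $ 1))
     else
       (case a of P0 \<Rightarrow> - complex_of_real (x $ 0) + \<i> * complex_of_real (x $ 1)
                | P1 \<Rightarrow> complex_of_real (x $ 2) - \<i> * complex_of_real (x $ 3)))"

definition L1 :: "('m::finite hspace \<Rightarrow> tensor_form) \<Rightarrow> 'm hspace \<Rightarrow> tensor_form" where
  "L1 h x B I = - z_coord 1 P0 x * h x (P0 # B) I - z_coord 1 P1 x * h x (P1 # B) I"

definition L2 :: "('m::finite hspace \<Rightarrow> tensor_form) \<Rightarrow> 'm hspace \<Rightarrow> tensor_form" where
  "L2 h x B I = z_coord 0 P0 x * h x (P0 # B) I + z_coord 0 P1 x * h x (P1 # B) I"

text \<open>
  The map induced by \<open>h \<mapsto> (L1 h, L2 h)\<close>, from degree-j cohomology for \<open>k + 2\<close> to two copies of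
  degree-j cohomology for \<open>k + 1\<close>.  It sends the class of \<open>h\<close> to the pair of the classes of \<open>L1 h\<close>
  and \<open>L2 h\<close>, obtained here as everything cohomologous to the image of a representative.
\<close>

definition L_coh ::
  "nat \<Rightarrow> (nat \<Rightarrow> 'm::finite) \<Rightarrow> 'm hspace set \<Rightarrow> nat \<Rightarrow> nat \<Rightarrow>
   ('m hspace \<Rightarrow> tensor_form) set \<Rightarrow>
   ('m hspace \<Rightarrow> tensor_form) set \<times> ('m hspace \<Rightarrow> tensor_form) set" where
  "L_coh n \<sigma> \<Omega> k j C =
     (cohomologous n \<sigma> \<Omega> (k + 1) j `` (L1 ` C), cohomologous n \<sigma> \<Omega> (k + 1) j `` (L2 ` C))"

definition slice :: "'m::finite hspace set \<Rightarrow> 'm hspace' set" where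
  "slice \<Omega> = {y. (0, y) \<in> \<Omega>}"

definition regular_on_slice ::
  "nat \<Rightarrow> (nat \<Rightarrow> 'm::finite) \<Rightarrow> 'm hspace' set \<Rightarrow> nat \<Rightarrow>
   ('m hspace' \<Rightarrow> pidx list \<Rightarrow> complex) \<Rightarrow> bool" where
  "regular_on_slice n \<sigma> X k f \<longleftrightarrow>
     (\<forall>y\<in>X. f y \<in> sym_tensors k) \<and>
     (\<forall>B. Ck_on 1 X (\<lambda>y. f y B)) \<and>
     (\<forall>y\<in>X. \<forall>A\<in>{2..<2*n}. \<forall>B. length B = k - 1 \<longrightarrow>
        nabla (frame' \<sigma>) P0 A (\<lambda>y. f y (P0 # B)) y + nabla (frame' \<sigma>) P1 A (\<lambda>y. f y (P1 # B)) y = 0)"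

text \<open>A function with values in symmetric tensors is identified with the family of its degree-0
  forms, whose only coefficient is the one at \<open>{}\<close>.\<close>

definition regular_extension ::
  "nat \<Rightarrow> (nat \<Rightarrow> 'm::finite) \<Rightarrow> 'm hspace set \<Rightarrow> nat \<Rightarrow>
   ('m hspace' \<Rightarrow> pidx list \<Rightarrow> complex) \<Rightarrow> ('m hspace \<Rightarrow> tensor_form) \<Rightarrow> bool" where
  "regular_extension n \<sigma> \<Omega> k f F \<longleftrightarrow>
     F \<in> regular_functions n \<sigma> \<Omega> k \<and> (\<forall>y\<in>slice \<Omega>. \<forall>B. F (0, y) B {} = f y B)"

end

theory Submission
  imports Defs
begin

text \<open>
  The operators \<open>\<nabla>\<^sub>A\<close> only differentiate in \<open>q\<^sub>t\<close> with \<open>t = A div 2\<close>, so a regular function \<open>f\<close> on the slice,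
  extended constantly in \<open>q\<^sub>0\<close>, is regular near the slice; what remains is to pass from this neighbourhood
  to \<open>\<Omega>\<close>.  Write \<open>M (u\<^sub>0, u\<^sub>1) = z\<^sub>0 u\<^sub>0 + z\<^sub>1 u\<^sub>1\<close> for the contraction with the coordinates, so that
  \<open>M \<circ> L = 0\<close>, and \<open>D\<close> for the operators of the complexes.  Off \<open>q\<^sub>0 = 0\<close> the \<open>2 \<times> 2\<close> matrix \<open>z\<close> has
  determinant \<open>|q\<^sub>0|\<^sup>2\<close>; there \<open>f = M u\<close> for some \<open>u\<close>, and \<open>M D u = D f = 0\<close> gives \<open>D u = L w\<close> with
  \<open>D w = 0\<close>.  Let \<open>\<phi>\<close> be a cutoff function that is \<open>1\<close> near the slice.  Then \<open>h = D (\<phi> w)\<close> and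
  \<open>g = \<phi> D u - D (\<phi> u)\<close> vanish near the slice, hence are smooth on \<open>\<Omega>\<close>, and \<open>L h = D g\<close>.  Injectivity
  gives \<open>h = D h'\<close>, surjectivity gives \<open>g - L h' = L h'' - D v\<close>, and
  \<open>F = M (\<phi> u - v) = \<phi> f - M v\<close> satisfies \<open>D F = M L (\<phi> w - h' - h'') = 0\<close> off \<open>q\<^sub>0 = 0\<close>, hence everywhere,
  while \<open>M v\<close> vanishes on the slice.

  Regular functions on the slice are only assumed to be \<open>C\<^sup>1\<close>; they are harmonic in the weak sense, so
  they agree locally with their means against a smooth radial kernel and are smooth.
\<close>

section \<open>Smooth functions\<close>

text \<open>The construction is a connecting-map argument: \<open>f\<close> lifts to
  \<open>u\<close>, and \<open>D u\<close> lifts to \<open>w\<close>; after the cutoff, injectivity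
  repairs \<open>w\<close> and surjectivity then repairs \<open>u\<close>. The obstacle is that the
  sequence formed by \<open>L\<close> and \<open>M\<close> is exact only where the matrix
  \<open>z\<close> is invertible, so that \<open>u\<close> and \<open>w\<close> are singular on
  \<open>q\<^sub>0 = 0\<close>. Moreover the constant extension of \<open>f\<close> lives only over
  the slice, whereas \<Omega> may contain points whose second component lies outside the slice.
  Hence \<phi> has to be 1 near the slice and also 0 near such points. A neighbourhood of constant
  width will not do: it has to shrink towards the boundary of the slice, and this is why an
  exhaustion function of the slice enters the cutoff.

  For \<open>C\<^sup>1\<close> functions the system cannot be differentiated once more to give a
  Laplace equation. The second derivatives are therefore moved onto a radial test function, chosen
  so that its gradient is the averaging kernel times the position vector.\<close>

lemma frechet_derivative_cong:
  assumes "open S" "x \<in> S" "\<And>y. y \<in> S \<Longrightarrow> f y = g y"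
  shows "frechet_derivative f (at x) = frechet_derivative g (at x)"
proof -
  have "(f has_derivative f') (at x) \<longleftrightarrow> (g has_derivative f') (at x)" for f'
    using has_derivative_transform_within_open[of f f' x UNIV S g]
      has_derivative_transform_within_open[of g f' x UNIV S f] assms by auto
  then show ?thesis by (simp add: frechet_derivative_def)
qed

lemma differentiable_cong_open:
  assumes "open S" "x \<in> S" "\<And>y. y \<in> S \<Longrightarrow> f y = g y"
  shows "f differentiable (at x) \<longleftrightarrow> g differentiable (at x)"
  unfolding differentiable_def
  using has_derivative_transform_within_open[OF _ assms(1,2), of f _ UNIV g]
    has_derivative_transform_within_open[OF _ assms(1,2), of g _ UNIV f] assms(3) by metis

lemma frechet_derivative_eqI:
  "(f has_derivative f') (at x) \<Longrightarrow> frechet_derivative f (at x) v = f' v"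
  using frechet_derivative_at by metis

lemma has_derivative_scaleR_arg:
  "(f has_derivative D) F \<Longrightarrow> D (c *\<^sub>R v) = c *\<^sub>R D v"
  using has_derivative_bounded_linear linear_simps(5) by blast

lemma Ck_on_cong:
  assumes "open S" "\<And>x. x \<in> S \<Longrightarrow> f x = g x"
  shows "Ck_on r S f \<longleftrightarrow> Ck_on r S g"
  using assms(2)
proof (induction r arbitrary: f g)
  case 0
  then show ?case by (auto cong: continuous_on_cong)
next
  case (Suc r)
  have "frechet_derivative f (at x) = frechet_derivative g (at x)" if "x \<in> S" for x
    using frechet_derivative_cong[OF assms(1) that] Suc.prems by auto
  then have "Ck_on r S (\<lambda>x. frechet_derivative f (at x) v) = Ck_on r S (\<lambda>x. frechet_derivative g (at x) v)" for v
    by (intro Suc.IH) auto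
  moreover have "f differentiable (at x) \<longleftrightarrow> g differentiable (at x)" if "x \<in> S" for x
    using differentiable_cong_open[OF assms(1) that] Suc.prems by auto
  ultimately show ?case by simp
qed

text \<open>The form used in the inductions on the order: the derivative is supplied by a formula
  valid on \<open>S\<close>, and openness of \<open>S\<close> permits replacing
  \<open>frechet_derivative\<close> by it at all lower orders.\<close>

lemma Ck_on_SucI:
  assumes "open S" "\<And>x. x \<in> S \<Longrightarrow> (f has_derivative D x) (at x)"
    and "\<And>v. Ck_on r S (\<lambda>x. D x v)"
  shows "Ck_on (Suc r) S f"
proof -
  have "Ck_on r S (\<lambda>x. frechet_derivative f (at x) v)" for v
    using assms(3) by (subst Ck_on_cong[OF assms(1)]) (auto simp: frechet_derivative_eqI[OF assms(2)])
  then show ?thesis using assms(2) by (auto simp: differentiable_def)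
qed

lemma Ck_on_local:
  assumes "\<And>x. x \<in> S \<Longrightarrow> \<exists>U. open U \<and> x \<in> U \<and> Ck_on r U f"
  shows "Ck_on r S f"
  using assms
proof (induction r arbitrary: f)
  case 0
  then show ?case
    by (metis Ck_on.simps(1) continuous_at_imp_continuous_on continuous_on_eq_continuous_at)
next
  case (Suc r)
  show ?case
  proof (simp, intro conjI ballI allI)
    fix x assume "x \<in> S"
    then show "f differentiable (at x)" using Suc.prems by fastforce
  next
    fix v
    show "Ck_on r S (\<lambda>x. frechet_derivative f (at x) v)"
      using Suc.prems by (intro Suc.IH) fastforce
  qed
qed

lemma Ck_on_subset: "Ck_on r S f \<Longrightarrow> T \<subseteq> S \<Longrightarrow> Ck_on r T f"
  by (induction r arbitrary: f) (auto intro: continuous_on_subset)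

lemma Ck_on_Suc_imp: "Ck_on (Suc r) S f \<Longrightarrow> Ck_on r S f"
proof (induction r arbitrary: f)
  case 0
  then show ?case
    by (simp add: continuous_at_imp_continuous_on differentiable_imp_continuous_within)
next
  case (Suc r)
  then show ?case by (meson Ck_on.simps(2))
qed

lemma Ck_on_const: "Ck_on r S (\<lambda>x. c)"
  by (induction r arbitrary: c) auto

lemma Ck_on_add:
  "Ck_on r S f \<Longrightarrow> Ck_on r S g \<Longrightarrow> open S \<Longrightarrow> Ck_on r S (\<lambda>x. f x + g x)"
proof (induction r arbitrary: f g)
  case 0
  then show ?case by (auto intro: continuous_on_add)
next
  case (Suc r)
  have "((\<lambda>x. f x + g x) has_derivative
      (\<lambda>v. frechet_derivative f (at x) v + frechet_derivative g (at x) v)) (at x)" if "x \<in> S" for x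
    using Suc.prems that
    by (intro has_derivative_add) (auto simp: frechet_derivative_works[symmetric])
  moreover have "Ck_on r S (\<lambda>x. frechet_derivative f (at x) v + frechet_derivative g (at x) v)" for v
    using Suc.prems by (intro Suc.IH) auto
  ultimately show ?case by (rule Ck_on_SucI[OF \<open>open S\<close>])
qed

lemma Ck_on_linear:
  "bounded_linear L \<Longrightarrow> Ck_on r S f \<Longrightarrow> open S \<Longrightarrow> Ck_on r S (\<lambda>x. L (f x))"
proof (induction r arbitrary: f)
  case 0
  then show ?case using bounded_linear.continuous_on[of L S f] by simp
next
  case (Suc r)
  have *: "((\<lambda>x. L (f x)) has_derivative (\<lambda>v. L (frechet_derivative f (at x) v))) (at x)" if "x \<in> S" for x
    using Suc.prems that
    by (rule_tac bounded_linear.has_derivative) (auto simp: frechet_derivative_works[symmetric])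
  have "Ck_on r S (\<lambda>x. L (frechet_derivative f (at x) v))" for v
    using Suc.prems by (intro Suc.IH) auto
  with \<open>open S\<close> * show ?case by (rule Ck_on_SucI)
qed

lemma Ck_on_compose_linear:
  "bounded_linear L \<Longrightarrow> Ck_on r S f \<Longrightarrow> open T \<Longrightarrow> L ` T \<subseteq> S \<Longrightarrow> Ck_on r T (\<lambda>x. f (L x))"
proof (induction r arbitrary: f)
  case 0
  then show ?case
    using continuous_on_compose2[of S f T L] linear_continuous_on[of L T] by simp
next
  case (Suc r)
  have *: "((\<lambda>x. f (L x)) has_derivative (\<lambda>v. frechet_derivative f (at (L x)) (L v))) (at x)" if "x \<in> T" for x
    using Suc.prems that
    by (rule_tac has_derivative_compose[OF bounded_linear_imp_has_derivative])
      (auto simp: frechet_derivative_works[symmetric])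
  have "Ck_on r T (\<lambda>x. frechet_derivative f (at (L x)) (L v))" for v
    using Suc.prems by (intro Suc.IH) auto
  with \<open>open T\<close> * show ?case by (rule Ck_on_SucI)
qed

lemma Ck_on_bilinear:
  "bounded_bilinear B \<Longrightarrow> Ck_on r S f \<Longrightarrow> Ck_on r S g \<Longrightarrow> open S \<Longrightarrow> Ck_on r S (\<lambda>x. B (f x) (g x))"
proof (induction r arbitrary: f g)
  case 0
  then show ?case using bounded_bilinear.continuous_on[of B S f g] by simp
next
  case (Suc r)
  have *: "((\<lambda>x. B (f x) (g x)) has_derivative
      (\<lambda>v. B (f x) (frechet_derivative g (at x) v) + B (frechet_derivative f (at x) v) (g x))) (at x)"
    if "x \<in> S" for x
    using Suc.prems that
    by (rule_tac bounded_bilinear.FDERIV) (auto simp: frechet_derivative_works[symmetric])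
  have "Ck_on r S (\<lambda>x. B (f x) (frechet_derivative g (at x) v) + B (frechet_derivative f (at x) v) (g x))" for v
    using Suc.prems Ck_on_Suc_imp[OF Suc.prems(2)] Ck_on_Suc_imp[OF Suc.prems(3)]
    by (intro Ck_on_add Suc.IH) auto
  with \<open>open S\<close> * show ?case by (rule Ck_on_SucI)
qed

lemmas Ck_on_mult = Ck_on_bilinear[OF bounded_bilinear_mult]

lemma Ck_on_inverse:
  fixes f :: "'a::real_normed_vector \<Rightarrow> 'b::real_normed_field"
  shows "Ck_on r S f \<Longrightarrow> open S \<Longrightarrow> (\<And>x. x \<in> S \<Longrightarrow> f x \<noteq> 0) \<Longrightarrow> Ck_on r S (\<lambda>x. inverse (f x))"
proof (induction r arbitrary: f)
  case 0
  then show ?case by (auto intro: continuous_on_inverse)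
next
  case (Suc r)
  have *: "((\<lambda>x. inverse (f x)) has_derivative
      (\<lambda>v. - (inverse (f x) * frechet_derivative f (at x) v * inverse (f x)))) (at x)"
    if "x \<in> S" for x
    using Suc.prems that
    by (intro Deriv.has_derivative_inverse) (auto simp: frechet_derivative_works[symmetric])
  have "Ck_on r S (\<lambda>x. - (inverse (f x) * frechet_derivative f (at x) v * inverse (f x)))" for v
    using Suc.prems Ck_on_Suc_imp[OF Suc.prems(1)]
    by (intro Ck_on_linear[of uminus] Ck_on_mult Suc.IH bounded_linear_minus bounded_linear_ident) auto
  with \<open>open S\<close> * show ?case by (rule Ck_on_SucI)
qed

lemma Ck_on_compose_real:
  fixes f :: "'a::real_normed_vector \<Rightarrow> real" and g :: "real \<Rightarrow> 'b::real_normed_vector"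
  shows "Ck_on r S f \<Longrightarrow> Ck_on r UNIV g \<Longrightarrow> open S \<Longrightarrow> Ck_on r S (\<lambda>x. g (f x))"
proof (induction r arbitrary: g)
  case 0
  then show ?case using continuous_on_compose2[of UNIV g S f] by simp
next
  case (Suc r)
  \<comment> \<open>The induction hypothesis concerns functions on the real line. By linearity all
    directional derivatives of \<open>g\<close> are multiples of the single function
    \<open>?g'\<close>.\<close>
  let ?g' = "\<lambda>s. frechet_derivative g (at s) 1"
  have g': "frechet_derivative g (at s) v = v *\<^sub>R ?g' s" for s v
  proof -
    have "linear (frechet_derivative g (at s))"
      using Suc.prems by (auto intro: linear_frechet_derivative)
    then have "frechet_derivative g (at s) (v *\<^sub>R 1) = v *\<^sub>R ?g' s" by (rule linear_scale)
    then show ?thesis by simp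
  qed
  have "((\<lambda>x. g (f x)) has_derivative
      (\<lambda>v. frechet_derivative g (at (f x)) (frechet_derivative f (at x) v))) (at x)"
    if "x \<in> S" for x
    using Suc.prems that
    by (rule_tac has_derivative_compose[of f _ x UNIV g]) (auto simp: frechet_derivative_works[symmetric])
  then have *: "((\<lambda>x. g (f x)) has_derivative
      (\<lambda>v. frechet_derivative f (at x) v *\<^sub>R ?g' (f x))) (at x)"
    if "x \<in> S" for x
    using that by (simp add: g'[symmetric])
  have "Ck_on r S (\<lambda>x. frechet_derivative f (at x) v *\<^sub>R ?g' (f x))" for v
    using Suc.prems Ck_on_Suc_imp[OF Suc.prems(1)]
    by (intro Ck_on_bilinear[OF bounded_bilinear_scaleR] Suc.IH) auto
  with \<open>open S\<close> * show ?case by (rule Ck_on_SucI)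
qed

lemma Ck_on_bounded_linear:
  assumes "bounded_linear L"
  shows "Ck_on r S L"
proof (cases r)
  case 0
  then show ?thesis using assms by (auto intro: linear_continuous_on)
next
  case (Suc r)
  have "(L has_derivative L) (at x)" for x
    using assms by (rule bounded_linear_imp_has_derivative)
  then have "frechet_derivative L (at x) = L" "L differentiable (at x)" for x
    by (auto simp: frechet_derivative_eqI differentiable_def)
  then show ?thesis using Suc by (simp add: Ck_on_const)
qed

section \<open>Closure properties of functions smooth to every order\<close>

lemma smooth_on_cong:
  "open S \<Longrightarrow> (\<And>x. x \<in> S \<Longrightarrow> f x = g x) \<Longrightarrow> smooth_on S f \<longleftrightarrow> smooth_on S g"
  using Ck_on_cong[of S f g] unfolding smooth_on_def by blast

lemma smooth_on_subset: "smooth_on S f \<Longrightarrow> T \<subseteq> S \<Longrightarrow> smooth_on T f"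
  using Ck_on_subset unfolding smooth_on_def by blast

lemma smooth_on_local:
  assumes "\<And>x. x \<in> S \<Longrightarrow> \<exists>U. open U \<and> x \<in> U \<and> smooth_on U f"
  shows "smooth_on S f"
  unfolding smooth_on_def
proof
  fix r
  show "Ck_on r S f"
    by (rule Ck_on_local) (meson assms smooth_on_def)
qed

lemma smooth_on_const [simp]: "smooth_on S (\<lambda>x. c)"
  by (simp add: smooth_on_def Ck_on_const)

lemma smooth_on_add:
  "open S \<Longrightarrow> smooth_on S f \<Longrightarrow> smooth_on S g \<Longrightarrow> smooth_on S (\<lambda>x. f x + g x)"
  by (simp add: smooth_on_def Ck_on_add)

lemma smooth_on_linear:
  "open S \<Longrightarrow> bounded_linear L \<Longrightarrow> smooth_on S f \<Longrightarrow> smooth_on S (\<lambda>x. L (f x))"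
  by (simp add: smooth_on_def Ck_on_linear)

lemma smooth_on_minus: "open S \<Longrightarrow> smooth_on S f \<Longrightarrow> smooth_on S (\<lambda>x. - f x)"
  by (rule smooth_on_linear) (simp_all add: bounded_linear_minus)

lemma smooth_on_diff:
  "open S \<Longrightarrow> smooth_on S f \<Longrightarrow> smooth_on S g \<Longrightarrow> smooth_on S (\<lambda>x. f x - g x)"
  using smooth_on_add[of S f "\<lambda>x. - g x"] by (simp add: smooth_on_minus)

lemma smooth_on_bilinear:
  "open S \<Longrightarrow> bounded_bilinear B \<Longrightarrow> smooth_on S f \<Longrightarrow> smooth_on S g \<Longrightarrow>
    smooth_on S (\<lambda>x. B (f x) (g x))"
  by (simp add: smooth_on_def Ck_on_bilinear)

lemma smooth_on_mult:
  fixes f g :: "'a::real_normed_vector \<Rightarrow> 'b::real_normed_algebra"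
  shows "open S \<Longrightarrow> smooth_on S f \<Longrightarrow> smooth_on S g \<Longrightarrow> smooth_on S (\<lambda>x. f x * g x)"
  by (rule smooth_on_bilinear[OF _ bounded_bilinear_mult])

lemma smooth_on_sum:
  "open S \<Longrightarrow> (\<And>i. i \<in> I \<Longrightarrow> smooth_on S (f i)) \<Longrightarrow> smooth_on S (\<lambda>x. \<Sum>i\<in>I. f i x)"
  by (induction I rule: infinite_finite_induct) (auto intro!: smooth_on_add)

lemma smooth_on_inverse:
  fixes f :: "'a::real_normed_vector \<Rightarrow> 'b::real_normed_field"
  shows "open S \<Longrightarrow> smooth_on S f \<Longrightarrow> (\<And>x. x \<in> S \<Longrightarrow> f x \<noteq> 0) \<Longrightarrow> smooth_on S (\<lambda>x. inverse (f x))"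
  by (simp add: smooth_on_def Ck_on_inverse)

lemma smooth_on_divide:
  fixes f g :: "'a::real_normed_vector \<Rightarrow> 'b::real_normed_field"
  shows "open S \<Longrightarrow> smooth_on S f \<Longrightarrow> smooth_on S g \<Longrightarrow> (\<And>x. x \<in> S \<Longrightarrow> g x \<noteq> 0) \<Longrightarrow>
    smooth_on S (\<lambda>x. f x / g x)"
  by (auto simp: divide_inverse intro!: smooth_on_mult smooth_on_inverse)

lemma smooth_on_compose_real:
  fixes f :: "'a::real_normed_vector \<Rightarrow> real" and g :: "real \<Rightarrow> 'b::real_normed_vector"
  shows "open S \<Longrightarrow> smooth_on UNIV g \<Longrightarrow> smooth_on S f \<Longrightarrow> smooth_on S (\<lambda>x. g (f x))"
  by (simp add: smooth_on_def Ck_on_compose_real)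

lemma smooth_on_compose_linear:
  "open T \<Longrightarrow> bounded_linear L \<Longrightarrow> smooth_on S f \<Longrightarrow> L ` T \<subseteq> S \<Longrightarrow> smooth_on T (\<lambda>x. f (L x))"
  unfolding smooth_on_def using Ck_on_compose_linear[of L _ S f T] by blast

lemma smooth_on_bounded_linear: "bounded_linear L \<Longrightarrow> smooth_on S L"
  by (simp add: smooth_on_def Ck_on_bounded_linear)

lemma smooth_on_imp_continuous_on: "smooth_on S f \<Longrightarrow> continuous_on S f"
  by (metis Ck_on.simps(1) smooth_on_def)

lemma smooth_on_imp_differentiable: "smooth_on S f \<Longrightarrow> x \<in> S \<Longrightarrow> f differentiable (at x)"
  by (metis Ck_on.simps(2) smooth_on_def)

lemma smooth_on_imp_has_derivative:
  "smooth_on S f \<Longrightarrow> x \<in> S \<Longrightarrow> (f has_derivative frechet_derivative f (at x)) (at x)"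
  using frechet_derivative_works smooth_on_imp_differentiable by blast

lemma smooth_on_frechet_derivative:
  "smooth_on S f \<Longrightarrow> smooth_on S (\<lambda>x. frechet_derivative f (at x) v)"
  by (metis Ck_on.simps(2) smooth_on_def)

text \<open>Differentiating \<open>f (y + t v) - f y = \<integral>\<^sub>0\<^sup>t \<partial>\<^sub>v f (y + \<tau> v) d\<tau>\<close> along \<open>u\<close> and then in \<open>t\<close> at \<open>0\<close>.\<close>

lemma second_derivative_symmetric:
  fixes f :: "'a::real_normed_vector \<Rightarrow> 'b::banach"
  assumes "open S" "x \<in> S" "Ck_on 2 S f"
  shows "frechet_derivative (\<lambda>y. frechet_derivative f (at y) v) (at x) u =
         frechet_derivative (\<lambda>y. frechet_derivative f (at y) u) (at x) v"
proof -
  define fv where "fv y = frechet_derivative f (at y) v" for y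
  define fu where "fu y = frechet_derivative f (at y) u" for y
  define fvu where "fvu y = frechet_derivative fv (at y) u" for y
  have C: "Ck_on (Suc (Suc 0)) S f" using assms(3) by (simp add: numeral_2_eq_2 del: Ck_on.simps)
  have f: "(f has_derivative frechet_derivative f (at y)) (at y)" if "y \<in> S" for y
    using C that by (simp add: frechet_derivative_works[symmetric])
  have fv: "(fv has_derivative frechet_derivative fv (at y)) (at y)"
    and fu: "(fu has_derivative frechet_derivative fu (at y)) (at y)" if "y \<in> S" for y
    using C that by (simp_all add: frechet_derivative_works[symmetric] fv_def[abs_def] fu_def[abs_def])
  have cont: "continuous_on S fvu" "continuous_on S fv"
    using C Ck_on_Suc_imp[of 0 S fv] by (simp_all add: fvu_def[abs_def] fv_def[abs_def])
  obtain e where "e > 0" and e: "ball x e \<subseteq> S" using assms open_contains_ball by blast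
  \<comment> \<open>With this \<open>d\<close> every point of the parallelogram spanned by
    \<open>d u\<close> and \<open>d v\<close> has distance at most \<open>e / 2\<close> from
    \<open>x\<close>; the summand 1 keeps the denominator positive when
    \<open>u = v = 0\<close>.\<close>
  define d where "d = e / (2 * (norm u + norm v + 1))"
  have "d > 0" unfolding d_def using \<open>e > 0\<close> by (auto intro!: divide_pos_pos add_nonneg_pos)
  have ntriv: "at 0 within {-d..d} \<noteq> bot" "at 0 within {0..d} \<noteq> bot"
    using \<open>d > 0\<close> by (simp_all add: trivial_limit_within islimpt_Icc)
  have in_S: "x + s *\<^sub>R u + t *\<^sub>R v \<in> S" if "\<bar>s\<bar> \<le> d" "\<bar>t\<bar> \<le> d" for s t
  proof -
    have "norm (s *\<^sub>R u + t *\<^sub>R v) \<le> \<bar>s\<bar> * norm u + \<bar>t\<bar> * norm v"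
      by (rule norm_triangle_le) simp
    also have "\<dots> \<le> d * norm u + d * norm v"
      using that by (intro add_mono mult_right_mono) auto
    also have "\<dots> \<le> d * (norm u + norm v + 1)" using \<open>d > 0\<close> by (simp add: distrib_left)
    also have "\<dots> = e / 2"
    proof -
      have "norm u + norm v + 1 > 0" by (simp add: add_nonneg_pos)
      then show ?thesis unfolding d_def
        by (metis divide_divide_eq_left less_irrefl nonzero_eq_divide_eq times_divide_eq_left mult.commute)
    qed
    also have "\<dots> < e" using \<open>e > 0\<close> by simp
    finally show ?thesis using e by (intro subsetD[OF e]) (simp add: dist_norm norm_minus_commute algebra_simps)
  qed
  have FTC: "((\<lambda>t. fv (x + s *\<^sub>R u + t *\<^sub>R v)) has_integral f (x + s *\<^sub>R u + T *\<^sub>R v) - f (x + s *\<^sub>R u)) {0..T}"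
    if "\<bar>s\<bar> \<le> d" "0 \<le> T" "T \<le> d" for s T
  proof -
    have "((\<lambda>t. f (x + s *\<^sub>R u + t *\<^sub>R v)) has_vector_derivative fv (x + s *\<^sub>R u + t *\<^sub>R v)) (at t within {0..T})"
      if t: "t \<in> {0..T}" for t
    proof -
      have in_S': "x + s *\<^sub>R u + t *\<^sub>R v \<in> S" using in_S that \<open>\<bar>s\<bar> \<le> d\<close> \<open>T \<le> d\<close> by auto
      have "((\<lambda>t. x + s *\<^sub>R u + t *\<^sub>R v) has_derivative (\<lambda>t. t *\<^sub>R v)) (at t within {0..T})"
        by (auto intro!: derivative_eq_intros)
      from has_derivative_compose[OF this f[OF in_S']]
      have "((\<lambda>t. f (x + s *\<^sub>R u + t *\<^sub>R v)) has_derivative (\<lambda>\<tau>. frechet_derivative f (at (x + s *\<^sub>R u + t *\<^sub>R v)) (\<tau> *\<^sub>R v))) (at t within {0..T})" .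
      then show ?thesis
        unfolding has_vector_derivative_def fv_def
        by (simp add: has_derivative_scaleR_arg[OF f[OF in_S']])
    qed
    from fundamental_theorem_of_calculus[OF \<open>0 \<le> T\<close> this] show ?thesis by simp
  qed
  have lin: "((\<lambda>s. g (x + s *\<^sub>R u + t *\<^sub>R v)) has_vector_derivative frechet_derivative g (at (x + s *\<^sub>R u + t *\<^sub>R v)) u) (at s within U)"
    if "\<bar>s\<bar> \<le> d" "\<bar>t\<bar> \<le> d" and g: "\<And>y. y \<in> S \<Longrightarrow> (g has_derivative frechet_derivative g (at y)) (at y)" for g s t and U :: "real set"
  proof -
    note in_S' = in_S[OF that(1,2)]
    have "((\<lambda>s. x + s *\<^sub>R u + t *\<^sub>R v) has_derivative (\<lambda>s. s *\<^sub>R u)) (at s within U)"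
      by (auto intro!: derivative_eq_intros)
    from has_derivative_compose[OF this g[OF in_S']]
    show ?thesis
      unfolding has_vector_derivative_def
      by (simp add: has_derivative_scaleR_arg[OF g[OF in_S']])
  qed
  have key: "integral {0..T} (\<lambda>t. fvu (x + t *\<^sub>R v)) = fu (x + T *\<^sub>R v) - fu x" if T: "0 \<le> T" "T \<le> d" for T
  proof -
    have "((\<lambda>s. integral (cbox 0 T) (\<lambda>t. fv (x + s *\<^sub>R u + t *\<^sub>R v))) has_vector_derivative
        integral (cbox 0 T) (\<lambda>t. fvu (x + 0 *\<^sub>R u + t *\<^sub>R v))) (at 0 within {-d..d})"
    proof (rule leibniz_rule_vector_derivative)
      fix s t assume st: "s \<in> {-d..d}" "t \<in> cbox 0 T"
      have "\<bar>s\<bar> \<le> d" "\<bar>t\<bar> \<le> d" using st T by auto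
      from lin[OF this fv]
      show "((\<lambda>s. fv (x + s *\<^sub>R u + t *\<^sub>R v)) has_vector_derivative fvu (x + s *\<^sub>R u + t *\<^sub>R v)) (at s within {- d..d})"
        unfolding fvu_def by simp
    next
      fix s assume "s \<in> {-d..d}"
      then have "\<bar>s\<bar> \<le> d" by auto
      from FTC[OF this T] show "(\<lambda>t. fv (x + s *\<^sub>R u + t *\<^sub>R v)) integrable_on cbox 0 T"
        by (auto simp: integrable_on_def)
    next
      have "continuous_on ({-d..d} \<times> cbox 0 T) (\<lambda>z. fvu (x + fst z *\<^sub>R u + snd z *\<^sub>R v))"
        using T by (intro continuous_on_compose2[OF cont(1)] continuous_intros) (auto intro!: in_S)
      then show "continuous_on ({-d..d} \<times> cbox 0 T) (\<lambda>(s, t). fvu (x + s *\<^sub>R u + t *\<^sub>R v))"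
        by (simp add: case_prod_unfold)
    qed (use \<open>d > 0\<close> in auto)
    moreover have "((\<lambda>s. f (x + s *\<^sub>R u + T *\<^sub>R v) - f (x + s *\<^sub>R u + 0 *\<^sub>R v)) has_vector_derivative
        fu (x + 0 *\<^sub>R u + T *\<^sub>R v) - fu (x + 0 *\<^sub>R u + 0 *\<^sub>R v)) (at 0 within {-d..d})"
      unfolding fu_def using T \<open>d > 0\<close>
      by (intro has_vector_derivative_diff lin f) auto
    moreover have "integral (cbox 0 T) (\<lambda>t. fv (x + s *\<^sub>R u + t *\<^sub>R v)) = f (x + s *\<^sub>R u + T *\<^sub>R v) - f (x + s *\<^sub>R u + 0 *\<^sub>R v)"
      if "s \<in> {-d..d}" for s
      using FTC[of s T] T that by (auto intro: integral_unique)
    ultimately have "((\<lambda>s. integral (cbox 0 T) (\<lambda>t. fv (x + s *\<^sub>R u + t *\<^sub>R v))) has_vector_derivative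
        fu (x + T *\<^sub>R v) - fu x) (at 0 within {-d..d})"
       "((\<lambda>s. integral (cbox 0 T) (\<lambda>t. fv (x + s *\<^sub>R u + t *\<^sub>R v))) has_vector_derivative
        integral (cbox 0 T) (\<lambda>t. fvu (x + t *\<^sub>R v))) (at 0 within {-d..d})"
      using \<open>d > 0\<close> by (auto intro: has_vector_derivative_transform[of 0 "{-d..d}"])
    from vector_derivative_unique_within[OF ntriv(1) this] show ?thesis by simp
  qed
  have "((\<lambda>T. integral {0..T} (\<lambda>t. fvu (x + t *\<^sub>R v))) has_vector_derivative fvu (x + 0 *\<^sub>R v)) (at 0 within {0..d})"
  proof (rule integral_has_vector_derivative)
    show "continuous_on {0..d} (\<lambda>t. fvu (x + t *\<^sub>R v))"
      using in_S[of 0] \<open>d > 0\<close> by (intro continuous_on_compose2[OF cont(1)] continuous_intros) auto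
  qed (use \<open>d > 0\<close> in auto)
  then have 0: "((\<lambda>T. integral {0..T} (\<lambda>t. fvu (x + t *\<^sub>R v))) has_vector_derivative fvu x) (at 0 within {0..d})"
    by simp
  have 1: "((\<lambda>T. fu (x + T *\<^sub>R v) - fu x) has_vector_derivative fvu x) (at 0 within {0..d})"
    by (rule has_vector_derivative_transform[OF _ _ 0]) (use \<open>d > 0\<close> key in auto)
  have "((\<lambda>t. x + t *\<^sub>R v) has_derivative (\<lambda>t. t *\<^sub>R v)) (at 0 within {0..d})"
    by (auto intro!: derivative_eq_intros)
  moreover have "(fu has_derivative frechet_derivative fu (at x)) (at (x + 0 *\<^sub>R v))"
    using fu[OF assms(2)] by simp
  ultimately have "((\<lambda>t. fu (x + t *\<^sub>R v)) has_derivative (\<lambda>t. frechet_derivative fu (at x) (t *\<^sub>R v))) (at 0 within {0..d})"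
    by (rule has_derivative_compose)
  then have "((\<lambda>t. fu (x + t *\<^sub>R v)) has_vector_derivative frechet_derivative fu (at x) v) (at 0 within {0..d})"
    unfolding has_vector_derivative_def
    by (simp add: has_derivative_scaleR_arg[OF fu[OF assms(2)]])
  then have "((\<lambda>t. fu (x + t *\<^sub>R v) - fu x) has_vector_derivative frechet_derivative fu (at x) v - 0) (at 0 within {0..d})"
    by (intro has_vector_derivative_diff) auto
  then have "fvu x = frechet_derivative fu (at x) v"
    using vector_derivative_unique_within[OF ntriv(2) 1] by simp
  then show ?thesis by (simp add: fvu_def fu_def[abs_def] fv_def[abs_def])
qed

lemma smooth_on_second_derivative_symmetric:
  fixes f :: "'a::real_normed_vector \<Rightarrow> 'b::banach"
  assumes "open S" "x \<in> S" "smooth_on S f"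
  shows "frechet_derivative (\<lambda>y. frechet_derivative f (at y) v) (at x) u =
         frechet_derivative (\<lambda>y. frechet_derivative f (at y) u) (at x) v"
  using assms by (intro second_derivative_symmetric) (auto simp: smooth_on_def)

section \<open>The operators $d^{A'}$\<close>

text \<open>Replaces the four cases of \<open>nabla\<close> by one shape. Coefficients and
  directions depend on neither \<open>f\<close> nor \<open>x\<close>, so smoothness and commutation
  are inherited from directional derivatives.\<close>

lemma nabla_eq_combination:
  "\<exists>c d i j. \<forall>(e :: nat \<Rightarrow> 'v::real_normed_vector) f x. nabla e a A f x =
      c * frechet_derivative f (at x) (e i) + d * frechet_derivative f (at x) (e j)"
proof -
  define t where "t = 4 * (A div 2)"
  consider "even A" "a = P0" | "even A" "a = P1" | "odd A" "a = P0" | "odd A" "a = P1"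
    by (cases a) auto
  then show ?thesis
  proof cases
    case 1
    then show ?thesis
      by (intro exI[of _ "-1"] exI[of _ "-\<i>"] exI[of _ "t + 2"] exI[of _ "t + 3"])
        (simp add: nabla_def Let_def t_def)
  next
    case 2
    then show ?thesis
      by (intro exI[of _ "-1"] exI[of _ "-\<i>"] exI[of _ "t"] exI[of _ "t + 1"])
        (simp add: nabla_def Let_def t_def)
  next
    case 3
    then show ?thesis
      by (intro exI[of _ "1"] exI[of _ "-\<i>"] exI[of _ "t"] exI[of _ "t + 1"])
        (simp add: nabla_def Let_def t_def)
  next
    case 4
    then show ?thesis
      by (intro exI[of _ "-1"] exI[of _ "\<i>"] exI[of _ "t + 2"] exI[of _ "t + 3"])
        (simp add: nabla_def Let_def t_def)
  qed
qed

lemma nabla_cong: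
  "open S \<Longrightarrow> x \<in> S \<Longrightarrow> (\<And>y. y \<in> S \<Longrightarrow> f y = g y) \<Longrightarrow> nabla e a A f x = nabla e a A g x"
  using frechet_derivative_cong[of S x f g] by (simp add: nabla_def)

lemma nabla_const [simp]: "nabla e a A (\<lambda>x. c) x = 0"
  by (simp add: nabla_def split: pidx.split)

lemma nabla_add:
  "f differentiable (at x) \<Longrightarrow> g differentiable (at x) \<Longrightarrow>
    nabla e a A (\<lambda>x. f x + g x) x = nabla e a A f x + nabla e a A g x"
  by (simp add: nabla_def Let_def frechet_derivative_eqI[OF has_derivative_add]
      frechet_derivative_works algebra_simps split: pidx.split)

lemma nabla_mult:
  "f differentiable (at x) \<Longrightarrow> g differentiable (at x) \<Longrightarrow>
    nabla e a A (\<lambda>x. f x * g x) x = f x * nabla e a A g x + nabla e a A f x * g x"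
  by (simp add: nabla_def Let_def frechet_derivative_eqI[OF has_derivative_mult]
      frechet_derivative_works algebra_simps split: pidx.split)

lemma nabla_cmult:
  "f differentiable (at x) \<Longrightarrow> nabla e a A (\<lambda>x. c * f x) x = c * nabla e a A f x"
  by (subst nabla_mult) auto

lemma nabla_sum:
  "(\<And>i. i \<in> I \<Longrightarrow> f i differentiable (at x)) \<Longrightarrow>
    nabla e a A (\<lambda>x. \<Sum>i\<in>I. f i x) x = (\<Sum>i\<in>I. nabla e a A (f i) x)"
proof (induction I rule: infinite_finite_induct)
  case (insert i I)
  then show ?case by (simp add: nabla_add)
qed auto

lemma smooth_on_nabla:
  assumes "open S" "smooth_on S f"
  shows "smooth_on S (nabla e a A f)"
proof -
  obtain c d i j where "nabla e a A f =
      (\<lambda>x. c * frechet_derivative f (at x) (e i) + d * frechet_derivative f (at x) (e j))"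
    using nabla_eq_combination[of a A] by meson
  then show ?thesis
    using assms by (auto intro!: smooth_on_add smooth_on_mult smooth_on_frechet_derivative)
qed

lemma nabla_commute:
  assumes S: "open S" "x \<in> S" and f: "smooth_on S f"
  shows "nabla e a A (nabla e b B f) x = nabla e b B (nabla e a A f) x"
proof -
  let ?D = "\<lambda>i x. frechet_derivative f (at x) (e i)"
  obtain c d i j where 1: "\<And>f x. nabla e a A f x =
      c * frechet_derivative f (at x) (e i) + d * frechet_derivative f (at x) (e j)"
    using nabla_eq_combination[of a A] by meson
  obtain c' d' i' j' where 2: "\<And>f x. nabla e b B f x =
      c' * frechet_derivative f (at x) (e i') + d' * frechet_derivative f (at x) (e j')"
    using nabla_eq_combination[of b B] by meson
  have diff: "?D i differentiable (at x)" for i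
    using smooth_on_imp_differentiable[OF smooth_on_frechet_derivative[OF f] S(2)] .
  have lin: "frechet_derivative (\<lambda>x. c * ?D i x + d * ?D j x) (at x) v =
      c * frechet_derivative (?D i) (at x) v + d * frechet_derivative (?D j) (at x) v" for c d i j v
    by (rule frechet_derivative_eqI)
      (auto intro!: derivative_eq_intros diff[unfolded frechet_derivative_works])
  have "nabla e a A (nabla e b B f) x = nabla e a A (\<lambda>x. c' * ?D i' x + d' * ?D j' x) x"
    using 2 by presburger
  also have "\<dots> = c * (c' * frechet_derivative (?D i') (at x) (e i) + d' * frechet_derivative (?D j') (at x) (e i))
      + d * (c' * frechet_derivative (?D i') (at x) (e j) + d' * frechet_derivative (?D j') (at x) (e j))"
    unfolding 1 lin ..
  also have "\<dots> = c' * (c * frechet_derivative (?D i) (at x) (e i') + d * frechet_derivative (?D j) (at x) (e i'))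
      + d' * (c * frechet_derivative (?D i) (at x) (e j') + d * frechet_derivative (?D j) (at x) (e j'))"
    unfolding smooth_on_second_derivative_symmetric[OF S f, of "e i'"]
      smooth_on_second_derivative_symmetric[OF S f, of "e j'"]
    by (simp add: algebra_simps)
  also have "\<dots> = nabla e b B (\<lambda>x. c * ?D i x + d * ?D j x) x"
    unfolding 2 lin ..
  also have "\<dots> = nabla e b B (nabla e a A f) x"
    using 1 by presburger
  finally show ?thesis .
qed

text \<open>The sign with which \<open>\<omega>\<^sup>A \<and> \<omega>\<^sup>J\<^sup>-\<^sup>A\<close> equals \<open>\<omega>\<^sup>J\<close>.\<close>

definition wsign :: "nat set \<Rightarrow> nat \<Rightarrow> complex" where
  "wsign J A = (-1) ^ card {l \<in> J. l < A}"

lemma wedge_basis_form: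
  assumes "finite J"
  shows "wedge (basis_form {A}) (basis_form I) J = (if A \<in> J \<and> I = J - {A} then wsign J A else 0)"
proof -
  have "wedge (basis_form {A}) (basis_form I) J = (\<Sum>I'\<in>Pow J. if I' = {A} then
      (-1) ^ card {(i, l). i \<in> {A} \<and> l \<in> J - {A} \<and> l < i} * (if J - {A} = I then 1 else 0) else 0)"
    unfolding wedge_def basis_form_def by (rule sum.cong) auto
  also have "\<dots> = (if A \<in> J \<and> I = J - {A}
      then (-1) ^ card {(i, l). i \<in> {A} \<and> l \<in> J - {A} \<and> l < i} else 0)"
    using assms by (subst sum.delta) auto
  also have "{(i, l). i \<in> {A} \<and> l \<in> J - {A} \<and> l < i} = Pair A ` {l \<in> J. l < A}"
    by auto
  finally show ?thesis
    by (simp add: wsign_def card_image inj_on_def)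
qed

lemma d_op_eq:
  "d_op n \<sigma> a f x J = (if J \<subseteq> {..<2*n} then
     (\<Sum>A\<in>J. wsign J A * nabla (frame \<sigma>) a A (\<lambda>y. f y (J - {A})) x) else 0)"
proof (cases "finite J")
  case False
  \<comment> \<open>For infinite \<open>J\<close> the sum over \<open>Pow J\<close> in
    \<open>wedge\<close> has the default value 0.\<close>
  then have "wedge (basis_form {A}) (basis_form I) J = 0" for A I
    by (simp add: wedge_def)
  with False show ?thesis by (auto simp: d_op_def dest: finite_subset)
next
  case True
  have "d_op n \<sigma> a f x J = (\<Sum>A<2*n. \<Sum>I\<in>Pow {..<2*n}. if I = J - {A} then
      (if A \<in> J then wsign J A * nabla (frame \<sigma>) a A (\<lambda>y. f y (J - {A})) x else 0) else 0)"
    unfolding d_op_def wedge_basis_form[OF True] by (intro sum.cong) auto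
  also have "\<dots> = (\<Sum>A<2*n. if A \<in> J \<and> J \<subseteq> {..<2*n} then
      wsign J A * nabla (frame \<sigma>) a A (\<lambda>y. f y (J - {A})) x else 0)"
    by (intro sum.cong refl, subst sum.delta) auto
  also have "\<dots> = (\<Sum>A\<in>{A\<in>{..<2*n}. A \<in> J \<and> J \<subseteq> {..<2*n}}.
      wsign J A * nabla (frame \<sigma>) a A (\<lambda>y. f y (J - {A})) x)"
    by (rule sum.inter_filter[symmetric]) simp
  also have "{A\<in>{..<2*n}. A \<in> J \<and> J \<subseteq> {..<2*n}} = (if J \<subseteq> {..<2*n} then J else {})"
    by auto
  finally show ?thesis by simp
qed

text \<open>Removing \<open>A\<close> changes the number of elements below \<open>B\<close> by one,
  while removing \<open>B\<close> leaves the number below \<open>A\<close> alone. This is the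
  anticommutation of two basis one-forms.\<close>

lemma wsign_swap:
  assumes "finite J" "A \<in> J" "B \<in> J" "A < B"
  shows "wsign J A * wsign (J - {A}) B = - (wsign J B * wsign (J - {B}) A)"
proof -
  have "{l \<in> J. l < B} = insert A {l \<in> J - {A}. l < B}"
    using assms by auto
  then have "wsign J B = - wsign (J - {A}) B"
    using assms by (simp add: wsign_def)
  moreover have "{l \<in> J - {B}. l < A} = {l \<in> J. l < A}"
    using assms by auto
  then have "wsign (J - {B}) A = wsign J A"
    by (simp add: wsign_def)
  ultimately show ?thesis by simp
qed

lemma d_op_cong:
  assumes "open S" "x \<in> S" "\<And>y I. y \<in> S \<Longrightarrow> f y I = g y I"
  shows "d_op n \<sigma> a f x J = d_op n \<sigma> a g x J"
proof -
  have "nabla (frame \<sigma>) a A (\<lambda>y. f y I) x = nabla (frame \<sigma>) a A (\<lambda>y. g y I) x" for A I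
    by (rule nabla_cong[OF assms(1,2)]) (simp add: assms(3))
  then show ?thesis by (simp add: d_op_eq)
qed

lemma d_op_zero: "d_op n \<sigma> a (\<lambda>y I. 0) x J = 0"
  by (simp add: d_op_eq)

lemma smooth_on_d_op:
  "open S \<Longrightarrow> (\<And>I. smooth_on S (\<lambda>y. f y I)) \<Longrightarrow> smooth_on S (\<lambda>x. d_op n \<sigma> a f x J)"
  unfolding d_op_eq
  by (cases "J \<subseteq> {..<2*n}") (auto intro!: smooth_on_sum smooth_on_mult smooth_on_nabla)

lemma d_op_add:
  assumes "\<And>I. (\<lambda>y. f y I) differentiable (at x)" "\<And>I. (\<lambda>y. g y I) differentiable (at x)"
  shows "d_op n \<sigma> a (\<lambda>y I. f y I + g y I) x J = d_op n \<sigma> a f x J + d_op n \<sigma> a g x J"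
  using assms by (simp add: d_op_eq nabla_add distrib_left sum.distrib)

lemma d_op_cmult:
  assumes "\<And>I. (\<lambda>y. f y I) differentiable (at x)"
  shows "d_op n \<sigma> a (\<lambda>y I. c * f y I) x J = c * d_op n \<sigma> a f x J"
  using assms by (simp add: d_op_eq nabla_cmult sum_distrib_left mult.left_commute)

lemma d_op_mult:
  assumes "z differentiable (at x)" "\<And>I. (\<lambda>y. f y I) differentiable (at x)"
  shows "d_op n \<sigma> a (\<lambda>y I. z y * f y I) x J = z x * d_op n \<sigma> a f x J +
    (if J \<subseteq> {..<2*n} then \<Sum>A\<in>J. wsign J A * (nabla (frame \<sigma>) a A z x * f x (J - {A})) else 0)"
  using assms by (simp add: d_op_eq nabla_mult distrib_left sum.distrib sum_distrib_left mult.left_commute)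

text \<open>Both sides are sums over ordered pairs of distinct elements of \<open>J\<close>.
  Exchanging the two elements keeps the second-order derivative, by \<open>nabla_commute\<close>,
  and reverses the sign, by \<open>wsign_swap\<close>.\<close>

lemma d_op_anticommute:
  assumes S: "open S" "x \<in> S" and f: "\<And>I. smooth_on S (\<lambda>y. f y I)"
  shows "d_op n \<sigma> a (d_op n \<sigma> b f) x J = - d_op n \<sigma> b (d_op n \<sigma> a f) x J"
proof (cases "J \<subseteq> {..<2*n}")
  case True
  then have fin: "finite J" by (rule finite_subset) simp
  define N where "N a A b B = wsign J A * wsign (J - {A}) B *
    nabla (frame \<sigma>) a A (nabla (frame \<sigma>) b B (\<lambda>y. f y (J - {A} - {B}))) x" for a A b B
  have expand: "d_op n \<sigma> a (d_op n \<sigma> b f) x J = (\<Sum>A\<in>J. \<Sum>B\<in>J - {A}. N a A b B)" for a b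
  proof -
    have "nabla (frame \<sigma>) a A (\<lambda>y. d_op n \<sigma> b f y (J - {A})) x =
        (\<Sum>B\<in>J - {A}. wsign (J - {A}) B *
          nabla (frame \<sigma>) a A (nabla (frame \<sigma>) b B (\<lambda>y. f y (J - {A} - {B}))) x)" for A
    proof -
      have diff: "(\<lambda>y. nabla (frame \<sigma>) b B (\<lambda>y. f y I) y) differentiable (at x)" for B I
        using smooth_on_imp_differentiable[OF smooth_on_nabla[OF S(1) f] S(2)] .
      have "J - {A} \<subseteq> {..<2*n}" using True by auto
      then have "nabla (frame \<sigma>) a A (\<lambda>y. d_op n \<sigma> b f y (J - {A})) x =
        nabla (frame \<sigma>) a A (\<lambda>y. \<Sum>B\<in>J - {A}. wsign (J - {A}) B *
          nabla (frame \<sigma>) b B (\<lambda>y. f y (J - {A} - {B})) y) x"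
        by (simp add: d_op_eq)
      also have "\<dots> = (\<Sum>B\<in>J - {A}. nabla (frame \<sigma>) a A (\<lambda>y. wsign (J - {A}) B *
          nabla (frame \<sigma>) b B (\<lambda>y. f y (J - {A} - {B})) y) x)"
        using diff by (intro nabla_sum differentiable_mult) auto
      finally show ?thesis using nabla_cmult[OF diff] by simp
    qed
    then show ?thesis
      using True by (simp add: d_op_eq[of n \<sigma> a] sum_distrib_left N_def mult.assoc)
  qed
  have swap: "N a A b B = - N b B a A" if "A \<in> J" "B \<in> J - {A}" for A B
  proof -
    have "J - {A} - {B} = J - {B} - {A}" by auto
    moreover have "wsign J A * wsign (J - {A}) B = - (wsign J B * wsign (J - {B}) A)"
      using wsign_swap[of J A B] wsign_swap[of J B A] that fin
      by (cases "A < B") auto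
    ultimately show ?thesis
      unfolding N_def using nabla_commute[OF S f, of "frame \<sigma>" a A b B "J - {A} - {B}"] by simp
  qed
  have "d_op n \<sigma> a (d_op n \<sigma> b f) x J = (\<Sum>A\<in>J. \<Sum>B | B \<in> J \<and> B \<noteq> A. - N b B a A)"
    unfolding expand using swap by (intro sum.cong) auto
  also have "\<dots> = (\<Sum>B\<in>J. \<Sum>A | A \<in> J \<and> B \<noteq> A. - N b B a A)"
    using fin by (rule sum.swap_restrict[OF fin])
  also have "\<dots> = - (\<Sum>B\<in>J. \<Sum>A\<in>J - {B}. N b B a A)"
    by (simp add: sum_negf[symmetric]) (intro sum.cong, auto)
  finally show ?thesis by (simp add: expand)
qed (simp add: d_op_eq)

lemma d_op_d_op_same:
  assumes "open S" "x \<in> S" "\<And>I. smooth_on S (\<lambda>y. f y I)"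
  shows "d_op n \<sigma> a (d_op n \<sigma> a f) x J = 0"
  using d_op_anticommute[OF assms, where a=a and b=a and n=n and J=J] by simp

section \<open>Bump functions\<close>

text \<open>The powers of \<open>1 / t\<close> are included because the family is then closed, up to
  linear combinations, under differentiation; smoothness becomes an induction on the order for all
  \<open>n\<close> at once.\<close>

definition flat_exp :: "nat \<Rightarrow> real \<Rightarrow> real" where
  "flat_exp n t = (if t \<le> 0 then 0 else inverse t ^ n * exp (- inverse t))"

lemma tendsto_flat_exp_at_0: "(flat_exp n \<longlongrightarrow> 0) (at 0)"
proof (rule filterlim_split_at)
  have "\<forall>\<^sub>F t in at_left 0. 0 = flat_exp n t"
    by (simp add: eventually_at_filter flat_exp_def)
  then show "(flat_exp n \<longlongrightarrow> 0) (at_left 0)"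
    by (rule Lim_transform_eventually[OF tendsto_const])
  have "((\<lambda>t. inverse t ^ n / exp (inverse t)) \<longlongrightarrow> (0::real)) (at_right 0)"
    by (rule filterlim_compose[OF tendsto_power_div_exp_0 filterlim_inverse_at_top_right])
  moreover have "\<forall>\<^sub>F t in at_right 0. inverse t ^ n / exp (inverse t) = flat_exp n t"
    using eventually_at_right_less[of "0::real"]
    by (rule eventually_mono) (simp add: flat_exp_def exp_minus divide_inverse)
  ultimately show "(flat_exp n \<longlongrightarrow> 0) (at_right 0)"
    by (rule Lim_transform_eventually)
qed

lemma flat_exp_derivative:
  "(flat_exp n has_real_derivative flat_exp (n + 2) t - of_nat n * flat_exp (n + 1) t) (at t)"
proof -
  consider "t < 0" | "t > 0" | "t = 0" by linarith
  then show ?thesis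
  proof cases
    case 1
    have "((\<lambda>t. 0) has_real_derivative 0) (at t)" by simp
    then have "(flat_exp n has_real_derivative 0) (at t)"
      by (rule has_field_derivative_transform_within_open[where S="{..<0}"]) (use 1 in \<open>auto simp: flat_exp_def\<close>)
    with 1 show ?thesis by (simp add: flat_exp_def)
  next
    case 2
    have "((\<lambda>t. inverse t ^ n * exp (- inverse t)) has_real_derivative
        inverse t ^ (n + 2) * exp (- inverse t) - of_nat n * (inverse t ^ (n + 1) * exp (- inverse t))) (at t)"
    proof -
      have "m \<noteq> 0 \<Longrightarrow> t ^ m = t * t ^ (m - Suc 0)" for m
        by (cases m) auto
      then show ?thesis
        using 2 by (cases n)
          (auto intro!: derivative_eq_intros simp: field_simps power2_eq_square, metis not_gr_zero)
    qed
    then have "(flat_exp n has_real_derivative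
        inverse t ^ (n + 2) * exp (- inverse t) - of_nat n * (inverse t ^ (n + 1) * exp (- inverse t))) (at t)"
      by (rule has_field_derivative_transform_within_open[where S="{0<..}"]) (use 2 in \<open>auto simp: flat_exp_def\<close>)
    with 2 show ?thesis by (simp add: flat_exp_def)
  next
    case 3
    \<comment> \<open>The difference quotient at 0 is the next member of the family, so its limit is
      already known.\<close>
    have "(flat_exp n (0 + h) - flat_exp n 0) / h = flat_exp (Suc n) h" for h
      by (simp add: flat_exp_def divide_inverse)
    then have "(flat_exp n has_real_derivative 0) (at 0)"
      using tendsto_flat_exp_at_0[of "Suc n"] by (simp add: DERIV_def)
    with 3 show ?thesis by (simp add: flat_exp_def)
  qed
qed

lemma smooth_on_flat_exp: "smooth_on UNIV (flat_exp n)"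
proof -
  have "Ck_on r UNIV (flat_exp n)" for r
  proof (induction r arbitrary: n)
    case 0
    have "isCont (flat_exp n) t" for t
      using flat_exp_derivative by (rule DERIV_isCont)
    then show ?case by (simp add: continuous_at_imp_continuous_on)
  next
    case (Suc r)
    have "(flat_exp n has_derivative (\<lambda>v. (flat_exp (n + 2) t - of_nat n * flat_exp (n + 1) t) * v)) (at t)" for t
      using flat_exp_derivative[of n t] unfolding has_field_derivative_def .
    moreover
    have "Ck_on r UNIV (\<lambda>t. (flat_exp (n + 2) t + (- of_nat n) * flat_exp (n + 1) t) * v)" for v
      by (intro Ck_on_mult Ck_on_add Ck_on_const Suc.IH open_UNIV)
    then have "Ck_on r UNIV (\<lambda>t. (flat_exp (n + 2) t - of_nat n * flat_exp (n + 1) t) * v)" for v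
      by simp
    ultimately show ?case by (rule Ck_on_SucI[OF open_UNIV])
  qed
  then show ?thesis by (simp add: smooth_on_def)
qed

lemma flat_exp_nonneg: "flat_exp n t \<ge> 0"
  by (simp add: flat_exp_def)

lemma flat_exp_pos: "t > 0 \<Longrightarrow> flat_exp n t > 0"
  by (simp add: flat_exp_def)

lemma flat_exp_nonpos: "t \<le> 0 \<Longrightarrow> flat_exp n t = 0"
  by (simp add: flat_exp_def)

lemma smooth_on_inner_self: "smooth_on S (\<lambda>x::'a::real_inner. x \<bullet> x)"
proof -
  have "smooth_on UNIV (\<lambda>x::'a. x \<bullet> x)"
    by (rule smooth_on_bilinear[OF open_UNIV bounded_bilinear_inner])
      (rule smooth_on_bounded_linear[OF bounded_linear_ident])+
  then show ?thesis using smooth_on_subset by blast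
qed

text \<open>The index 2 is taken because \<open>flat_exp 2\<close> is the derivative of
  \<open>flat_exp 0\<close>: it makes \<open>ball_kernel r y\<close> times \<open>y\<close> the
  gradient of a function supported in the same ball. The kernel is not normalized; means are divided
  by its integral where required.\<close>

definition ball_kernel :: "real \<Rightarrow> 'a::euclidean_space \<Rightarrow> real" where
  "ball_kernel r y = flat_exp 2 (r\<^sup>2 - y \<bullet> y)"

lemma smooth_on_ball_kernel: "smooth_on UNIV (ball_kernel r)"
  unfolding ball_kernel_def
  by (rule smooth_on_compose_real[OF open_UNIV smooth_on_flat_exp])
    (intro smooth_on_diff smooth_on_const smooth_on_inner_self open_UNIV)

lemma ball_kernel_eq_0: "r \<ge> 0 \<Longrightarrow> norm y \<ge> r \<Longrightarrow> ball_kernel r y = 0"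
  unfolding ball_kernel_def using power_mono[of r "norm y" 2]
  by (intro flat_exp_nonpos) (simp add: power2_norm_eq_inner)

lemma ball_kernel_nonneg: "ball_kernel r y \<ge> 0"
  by (simp add: ball_kernel_def flat_exp_nonneg)

lemma mem_cbox_if_norm_le: "norm (y::'a::euclidean_space) \<le> r \<Longrightarrow> y \<in> cbox (- r *\<^sub>R One) (r *\<^sub>R One)"
proof -
  assume "norm y \<le> r"
  then have "\<bar>y \<bullet> i\<bar> \<le> r" if "i \<in> Basis" for i
    using Basis_le_norm[OF that, of y] by linarith
  then show ?thesis by (auto simp: mem_box abs_le_iff) (smt (verit))
qed

lemma integral_ball_kernel_pos:
  assumes "r > 0"
  shows "integral (cbox (- r *\<^sub>R One) (r *\<^sub>R One)) (ball_kernel r :: 'a::euclidean_space \<Rightarrow> real) > 0"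
proof -
  let ?B = "cbox (- r *\<^sub>R One) (r *\<^sub>R One :: 'a)"
  have cont: "continuous_on ?B (ball_kernel r)"
    using smooth_on_imp_continuous_on[OF smooth_on_ball_kernel] continuous_on_subset by blast
  have "integral ?B (ball_kernel r) \<noteq> 0"
  proof
    assume "integral ?B (ball_kernel r) = 0"
    then have "(ball_kernel r has_integral 0) ?B"
      using integrable_integral[OF integrable_continuous[OF cont]] by simp
    moreover have "(0::'a) \<in> ?B" using assms by (intro mem_cbox_if_norm_le) simp
    moreover have "box (- r *\<^sub>R One) (r *\<^sub>R One :: 'a) \<noteq> {}" using assms by (simp add: box_ne_empty)
    ultimately have "ball_kernel r (0::'a) = 0"
      using has_integral_0_cbox_imp_0[OF cont] ball_kernel_nonneg by blast
    then show False using flat_exp_pos[of "r\<^sup>2" 2] assms by (simp add: ball_kernel_def)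
  qed
  moreover have "integral ?B (ball_kernel r) \<ge> 0"
    by (intro integral_nonneg integrable_continuous cont) (rule ball_kernel_nonneg)
  ultimately show ?thesis by linarith
qed

section \<open>Convolution\<close>

text \<open>Since \<open>x\<close> enters only through the kernel, all differentiation falls on
  \<kappa>, and continuity of \<open>f\<close> is enough.\<close>

lemma convolution_has_derivative:
  fixes f :: "'a::euclidean_space \<Rightarrow> 'b::banach" and \<kappa> :: "'a \<Rightarrow> real"
  assumes f: "continuous_on (cbox c d) f" and \<kappa>: "smooth_on UNIV \<kappa>"
  shows "((\<lambda>x. integral (cbox c d) (\<lambda>p. \<kappa> (p - x) *\<^sub>R f p)) has_derivative
    (\<lambda>v. integral (cbox c d) (\<lambda>p. (- frechet_derivative \<kappa> (at (p - x)) v) *\<^sub>R f p))) (at x)"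
proof -
  let ?D = "\<lambda>y. frechet_derivative \<kappa> (at y)"
  have D: "(\<kappa> has_derivative ?D y) (at y)" for y
    using smooth_on_imp_has_derivative[OF \<kappa>] by simp
  have bl: "bounded_linear (\<lambda>v. (- ?D y v) *\<^sub>R b)" for y and b :: 'b
    by (intro bounded_linear_scaleR_const bounded_linear_minus has_derivative_bounded_linear[OF D])
  \<comment> \<open>The Leibniz rule for a vector parameter wants the derivative as a continuous
    function into the bounded linear maps; in finite dimension this continuity can be checked for
    each fixed \<open>v\<close>.\<close>
  define g where "g x p = Blinfun (\<lambda>v. (- ?D (p - x) v) *\<^sub>R f p)" for x p
  have g: "blinfun_apply (g x p) = (\<lambda>v. (- ?D (p - x) v) *\<^sub>R f p)" for x p
    unfolding g_def by (rule bounded_linear_Blinfun_apply[OF bl])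
  have cont\<kappa>: "continuous_on UNIV \<kappa>" "\<And>v. continuous_on UNIV (\<lambda>y. ?D y v)"
    using smooth_on_imp_continuous_on \<kappa> smooth_on_frechet_derivative by blast+
  have contg: "continuous_on (UNIV \<times> cbox c d) (\<lambda>(x, p). g x p)"
  proof (rule continuous_on_blinfun_componentwise)
    fix v :: 'a
    have "continuous_on (UNIV \<times> cbox c d) (\<lambda>z. (- ?D (snd z - fst z) v) *\<^sub>R f (snd z))"
      by (intro continuous_intros continuous_on_compose2[OF cont\<kappa>(2)] continuous_on_compose2[OF f]) auto
    then show "continuous_on (UNIV \<times> cbox c d) (\<lambda>z. blinfun_apply (case z of (x, p) \<Rightarrow> g x p) v)"
      by (simp add: case_prod_unfold g)
  qed
  have "((\<lambda>x. integral (cbox c d) (\<lambda>p. \<kappa> (p - x) *\<^sub>R f p)) has_derivative integral (cbox c d) (g x)) (at x within UNIV)"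
  proof (rule leibniz_rule[OF _ _ contg])
    fix x p assume "p \<in> cbox c d"
    have "((\<lambda>x. p - x) has_derivative (\<lambda>v. - v)) (at x within UNIV)"
      by (auto intro!: derivative_eq_intros)
    from has_derivative_compose[OF this D]
    have "((\<lambda>x. \<kappa> (p - x)) has_derivative (\<lambda>v. ?D (p - x) (- v))) (at x within UNIV)" .
    moreover have "?D (p - x) (- v) = - ?D (p - x) v" for v
      using has_derivative_scaleR_arg[OF D, of "p - x" "-1" v] by simp
    ultimately have "((\<lambda>x. \<kappa> (p - x)) has_derivative (\<lambda>v. - ?D (p - x) v)) (at x within UNIV)"
      by simp
    then show "((\<lambda>x. \<kappa> (p - x) *\<^sub>R f p) has_derivative blinfun_apply (g x p)) (at x within UNIV)"
      unfolding g by (rule has_derivative_scaleR_left)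
  next
    fix x :: 'a
    show "(\<lambda>p. \<kappa> (p - x) *\<^sub>R f p) integrable_on cbox c d"
      by (intro integrable_continuous continuous_intros continuous_on_compose2[OF cont\<kappa>(1)] f) auto
  qed auto
  moreover have "blinfun_apply (integral (cbox c d) (g x)) v = integral (cbox c d) (\<lambda>p. (- ?D (p - x) v) *\<^sub>R f p)" for v
  proof -
    have "continuous_on (cbox c d) (\<lambda>p. (\<lambda>(x, p). g x p) (x, p))"
      by (rule continuous_on_compose2[OF contg]) (auto intro!: continuous_intros)
    then have "g x integrable_on cbox c d" by (intro integrable_continuous) simp
    from integral_linear[OF this blinfun.bounded_linear_left[of v]] show ?thesis
      by (simp add: o_def g)
  qed
  then have "blinfun_apply (integral (cbox c d) (g x)) = (\<lambda>v. integral (cbox c d) (\<lambda>p. (- ?D (p - x) v) *\<^sub>R f p))"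
    by (rule ext)
  ultimately show ?thesis by simp
qed

lemma smooth_on_convolution:
  fixes f :: "'a::euclidean_space \<Rightarrow> 'b::banach" and \<kappa> :: "'a \<Rightarrow> real"
  assumes f: "continuous_on (cbox c d) f" and \<kappa>: "smooth_on UNIV \<kappa>"
  shows "smooth_on UNIV (\<lambda>x. integral (cbox c d) (\<lambda>p. \<kappa> (p - x) *\<^sub>R f p))"
proof -
  have "Ck_on r UNIV (\<lambda>x. integral (cbox c d) (\<lambda>p. \<kappa> (p - x) *\<^sub>R f p))" for r
    using \<kappa>
  proof (induction r arbitrary: \<kappa>)
    case 0
    have "isCont (\<lambda>x. integral (cbox c d) (\<lambda>p. \<kappa> (p - x) *\<^sub>R f p)) x" for x
      by (rule has_derivative_continuous[OF convolution_has_derivative[OF f 0]])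
    then show ?case by (simp add: continuous_at_imp_continuous_on)
  next
    case (Suc r)
    show ?case
    proof (rule Ck_on_SucI[OF open_UNIV convolution_has_derivative[OF f Suc.prems]])
      fix v
      show "Ck_on r UNIV (\<lambda>x. integral (cbox c d) (\<lambda>p. (- frechet_derivative \<kappa> (at (p - x)) v) *\<^sub>R f p))"
        by (rule Suc.IH) (intro smooth_on_minus smooth_on_frechet_derivative Suc.prems open_UNIV)
    qed
  qed
  then show ?thesis by (simp add: smooth_on_def)
qed

text \<open>Substituting \<open>p = x + y\<close> turns the mean into a convolution, but over a box
  that moves with \<open>x\<close>. Near a given \<open>x0\<close> it may be replaced by one fixed
  larger box, because the kernel vanishes outside the ball; the larger box must stay inside
  \<open>S\<close>, where \<open>f\<close> is continuous.\<close>

lemma smooth_on_ball_mean: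
  fixes f :: "'a::euclidean_space \<Rightarrow> 'b::banach"
  assumes "r > 0" and S: "open S" "continuous_on S f" 
    and T: "open T" "\<And>x y. x \<in> T \<Longrightarrow> y \<in> cbox (- r *\<^sub>R One) (r *\<^sub>R One) \<Longrightarrow> x + y \<in> S"
  shows "smooth_on T (\<lambda>x. integral (cbox (- r *\<^sub>R One) (r *\<^sub>R One)) (\<lambda>y. ball_kernel r y *\<^sub>R f (x + y)))"
    (is "smooth_on T ?M")
proof (rule smooth_on_local)
  fix x0 assume x0: "x0 \<in> T"
  let ?B = "\<lambda>r. cbox (- r *\<^sub>R One) (r *\<^sub>R One :: 'a)"
  let ?K = "(+) x0 ` ?B r"
  have "compact ?K" "?K \<subseteq> S" using T(2)[OF x0] by (auto intro: compact_translation)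
  then obtain e where e: "e > 0" "{y. infdist y ?K \<le> e} \<subseteq> S"
    using compact_in_open_separated[of ?K S] S(1) assms(1) by (auto simp: box_ne_empty)
  \<comment> \<open>A vector with all coordinates bounded by \<open>s\<close> has norm at most
    \<open>DIM('a)\<close> times \<open>s\<close>, that is \<open>e\<close>; so widening the cube by
    \<open>s\<close> on each side does not leave \<open>S\<close>.\<close>
  define s where "s = e / real DIM('a)"
  have s: "s > 0" "s * DIM('a) \<le> e" using e(1) by (simp_all add: s_def)
  define c where "c = x0 + (- (r + s)) *\<^sub>R (One :: 'a)"
  define d where "d = x0 + (r + s) *\<^sub>R (One :: 'a)"
  have cd: "cbox c d \<subseteq> S"
  proof
    fix p assume p: "p \<in> cbox c d"
    \<comment> \<open>Truncating the coordinates gives the point of the cube nearest to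
      \<open>p - x0\<close>.\<close>
    define q where "q = (\<Sum>i\<in>Basis. max (- r) (min r ((p - x0) \<bullet> i)) *\<^sub>R i)"
    have q: "q \<bullet> i = max (- r) (min r ((p - x0) \<bullet> i))" if "i \<in> Basis" for i
      using that by (simp add: q_def)
    have "q \<in> ?B r" using assms(1) by (auto simp: mem_box q)
    then have K: "x0 + q \<in> ?K" by blast
    have "\<bar>(p - (x0 + q)) \<bullet> i\<bar> \<le> s" if i: "i \<in> Basis" for i
    proof -
      have "- (r + s) \<le> (p - x0) \<bullet> i" "(p - x0) \<bullet> i \<le> r + s"
        using p i by (auto simp: mem_box c_def d_def inner_diff_left inner_add_left algebra_simps)
      moreover have "(p - (x0 + q)) \<bullet> i = (p - x0) \<bullet> i - q \<bullet> i" by (simp add: inner_diff_left inner_add_left)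
      ultimately show ?thesis using q[OF i] assms(1) s(1) by (auto simp: max_def min_def split: if_splits)
    qed
    then have "norm (p - (x0 + q)) \<le> (\<Sum>i\<in>(Basis::'a set). s)"
      by (intro order.trans[OF norm_le_l1] sum_mono) auto
    then have "dist p (x0 + q) \<le> e" using s(2) by (simp add: dist_norm mult.commute)
    then have "infdist p ?K \<le> e" using infdist_le[OF K, of p] by linarith
    then show "p \<in> S" using e(2) by blast
  qed
  define U where "U = T \<inter> ball x0 s"
  have eq: "?M x = integral (cbox c d) (\<lambda>p. ball_kernel r (p - x) *\<^sub>R f p)" if x: "x \<in> U" for x
  proof -
    have "?M x = integral (?B r) ((\<lambda>p. ball_kernel r (p - x) *\<^sub>R f p) \<circ> (+) x)"
      by (simp add: o_def)
    also have "\<dots> = integral (cbox (- r *\<^sub>R One + x) (r *\<^sub>R One + x)) (\<lambda>p. ball_kernel r (p - x) *\<^sub>R f p)"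
      by (rule integral_shift_cbox_plus)
    also have "\<dots> = integral (cbox c d) (\<lambda>p. if p \<in> cbox (- r *\<^sub>R One + x) (r *\<^sub>R One + x) then ball_kernel r (p - x) *\<^sub>R f p else 0)"
    proof -
      have "cbox (- r *\<^sub>R One + x) (r *\<^sub>R One + x) \<subseteq> cbox c d"
      proof (rule subset_box_imp(1)[OF ballI])
        fix i :: 'a assume i: "i \<in> Basis"
        have "\<bar>(x - x0) \<bullet> i\<bar> \<le> s"
          using x Basis_le_norm[OF i, of "x - x0"] by (auto simp: U_def dist_norm norm_minus_commute)
        then show "c \<bullet> i \<le> (- r *\<^sub>R One + x) \<bullet> i \<and> (r *\<^sub>R One + x) \<bullet> i \<le> d \<bullet> i"
          using i by (auto simp: c_def d_def inner_diff_left inner_add_left abs_le_iff)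
      qed
      then show ?thesis by (subst integral_restrict_Int) (simp add: Int_absorb2)
    qed
    also have "\<dots> = integral (cbox c d) (\<lambda>p. ball_kernel r (p - x) *\<^sub>R f p)"
    proof (rule integral_cong)
      fix p
      have "p \<in> cbox (- r *\<^sub>R One + x) (r *\<^sub>R One + x)" if "norm (p - x) \<le> r"
        using mem_cbox_if_norm_le[OF that] by (auto simp: mem_box inner_diff_left inner_add_left algebra_simps)
      then show "(if p \<in> cbox (- r *\<^sub>R One + x) (r *\<^sub>R One + x) then ball_kernel r (p - x) *\<^sub>R f p else 0) =
          ball_kernel r (p - x) *\<^sub>R f p"
        using ball_kernel_eq_0[of r "p - x"] assms(1) by (cases "norm (p - x) \<le> r") simp_all
    qed
    finally show ?thesis .
  qed
  have "open U" "x0 \<in> U" using T(1) x0 s(1) by (auto simp: U_def)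
  moreover have "smooth_on U (\<lambda>x. integral (cbox c d) (\<lambda>p. ball_kernel r (p - x) *\<^sub>R f p))"
    by (rule smooth_on_subset[OF smooth_on_convolution[OF continuous_on_subset[OF S(2) cd] smooth_on_ball_kernel]]) simp
  then have "smooth_on U ?M"
    using smooth_on_cong[OF \<open>open U\<close> eq] by simp
  ultimately show "\<exists>U. open U \<and> x0 \<in> U \<and> smooth_on U ?M" by blast
qed

section \<open>Integrals of derivatives and integration by parts\<close>

lemma integral_eq_on_superset:
  fixes f :: "'a::euclidean_space \<Rightarrow> 'b::banach"
  assumes "S \<subseteq> T" "\<And>x. x \<notin> S \<Longrightarrow> f x = 0"
  shows "integral T f = integral S f"
proof -
  have "integral T f = integral T (\<lambda>x. if x \<in> S then f x else 0)"
    using assms(2) by (intro integral_cong) auto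
  also have "\<dots> = integral S f"
    using assms(1) by (subst integral_restrict_Int) (simp add: Int_absorb2)
  finally show ?thesis .
qed

text \<open>Translating the function along \<open>v\<close> does not change its integral.\<close>

lemma integral_derivative_eq_0:
  fixes f :: "'a::euclidean_space \<Rightarrow> 'b::banach"
  assumes f: "\<And>x. (f has_derivative f' x) (at x)"
    and cont: "continuous_on UNIV (\<lambda>x. f' x v)"
    and supp: "\<And>x. x \<notin> cbox a b \<Longrightarrow> f x = 0"
  shows "integral (cbox a b) (\<lambda>x. f' x v) = 0"
proof -
  \<comment> \<open>The box from \<open>c\<close> to \<open>d\<close> contains the supports of all
    translates by \<open>t v\<close> with \<bar>t\<bar> \<le> 1, so the domain of integration need
    not depend on \<open>t\<close>.\<close>
  define c where "c = a - norm v *\<^sub>R One"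
  define d where "d = b + norm v *\<^sub>R One"
  have sub: "cbox (a - t *\<^sub>R v) (b - t *\<^sub>R v) \<subseteq> cbox c d" if t: "\<bar>t\<bar> \<le> 1" for t
  proof (rule subset_box_imp(1)[OF ballI])
    fix i :: 'a assume i: "i \<in> Basis"
    have "\<bar>t * (v \<bullet> i)\<bar> \<le> 1 * norm v"
      unfolding abs_mult using t Basis_le_norm[OF i, of v] by (intro mult_mono) auto
    then show "c \<bullet> i \<le> (a - t *\<^sub>R v) \<bullet> i \<and> (b - t *\<^sub>R v) \<bullet> i \<le> d \<bullet> i"
      using i by (auto simp: c_def d_def inner_diff_left inner_add_left abs_le_iff)
  qed
  have contf: "continuous_on UNIV f"
    using has_derivative_continuous[OF f] by (simp add: continuous_at_imp_continuous_on)
  have const: "integral (cbox c d) (\<lambda>y. f (y + t *\<^sub>R v)) = integral (cbox a b) f" if t: "\<bar>t\<bar> \<le> 1" for t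
  proof -
    have "integral (cbox c d) (\<lambda>y. f (y + t *\<^sub>R v)) = integral (cbox (a - t *\<^sub>R v) (b - t *\<^sub>R v)) (\<lambda>y. f (y + t *\<^sub>R v))"
    proof (rule integral_eq_on_superset[OF sub[OF t]])
      fix y assume "y \<notin> cbox (a - t *\<^sub>R v) (b - t *\<^sub>R v)"
      then have "y + t *\<^sub>R v \<notin> cbox a b"
        by (auto simp: mem_box inner_diff_left inner_add_left algebra_simps)
      then show "f (y + t *\<^sub>R v) = 0" by (rule supp)
    qed
    also have "\<dots> = integral (cbox a b) f"
      using integral_shift_cbox_plus[of "a - t *\<^sub>R v" "b - t *\<^sub>R v" f "t *\<^sub>R v"] by (simp add: o_def add.commute)
    finally show ?thesis .
  qed
  have "((\<lambda>t. integral (cbox c d) (\<lambda>y. f (y + t *\<^sub>R v))) has_vector_derivative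
      integral (cbox c d) (\<lambda>y. f' (y + 0 *\<^sub>R v) v)) (at 0 within {-1..1})"
  proof (rule leibniz_rule_vector_derivative)
    fix t and y :: 'a
    have "((\<lambda>t. y + t *\<^sub>R v) has_derivative (\<lambda>t. t *\<^sub>R v)) (at t within {-1..1})"
      by (auto intro!: derivative_eq_intros)
    from has_derivative_compose[OF this f]
    show "((\<lambda>t. f (y + t *\<^sub>R v)) has_vector_derivative f' (y + t *\<^sub>R v) v) (at t within {-1..1})"
      unfolding has_vector_derivative_def by (simp add: has_derivative_scaleR_arg[OF f])
  next
    fix t
    show "(\<lambda>y. f (y + t *\<^sub>R v)) integrable_on cbox c d"
      by (intro integrable_continuous continuous_on_compose2[OF contf] continuous_intros) auto
  next
    have "continuous_on ({-1..1} \<times> cbox c d) (\<lambda>z. f' (snd z + fst z *\<^sub>R v) v)"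
      by (intro continuous_on_compose2[OF cont] continuous_intros) auto
    then show "continuous_on ({-1..1} \<times> cbox c d) (\<lambda>(t, y). f' (y + t *\<^sub>R v) v)"
      by (simp add: case_prod_unfold)
  qed auto
  moreover have "((\<lambda>t. integral (cbox c d) (\<lambda>y. f (y + t *\<^sub>R v))) has_vector_derivative 0) (at 0 within {-1..1})"
    by (rule has_vector_derivative_transform[OF _ _ has_vector_derivative_const[of "integral (cbox a b) f"]])
      (auto simp: const)
  moreover have "at (0::real) within {-1..1} \<noteq> bot"
    by (simp add: trivial_limit_within islimpt_Icc)
  ultimately have "integral (cbox c d) (\<lambda>y. f' y v) = 0"
    using vector_derivative_unique_within by fastforce
  moreover have "integral (cbox c d) (\<lambda>y. f' y v) = integral (cbox a b) (\<lambda>y. f' y v)"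
  proof (rule integral_eq_on_superset)
    show "cbox a b \<subseteq> cbox c d" using sub[of 0] by simp
    fix x assume x: "x \<notin> cbox a b"
    have "((\<lambda>x. 0) has_derivative (\<lambda>v. 0)) (at x)" by simp
    then have "(f has_derivative (\<lambda>v. 0)) (at x)"
      by (rule has_derivative_transform_within_open[where s="- cbox a b"]) (use x supp in auto)
    then show "f' x v = 0" using has_derivative_unique[OF f] by metis
  qed
  ultimately show ?thesis by simp
qed

text \<open>Reduces to functions on the whole space by extension by zero: \<open>S\<close> and the
  complement of \<open>K\<close> form an open cover, and the extension is differentiable on
  both.\<close>

lemma integral_derivative_eq_0_on:
  fixes f :: "'a::euclidean_space \<Rightarrow> 'b::banach"
  assumes S: "open S" "cbox a b \<subseteq> S" and K: "closed K" "K \<subseteq> cbox a b"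
    and f: "\<And>x. x \<in> S \<Longrightarrow> (f has_derivative f' x) (at x)"
    and cont: "continuous_on S (\<lambda>x. f' x v)"
    and supp: "\<And>x. x \<in> S - K \<Longrightarrow> f x = 0"
  shows "integral (cbox a b) (\<lambda>x. f' x v) = 0"
proof -
  define g where "g x = (if x \<in> S then f x else 0)" for x
  define g' where "g' x = (if x \<in> S then f' x else (\<lambda>v. 0))" for x
  have off: "(g has_derivative (\<lambda>v. 0)) (at x)" if "x \<notin> K" for x
  proof -
    have "((\<lambda>x. 0) has_derivative (\<lambda>v. 0)) (at x)" by simp
    then show ?thesis
      by (rule has_derivative_transform_within_open[where s="- K"])
        (use that K(1) supp in \<open>auto simp: g_def open_Compl\<close>)
  qed
  have on: "(g has_derivative f' x) (at x)" if "x \<in> S" for x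
    by (rule has_derivative_transform_within_open[OF f[OF that] S(1) that]) (simp add: g_def)
  have g: "(g has_derivative g' x) (at x)" for x
    using on[of x] off[of x] K(2) S(2) by (auto simp: g'_def)
  have zero: "g' x v = 0" if "x \<notin> K" for x
    using has_derivative_unique[OF g off[OF that]] by metis
  have "continuous_on (- K) (\<lambda>x. g' x v)"
    using continuous_on_const[of "- K" "0 :: 'b"] by (rule continuous_on_eq) (simp add: zero)
  moreover have "continuous_on S (\<lambda>x. g' x v)"
    using cont by (rule continuous_on_eq) (simp add: g'_def)
  ultimately have "continuous_on (S \<union> - K) (\<lambda>x. g' x v)"
    using S(1) K(1) by (intro continuous_on_open_Un) auto
  moreover have "S \<union> - K = UNIV" using K(2) S(2) by auto
  ultimately have "integral (cbox a b) (\<lambda>x. g' x v) = 0"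
    using supp K(2) by (intro integral_derivative_eq_0[OF g]) (auto simp: g_def)
  moreover have "integral (cbox a b) (\<lambda>x. g' x v) = integral (cbox a b) (\<lambda>x. f' x v)"
    using S(2) by (intro integral_cong) (auto simp: g'_def)
  ultimately show ?thesis by simp
qed

text \<open>As \<open>u\<close> has only first derivatives, integration by parts moves its
  derivative onto \<psi>. Both sides become minus the integral of \<open>u\<close> against a mixed
  second derivative of \<psi>, which is symmetric.\<close>

lemma integral_mixed_derivatives_symmetric:
  fixes u :: "'a::euclidean_space \<Rightarrow> complex" and \<psi> :: "'a \<Rightarrow> real"
  assumes S: "open S" "cbox a b \<subseteq> S" and K: "closed K" "K \<subseteq> cbox a b"
    and u: "Ck_on 1 S u" and \<psi>: "smooth_on UNIV \<psi>" "\<And>x. x \<notin> K \<Longrightarrow> \<psi> x = 0"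
  shows "integral (cbox a b) (\<lambda>x. frechet_derivative \<psi> (at x) w *\<^sub>R frechet_derivative u (at x) v) =
    integral (cbox a b) (\<lambda>x. frechet_derivative \<psi> (at x) v *\<^sub>R frechet_derivative u (at x) w)"
proof -
  let ?u = "\<lambda>v x. frechet_derivative u (at x) v" and ?\<psi> = "\<lambda>v x. frechet_derivative \<psi> (at x) v"
  let ?\<psi>2 = "\<lambda>w v x. frechet_derivative (?\<psi> w) (at x) v"
  have du: "(u has_derivative frechet_derivative u (at x)) (at x)" if "x \<in> S" for x
    using u that by (simp add: frechet_derivative_works[symmetric])
  have cu: "continuous_on S (?u v)" for v using u by simp
  have cu0: "continuous_on S u"
    using du has_derivative_continuous by (blast intro: continuous_at_imp_continuous_on)
  have s\<psi>: "smooth_on UNIV (?\<psi> w)" "smooth_on UNIV (?\<psi>2 w v)" for w v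
    by (intro smooth_on_frechet_derivative \<psi>(1))+
  have d\<psi>: "(?\<psi> w has_derivative frechet_derivative (?\<psi> w) (at x)) (at x)" for w x
    using smooth_on_imp_has_derivative[OF s\<psi>(1)] by blast
  have c\<psi>: "continuous_on S (?\<psi> w)" "continuous_on S (?\<psi>2 w v)" for w v
    using smooth_on_imp_continuous_on[OF smooth_on_subset[OF s\<psi>(1)]]
      smooth_on_imp_continuous_on[OF smooth_on_subset[OF s\<psi>(2)]] by blast+
  have \<psi>0: "?\<psi> w x = 0" if "x \<notin> K" for w x
  proof (rule frechet_derivative_eqI)
    have "((\<lambda>x. 0) has_derivative (\<lambda>v. 0)) (at x)" by simp
    then show "(\<psi> has_derivative (\<lambda>v. 0)) (at x)"
      by (rule has_derivative_transform_within_open[where s="- K"])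
        (use that K(1) \<psi>(2) in \<open>auto simp: open_Compl\<close>)
  qed
  have parts: "integral (cbox a b) (\<lambda>x. ?\<psi> w x *\<^sub>R ?u v x) = - integral (cbox a b) (\<lambda>x. ?\<psi>2 w v x *\<^sub>R u x)" for v w
  proof -
    have "integral (cbox a b) (\<lambda>x. (\<lambda>v. ?\<psi> w x *\<^sub>R ?u v x + ?\<psi>2 w v x *\<^sub>R u x) v) = 0"
    proof (rule integral_derivative_eq_0_on[OF S K])
      show "((\<lambda>x. ?\<psi> w x *\<^sub>R u x) has_derivative (\<lambda>v. ?\<psi> w x *\<^sub>R ?u v x + ?\<psi>2 w v x *\<^sub>R u x)) (at x)"
        if "x \<in> S" for x
        by (rule has_derivative_scaleR[OF d\<psi> du[OF that]])
      show "continuous_on S (\<lambda>x. ?\<psi> w x *\<^sub>R ?u v x + ?\<psi>2 w v x *\<^sub>R u x)"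
        by (intro continuous_intros c\<psi> cu cu0)
    qed (simp add: \<psi>0)
    moreover have "(\<lambda>x. ?\<psi> w x *\<^sub>R ?u v x) integrable_on cbox a b" "(\<lambda>x. ?\<psi>2 w v x *\<^sub>R u x) integrable_on cbox a b"
      by (intro integrable_continuous continuous_intros continuous_on_subset[OF _ S(2)] c\<psi> cu cu0)+
    ultimately show ?thesis by (simp add: integral_add add_eq_0_iff2)
  qed
  show ?thesis
    unfolding parts using smooth_on_second_derivative_symmetric[OF open_UNIV _ \<psi>(1), of _ w v]
    by simp
qed

section \<open>Regularity\<close>

text \<open>The factor cancels the gradient \<open>- 2 y\<close> of
  \<open>r\<^sup>2 - y \<bullet> y\<close>, which leaves exactly the kernel times
  \<open>y\<close>.\<close>

definition ball_potential :: "real \<Rightarrow> 'a::euclidean_space \<Rightarrow> real" where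
  "ball_potential r y = - (1/2) * flat_exp 0 (r\<^sup>2 - y \<bullet> y)"

lemma smooth_on_ball_potential: "smooth_on UNIV (ball_potential r)"
  unfolding ball_potential_def
  by (intro smooth_on_mult smooth_on_const open_UNIV,
      rule smooth_on_compose_real[OF open_UNIV smooth_on_flat_exp])
    (intro smooth_on_diff smooth_on_const smooth_on_inner_self open_UNIV)

lemma ball_potential_eq_0: "r \<ge> 0 \<Longrightarrow> norm y \<ge> r \<Longrightarrow> ball_potential r y = 0"
  unfolding ball_potential_def using power_mono[of r "norm y" 2]
  by (simp add: power2_norm_eq_inner flat_exp_nonpos)

lemma frechet_derivative_ball_potential:
  "frechet_derivative (ball_potential r) (at y) v = ball_kernel r y * (y \<bullet> v)"
proof (rule frechet_derivative_eqI)
  have g: "((\<lambda>y. r\<^sup>2 - y \<bullet> y) has_derivative (\<lambda>v. - (2 * (y \<bullet> v)))) (at y)"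
    by (auto intro!: derivative_eq_intros simp: inner_commute)
  have "(flat_exp 0 has_real_derivative flat_exp 2 s) (at s)" for s
    using flat_exp_derivative[of 0 s] by (simp add: numeral_2_eq_2)
  then have "(flat_exp 0 has_derivative (\<lambda>v. flat_exp 2 s * v)) (at s)" for s
    by (simp add: has_field_derivative_def)
  from has_derivative_compose[OF g this]
  have "((\<lambda>y. flat_exp 0 (r\<^sup>2 - y \<bullet> y)) has_derivative (\<lambda>v. ball_kernel r y * (- (2 * (y \<bullet> v))))) (at y)"
    by (simp add: ball_kernel_def)
  from has_derivative_mult_right[OF this, of "- (1/2)"]
  show "(ball_potential r has_derivative (\<lambda>v. ball_kernel r y * (y \<bullet> v))) (at y)"
    unfolding ball_potential_def[abs_def] by simp
qed

lemma scaled_derivative: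
  fixes f :: "'a::real_normed_vector \<Rightarrow> 'b::real_normed_vector"
  assumes "f differentiable (at (x + \<epsilon> *\<^sub>R y))"
  shows "((\<lambda>y. f (x + \<epsilon> *\<^sub>R y)) has_derivative (\<lambda>v. \<epsilon> *\<^sub>R frechet_derivative f (at (x + \<epsilon> *\<^sub>R y)) v)) (at y)"
proof -
  have f: "(f has_derivative frechet_derivative f (at (x + \<epsilon> *\<^sub>R y))) (at (x + \<epsilon> *\<^sub>R y))"
    using assms frechet_derivative_works by blast
  have "((\<lambda>y. x + \<epsilon> *\<^sub>R y) has_derivative (\<lambda>v. \<epsilon> *\<^sub>R v)) (at y)"
    by (auto intro!: derivative_eq_intros)
  from has_derivative_compose[OF this f] show ?thesis
    by (simp add: has_derivative_scaleR_arg[OF f])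
qed

text \<open>As \<open>\<partial>\<^sub>b\<close> of the potential is \<open>(y \<bullet> b)\<close> times the kernel, the hypothesis says that the mean of
  \<open>y \<mapsto> f (x + \<epsilon> y)\<close> does not change with \<open>\<epsilon>\<close>.\<close>

lemma ball_mean_eq:
  fixes f :: "'a::euclidean_space \<Rightarrow> complex"
  assumes S: "open S" "\<And>y. y \<in> cbox (- r *\<^sub>R One) (r *\<^sub>R One) \<Longrightarrow> x + y \<in> S" and "r > 0"
    and f: "Ck_on 1 S f"
    and hyp: "\<And>\<epsilon>. 0 < \<epsilon> \<Longrightarrow> \<epsilon> \<le> 1 \<Longrightarrow> integral (cbox (- r *\<^sub>R One) (r *\<^sub>R One))
      (\<lambda>y. \<Sum>b\<in>Basis. frechet_derivative (ball_potential r) (at y) b *\<^sub>R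
        frechet_derivative (\<lambda>y. f (x + \<epsilon> *\<^sub>R y)) (at y) b) = 0"
  shows "integral (cbox (- r *\<^sub>R One) (r *\<^sub>R One)) (\<lambda>y. ball_kernel r y *\<^sub>R f (x + y)) =
    integral (cbox (- r *\<^sub>R One) (r *\<^sub>R One)) (ball_kernel r :: 'a \<Rightarrow> real) *\<^sub>R f x"
proof -
  let ?B = "cbox (- r *\<^sub>R One) (r *\<^sub>R One :: 'a)"
  let ?D = "\<lambda>z v. frechet_derivative f (at z) v"
  have diff: "f differentiable (at z)" if "z \<in> S" for z using f that by simp
  then have contf: "continuous_on S f"
    by (meson continuous_at_imp_continuous_on differentiable_imp_continuous_within)
  have contD: "continuous_on S (\<lambda>z. ?D z v)" for v using f by simp
  have contk: "continuous_on T (ball_kernel r)" for T :: "'a set"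
    using smooth_on_imp_continuous_on[OF smooth_on_subset[OF smooth_on_ball_kernel]] by blast
  have in_S: "x + \<epsilon> *\<^sub>R y \<in> S" if "0 \<le> \<epsilon>" "\<epsilon> \<le> 1" "y \<in> ?B" for \<epsilon> y
  proof (rule S(2))
    have "0 \<in> ?B" using \<open>r > 0\<close> by (intro mem_cbox_if_norm_le) simp
    from convexD[OF convex_box(1) this that(3), of "1 - \<epsilon>" \<epsilon>]
    show "\<epsilon> *\<^sub>R y \<in> ?B" using that by simp
  qed
  have lin: "?D z y = (\<Sum>b\<in>Basis. (y \<bullet> b) *\<^sub>R ?D z b)" if "z \<in> S" for z y
  proof -
    have "linear (frechet_derivative f (at z))" by (rule linear_frechet_derivative[OF diff[OF that]])
    from linear_sum[OF this, of "\<lambda>b. (y \<bullet> b) *\<^sub>R b" Basis] linear_scale[OF this]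
    show ?thesis by (simp add: euclidean_representation)
  qed
  define J where "J \<epsilon> = integral ?B (\<lambda>y. ball_kernel r y *\<^sub>R f (x + \<epsilon> *\<^sub>R y))" for \<epsilon>
  have dJ: "(J has_vector_derivative integral ?B (\<lambda>y. ball_kernel r y *\<^sub>R (\<Sum>b\<in>Basis. (y \<bullet> b) *\<^sub>R ?D (x + \<epsilon> *\<^sub>R y) b)))
      (at \<epsilon> within {0..1})" if \<epsilon>: "\<epsilon> \<in> {0..1}" for \<epsilon>
    unfolding J_def
  proof (rule leibniz_rule_vector_derivative)
    fix \<epsilon> :: real and y assume *: "\<epsilon> \<in> {0..1}" "y \<in> ?B"
    then have z: "x + \<epsilon> *\<^sub>R y \<in> S" by (intro in_S) auto
    have D: "(f has_derivative ?D (x + \<epsilon> *\<^sub>R y)) (at (x + \<epsilon> *\<^sub>R y))"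
      using diff[OF z] frechet_derivative_works by blast
    have "((\<lambda>\<epsilon>. x + \<epsilon> *\<^sub>R y) has_derivative (\<lambda>t. t *\<^sub>R y)) (at \<epsilon> within {0..1})"
      by (auto intro!: derivative_eq_intros)
    from has_derivative_compose[OF this D]
    have "((\<lambda>\<epsilon>. f (x + \<epsilon> *\<^sub>R y)) has_vector_derivative ?D (x + \<epsilon> *\<^sub>R y) y) (at \<epsilon> within {0..1})"
      unfolding has_vector_derivative_def by (simp add: has_derivative_scaleR_arg[OF D])
    from bounded_linear.has_vector_derivative[OF bounded_linear_scaleR_right this, of "ball_kernel r y"]
    show "((\<lambda>\<epsilon>. ball_kernel r y *\<^sub>R f (x + \<epsilon> *\<^sub>R y)) has_vector_derivative
        ball_kernel r y *\<^sub>R (\<Sum>b\<in>Basis. (y \<bullet> b) *\<^sub>R ?D (x + \<epsilon> *\<^sub>R y) b)) (at \<epsilon> within {0..1})"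
      by (simp only: lin[OF z, of y])
  next
    fix \<epsilon> :: real assume "\<epsilon> \<in> {0..1}"
    then show "(\<lambda>y. ball_kernel r y *\<^sub>R f (x + \<epsilon> *\<^sub>R y)) integrable_on ?B"
      by (intro integrable_continuous continuous_intros contk continuous_on_compose2[OF contf]) (auto intro: in_S)
  next
    have "continuous_on ({0..1} \<times> ?B)
        (\<lambda>z. ball_kernel r (snd z) *\<^sub>R (\<Sum>b\<in>Basis. (snd z \<bullet> b) *\<^sub>R ?D (x + fst z *\<^sub>R snd z) b))"
      by (intro continuous_intros continuous_on_compose2[OF contk[of UNIV]] continuous_on_compose2[OF contD])
        (auto intro: in_S)
    then show "continuous_on ({0..1} \<times> ?B)
        (\<lambda>(\<epsilon>, y). ball_kernel r y *\<^sub>R (\<Sum>b\<in>Basis. (y \<bullet> b) *\<^sub>R ?D (x + \<epsilon> *\<^sub>R y) b))"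
      by (simp add: case_prod_unfold)
  qed (use \<epsilon> in auto)
  \<comment> \<open>The chain rule puts a factor \<epsilon> into the hypothesis, so the vanishing of
    the derivative can be read off only for \<epsilon> > 0. At the end point 0 continuity of
    \<open>J\<close> takes over.\<close>
  have J': "(J has_derivative (\<lambda>h. 0)) (at \<epsilon> within {0..1})" if \<epsilon>: "\<epsilon> \<in> {0..1} - {0}" for \<epsilon>
  proof -
    have "integral ?B (\<lambda>y. \<epsilon> *\<^sub>R (ball_kernel r y *\<^sub>R (\<Sum>b\<in>Basis. (y \<bullet> b) *\<^sub>R ?D (x + \<epsilon> *\<^sub>R y) b))) =
      integral ?B (\<lambda>y. \<Sum>b\<in>Basis. frechet_derivative (ball_potential r) (at y) b *\<^sub>R
        frechet_derivative (\<lambda>y. f (x + \<epsilon> *\<^sub>R y)) (at y) b)"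
    proof (rule integral_cong)
      fix y assume "y \<in> ?B"
      then have "x + \<epsilon> *\<^sub>R y \<in> S" using \<epsilon> by (intro in_S) auto
      from frechet_derivative_eqI[OF scaled_derivative[OF diff[OF this]]]
      show "\<epsilon> *\<^sub>R (ball_kernel r y *\<^sub>R (\<Sum>b\<in>Basis. (y \<bullet> b) *\<^sub>R ?D (x + \<epsilon> *\<^sub>R y) b)) =
        (\<Sum>b\<in>Basis. frechet_derivative (ball_potential r) (at y) b *\<^sub>R
        frechet_derivative (\<lambda>y. f (x + \<epsilon> *\<^sub>R y)) (at y) b)"
        by (simp add: frechet_derivative_ball_potential scaleR_sum_right mult.commute mult.left_commute)
    qed
    also have "\<dots> = 0" using \<epsilon> by (intro hyp) auto
    finally have "\<epsilon> *\<^sub>R integral ?B (\<lambda>y. ball_kernel r y *\<^sub>R (\<Sum>b\<in>Basis. (y \<bullet> b) *\<^sub>R ?D (x + \<epsilon> *\<^sub>R y) b)) = 0"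
      by (simp only: integral_cmul)
    then have "integral ?B (\<lambda>y. ball_kernel r y *\<^sub>R (\<Sum>b\<in>Basis. (y \<bullet> b) *\<^sub>R ?D (x + \<epsilon> *\<^sub>R y) b)) = 0"
      using \<epsilon> by (simp only: scaleR_eq_0_iff) auto
    then show ?thesis using dJ[of \<epsilon>] \<epsilon> by (simp add: has_vector_derivative_def)
  qed
  have contJ: "continuous_on {0..1} J"
    unfolding continuous_on_eq_continuous_within
    using dJ has_vector_derivative_continuous by blast
  have "J 1 = J 0"
    by (rule has_derivative_zero_unique_strong_convex[of "{0..1::real}" "{0}" J 0, OF _ _ contJ _ _ J'])
      simp_all
  moreover have "J 0 = integral ?B (ball_kernel r :: 'a \<Rightarrow> real) *\<^sub>R f x"
  proof -
    have "(ball_kernel r has_integral integral ?B (ball_kernel r)) ?B"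
      by (intro integrable_integral integrable_continuous contk)
    from has_integral_scaleR_left[OF this, of "f x"] show ?thesis
      by (simp add: J_def integral_unique)
  qed
  ultimately show ?thesis by (simp add: J_def)
qed

section \<open>The first-order system in blocks of four real coordinates\<close>

lemma bij_betw_axis_Basis:
  "bij_betw (\<lambda>(i, j). axis i (axis j 1)) (UNIV \<times> UNIV) (Basis :: (real^4^'m::finite) set)"
proof -
  have "inj (\<lambda>(i, j). axis i (axis j 1) :: real^4^'m)"
    by (rule injI) (auto simp: axis_eq_axis axis_eq_0_iff)
  moreover have "range (\<lambda>(i, j). axis i (axis j 1) :: real^4^'m) = Basis"
    by (auto simp: Basis_vec_def image_iff)
  ultimately show ?thesis by (simp add: bij_betw_def)
qed

lemma sum_Basis_blocks:
  "(\<Sum>b\<in>(Basis :: (real^4^'m::finite) set). g b) = (\<Sum>i\<in>UNIV. g (axis i (axis 0 1)) +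
    g (axis i (axis 1 1)) + g (axis i (axis 2 1)) + g (axis i (axis 3 1)))"
proof -
  have "(\<Sum>b\<in>Basis. g b) = (\<Sum>(i, j)\<in>UNIV \<times> UNIV. g (axis i (axis j 1)))"
    using sum.reindex_bij_betw[OF bij_betw_axis_Basis, of g, symmetric] by (simp add: case_prod_unfold)
  also have "\<dots> = (\<Sum>i\<in>UNIV. \<Sum>j\<in>(UNIV :: 4 set). g (axis i (axis j 1)))"
    by (simp add: sum.cartesian_product)
  \<comment> \<open>\<open>sum_4\<close> runs over 1, 2, 3, 4, and in the type \<open>4\<close> the
    last of these is the index 0.\<close>
  moreover have "(4::4) = 0" by simp
  ultimately show ?thesis by (simp only: sum_4 add_ac)
qed

lemma frame'_block: "j < 4 \<Longrightarrow> frame' \<sigma> (4 * t + j) = axis (\<sigma> t) (axis (of_nat j) 1)"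
  by (simp add: frame'_def)

lemma nabla_frame'_even:
  "nabla (frame' \<sigma>) P0 (2 * t) f y + nabla (frame' \<sigma>) P1 (2 * t) g y =
    - frechet_derivative f (at y) (axis (\<sigma> t) (axis 2 1)) - \<i> * frechet_derivative f (at y) (axis (\<sigma> t) (axis 3 1))
    + (- frechet_derivative g (at y) (axis (\<sigma> t) (axis 0 1)) - \<i> * frechet_derivative g (at y) (axis (\<sigma> t) (axis 1 1)))"
proof -
  have "frame' \<sigma> (4 * t) = axis (\<sigma> t) (axis 0 1)" "frame' \<sigma> (4 * t + 1) = axis (\<sigma> t) (axis 1 1)"
    "frame' \<sigma> (4 * t + 2) = axis (\<sigma> t) (axis 2 1)" "frame' \<sigma> (4 * t + 3) = axis (\<sigma> t) (axis 3 1)"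
    using frame'_block[of 0 \<sigma> t] frame'_block[of 1 \<sigma> t] frame'_block[of 2 \<sigma> t] frame'_block[of 3 \<sigma> t]
    by simp_all
  then show ?thesis by (simp add: nabla_def Let_def)
qed

lemma nabla_frame'_odd:
  "nabla (frame' \<sigma>) P0 (2 * t + 1) f y + nabla (frame' \<sigma>) P1 (2 * t + 1) g y =
    frechet_derivative f (at y) (axis (\<sigma> t) (axis 0 1)) - \<i> * frechet_derivative f (at y) (axis (\<sigma> t) (axis 1 1))
    + (- frechet_derivative g (at y) (axis (\<sigma> t) (axis 2 1)) + \<i> * frechet_derivative g (at y) (axis (\<sigma> t) (axis 3 1)))"
proof -
  have "frame' \<sigma> (4 * t) = axis (\<sigma> t) (axis 0 1)" "frame' \<sigma> (4 * t + 1) = axis (\<sigma> t) (axis 1 1)"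
    "frame' \<sigma> (4 * t + 2) = axis (\<sigma> t) (axis 2 1)" "frame' \<sigma> (4 * t + 3) = axis (\<sigma> t) (axis 3 1)"
    using frame'_block[of 0 \<sigma> t] frame'_block[of 1 \<sigma> t] frame'_block[of 2 \<sigma> t] frame'_block[of 3 \<sigma> t]
    by simp_all
  then show ?thesis by (simp add: nabla_def Let_def)
qed

text \<open>The operators of one quaternionic variable, paired with a derivative of the potential, combine
  to the Dirichlet pairing because mixed derivatives may be exchanged under the integral.\<close>

lemma block_combination:
  fixes p q :: "4 \<Rightarrow> 4 \<Rightarrow> complex"
  assumes sym: "\<And>i j. p i j = p j i" "\<And>i j. q i j = q j i"
    and even: "\<And>l. - p 2 l - \<i> * p 3 l + (- q 0 l - \<i> * q 1 l) = 0"
    and odd: "\<And>l. p 0 l - \<i> * p 1 l + (- q 2 l + \<i> * q 3 l) = 0"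
  shows "p 0 0 + p 1 1 + p 2 2 + p 3 3 = 0" "q 0 0 + q 1 1 + q 2 2 + q 3 3 = 0"
proof -
  \<comment> \<open>The weights and the choices of \<open>l\<close> are those of the complex
    conjugates of the operators acting on \<open>p\<close>: composed with the system they give the
    Laplacian. Symmetry removes the off-diagonal terms of \<open>p\<close> and all terms in
    \<open>q\<close>. The second identity uses the conjugates of the operators acting on
    \<open>q\<close> in the same way.\<close>
  have "p 0 0 + p 1 1 + p 2 2 + p 3 3 =
    - (- p 2 2 - \<i> * p 3 2 + (- q 0 2 - \<i> * q 1 2)) + \<i> * (- p 2 3 - \<i> * p 3 3 + (- q 0 3 - \<i> * q 1 3))
    + (p 0 0 - \<i> * p 1 0 + (- q 2 0 + \<i> * q 3 0)) + \<i> * (p 0 1 - \<i> * p 1 1 + (- q 2 1 + \<i> * q 3 1))"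
    using sym(1)[of 2 3] sym(1)[of 0 1] sym(2)[of 0 2] sym(2)[of 1 2] sym(2)[of 0 3] sym(2)[of 1 3]
    by (simp add: algebra_simps)
  then show "p 0 0 + p 1 1 + p 2 2 + p 3 3 = 0" by (simp only: even odd) simp
  have "q 0 0 + q 1 1 + q 2 2 + q 3 3 =
    - (- p 2 0 - \<i> * p 3 0 + (- q 0 0 - \<i> * q 1 0)) + \<i> * (- p 2 1 - \<i> * p 3 1 + (- q 0 1 - \<i> * q 1 1))
    - (p 0 2 - \<i> * p 1 2 + (- q 2 2 + \<i> * q 3 2)) - \<i> * (p 0 3 - \<i> * p 1 3 + (- q 2 3 + \<i> * q 3 3))"
    using sym(2)[of 2 3] sym(2)[of 0 1] sym(1)[of 0 2] sym(1)[of 1 2] sym(1)[of 0 3] sym(1)[of 1 3]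
    by (simp add: algebra_simps)
  then show "q 0 0 + q 1 1 + q 2 2 + q 3 3 = 0" by (simp only: even odd) simp
qed

lemma integral_potential_zero:
  fixes u v :: "'m::finite hspace' \<Rightarrow> complex"
  assumes "r > 0" and S: "open S" "cbox (- r *\<^sub>R One) (r *\<^sub>R One) \<subseteq> S"
    and u: "Ck_on 1 S u" and v: "Ck_on 1 S v" and \<sigma>: "\<sigma> ` {1..<n} = UNIV"
    and eq: "\<And>A y. A \<in> {2..<2*n} \<Longrightarrow> y \<in> S \<Longrightarrow> nabla (frame' \<sigma>) P0 A u y + nabla (frame' \<sigma>) P1 A v y = 0"
  shows "integral (cbox (- r *\<^sub>R One) (r *\<^sub>R One)) (\<lambda>y. \<Sum>b\<in>Basis.
      frechet_derivative (ball_potential r) (at y) b *\<^sub>R frechet_derivative u (at y) b) = 0" (is "?I u = 0")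
    and "integral (cbox (- r *\<^sub>R One) (r *\<^sub>R One)) (\<lambda>y. \<Sum>b\<in>Basis.
      frechet_derivative (ball_potential r) (at y) b *\<^sub>R frechet_derivative v (at y) b) = 0" (is "?I v = 0")
proof -
  let ?B = "cbox (- r *\<^sub>R One) (r *\<^sub>R One :: 'm hspace')"
  let ?\<psi> = "\<lambda>w y. frechet_derivative (ball_potential r :: 'm hspace' \<Rightarrow> real) (at y) w"
  let ?e = "\<lambda>i j. axis i (axis j 1) :: 'm hspace'"
  \<comment> \<open>Up to sign, \<open>Q f i j l\<close> is the weak second derivative of
    \<open>f\<close> in the directions \<open>j\<close> and \<open>l\<close> of block
    \<open>i\<close>, tested against the potential. Only first derivatives of \<open>f\<close> occur
    in it, yet it is symmetric in \<open>j\<close> and \<open>l\<close>.\<close>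
  define F where "F f i j l y = ?\<psi> (?e i l) y *\<^sub>R frechet_derivative f (at y) (?e i j)"
    for f :: "'m hspace' \<Rightarrow> complex" and i j l y
  define Q where "Q f i j l = integral ?B (F f i j l)" for f i j l
  have K: "closed (cball 0 r :: 'm hspace' set)" "cball 0 r \<subseteq> ?B"
    using mem_cbox_if_norm_le by auto
  have c\<psi>: "continuous_on S (?\<psi> w)" for w
    by (rule smooth_on_imp_continuous_on[OF smooth_on_subset[OF smooth_on_frechet_derivative[OF smooth_on_ball_potential]]]) simp
  have int: "(F f i j l has_integral Q f i j l) ?B" if "Ck_on 1 S f" for f i j l
    unfolding Q_def F_def using that
    by (intro integrable_integral integrable_continuous continuous_intros continuous_on_subset[OF _ S(2)] c\<psi>) simp
  have sym: "Q f i j l = Q f i l j" if "Ck_on 1 S f" for f i j l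
    unfolding Q_def F_def
    by (rule integral_mixed_derivatives_symmetric[OF S K that smooth_on_ball_potential])
      (use \<open>r > 0\<close> in \<open>auto intro!: ball_potential_eq_0\<close>)
  have zero: "Q u i 0 0 + Q u i 1 1 + Q u i 2 2 + Q u i 3 3 = 0 \<and> Q v i 0 0 + Q v i 1 1 + Q v i 2 2 + Q v i 3 3 = 0" for i
  proof -
    \<comment> \<open>Every block belongs to some \<open>q\<^sub>t\<close> with
      \<open>1 \<le> t < n\<close>, and its two equations \<open>A = 2 t\<close> and
      \<open>A = 2 t + 1\<close> are among the given ones.\<close>
    obtain t where t: "t \<in> {1..<n}" "i = \<sigma> t" using \<sigma> by (metis UNIV_I imageE)
    have A: "2 * t \<in> {2..<2*n}" "2 * t + 1 \<in> {2..<2*n}" using t(1) by auto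
    have even: "- Q u i 2 l - \<i> * Q u i 3 l + (- Q v i 0 l - \<i> * Q v i 1 l) = 0" for l
    proof -
      have I: "((\<lambda>y. - F u i 2 l y - \<i> * F u i 3 l y + (- F v i 0 l y - \<i> * F v i 1 l y)) has_integral
          - Q u i 2 l - \<i> * Q u i 3 l + (- Q v i 0 l - \<i> * Q v i 1 l)) ?B"
        by (intro has_integral_add has_integral_diff has_integral_neg has_integral_mult_right int u v)
      have Z: "- F u i 2 l y - \<i> * F u i 3 l y + (- F v i 0 l y - \<i> * F v i 1 l y) = 0" if "y \<in> ?B" for y
      proof -
        have "- F u i 2 l y - \<i> * F u i 3 l y + (- F v i 0 l y - \<i> * F v i 1 l y) = complex_of_real (?\<psi> (?e i l) y) *
            (nabla (frame' \<sigma>) P0 (2 * t) u y + nabla (frame' \<sigma>) P1 (2 * t) v y)"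
          unfolding nabla_frame'_even t(2) F_def by (simp add: scaleR_conv_of_real algebra_simps)
        then show ?thesis using eq[OF A(1)] that S(2) by auto
      qed
      from has_integral_unique[OF I has_integral_is_0[OF Z]] show ?thesis .
    qed
    have odd: "Q u i 0 l - \<i> * Q u i 1 l + (- Q v i 2 l + \<i> * Q v i 3 l) = 0" for l
    proof -
      have I: "((\<lambda>y. F u i 0 l y - \<i> * F u i 1 l y + (- F v i 2 l y + \<i> * F v i 3 l y)) has_integral
          Q u i 0 l - \<i> * Q u i 1 l + (- Q v i 2 l + \<i> * Q v i 3 l)) ?B"
        by (intro has_integral_add has_integral_diff has_integral_neg has_integral_mult_right int u v)
      have Z: "F u i 0 l y - \<i> * F u i 1 l y + (- F v i 2 l y + \<i> * F v i 3 l y) = 0" if "y \<in> ?B" for y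
      proof -
        have "F u i 0 l y - \<i> * F u i 1 l y + (- F v i 2 l y + \<i> * F v i 3 l y) = complex_of_real (?\<psi> (?e i l) y) *
            (nabla (frame' \<sigma>) P0 (2 * t + 1) u y + nabla (frame' \<sigma>) P1 (2 * t + 1) v y)"
          unfolding nabla_frame'_odd t(2) F_def by (simp add: scaleR_conv_of_real algebra_simps)
        then show ?thesis using eq[OF A(2)] that S(2) by auto
      qed
      from has_integral_unique[OF I has_integral_is_0[OF Z]] show ?thesis .
    qed
    show ?thesis
      using block_combination[of "Q u i" "Q v i", OF sym[OF u] sym[OF v] even odd] by blast
  qed
  have I: "?I f = (\<Sum>i\<in>UNIV. Q f i 0 0 + Q f i 1 1 + Q f i 2 2 + Q f i 3 3)" if f: "Ck_on 1 S f" for f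
  proof (rule integral_unique)
    have "((\<lambda>y. \<Sum>i\<in>UNIV. F f i 0 0 y + F f i 1 1 y + F f i 2 2 y + F f i 3 3 y) has_integral
        (\<Sum>i\<in>UNIV. Q f i 0 0 + Q f i 1 1 + Q f i 2 2 + Q f i 3 3)) ?B"
      by (intro has_integral_sum has_integral_add int[OF f] finite)
    moreover have "(\<lambda>y. \<Sum>i\<in>UNIV. F f i 0 0 y + F f i 1 1 y + F f i 2 2 y + F f i 3 3 y) =
        (\<lambda>y. \<Sum>b\<in>Basis. ?\<psi> b y *\<^sub>R frechet_derivative f (at y) b)"
      unfolding F_def sum_Basis_blocks[of "\<lambda>b. ?\<psi> b _ *\<^sub>R frechet_derivative f (at _) b"] ..
    ultimately show "((\<lambda>y. \<Sum>b\<in>Basis. ?\<psi> b y *\<^sub>R frechet_derivative f (at y) b) has_integral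
        (\<Sum>i\<in>UNIV. Q f i 0 0 + Q f i 1 1 + Q f i 2 2 + Q f i 3 3)) ?B"
      by simp
  qed
  show "?I u = 0" "?I v = 0"
    unfolding I[OF u] I[OF v] using zero by simp_all
qed

section \<open>Rescaling and the smoothness of solutions\<close>

lemma Ck_on_1_scaled:
  assumes "Ck_on 1 S f" "open S"
  shows "open {y. x + \<epsilon> *\<^sub>R y \<in> S}" "Ck_on 1 {y. x + \<epsilon> *\<^sub>R y \<in> S} (\<lambda>y. f (x + \<epsilon> *\<^sub>R y))"
proof -
  have "continuous_on UNIV (\<lambda>y. x + \<epsilon> *\<^sub>R y)" by (intro continuous_intros)
  then have "open ((\<lambda>y. x + \<epsilon> *\<^sub>R y) -` S)" using assms(2) by (rule open_vimage[rotated])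
  then show o: "open {y. x + \<epsilon> *\<^sub>R y \<in> S}" by (simp add: vimage_def)
  have "Ck_on (Suc 0) {y. x + \<epsilon> *\<^sub>R y \<in> S} (\<lambda>y. f (x + \<epsilon> *\<^sub>R y))"
  proof (rule Ck_on_SucI[OF o scaled_derivative])
    fix v
    have "continuous_on S (\<lambda>z. frechet_derivative f (at z) v)" using assms(1) by simp
    then show "Ck_on 0 {y. x + \<epsilon> *\<^sub>R y \<in> S} (\<lambda>y. \<epsilon> *\<^sub>R frechet_derivative f (at (x + \<epsilon> *\<^sub>R y)) v)"
      by (auto intro!: continuous_intros intro: continuous_on_compose2)
  qed (use assms(1) in simp)
  then show "Ck_on 1 {y. x + \<epsilon> *\<^sub>R y \<in> S} (\<lambda>y. f (x + \<epsilon> *\<^sub>R y))" by simp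
qed

lemma nabla_scaled:
  assumes "f differentiable (at (x + \<epsilon> *\<^sub>R y))"
  shows "nabla e a A (\<lambda>y. f (x + \<epsilon> *\<^sub>R y)) y = \<epsilon> *\<^sub>R nabla e a A f (x + \<epsilon> *\<^sub>R y)"
  by (simp add: nabla_def Let_def frechet_derivative_eqI[OF scaled_derivative[OF assms]]
      scaleR_conv_of_real algebra_simps split: pidx.split)

text \<open>Rescaling about a point preserves the system, so the Dirichlet pairing with the
  potential vanishes at every scale and each function is a constant multiple of its smooth kernel
  mean. The two functions are treated together because the pairing of either one vanishes only by
  combining equations that involve both.\<close>

lemma smooth_pair:
  fixes u v :: "'m::finite hspace' \<Rightarrow> complex"
  assumes X: "open X" and u: "Ck_on 1 X u" and v: "Ck_on 1 X v" and \<sigma>: "\<sigma> ` {1..<n} = UNIV"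
    and eq: "\<And>A y. A \<in> {2..<2*n} \<Longrightarrow> y \<in> X \<Longrightarrow> nabla (frame' \<sigma>) P0 A u y + nabla (frame' \<sigma>) P1 A v y = 0"
  shows "smooth_on X u" "smooth_on X v"
proof -
  have "smooth_on X u \<and> smooth_on X v"
  proof -
    have "\<exists>T. open T \<and> x0 \<in> T \<and> smooth_on T u \<and> smooth_on T v" if "x0 \<in> X" for x0
    proof -
      obtain R where R: "R > 0" "ball x0 R \<subseteq> X" using X \<open>x0 \<in> X\<close> open_contains_ball by blast
      define N where "N = real DIM('m hspace')"
      \<comment> \<open>The norm of a vector in the cube is at most \<open>N r = R / 2\<close>;
        added to a point of \<open>ball x0 (R / 2)\<close> it stays in
        \<open>ball x0 R\<close>.\<close>
      define r where "r = R / (2 * N)"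
      have "N > 0" by (simp add: N_def)
      then have r: "r > 0" "N * r = R / 2" using R(1) by (simp_all add: r_def)
      let ?B = "cbox (- r *\<^sub>R One) (r *\<^sub>R One :: 'm hspace')"
      define T where "T = ball x0 (R / 2)"
      have in_X: "x + y \<in> X" if "x \<in> T" "y \<in> ?B" for x y
      proof -
        have "\<bar>y \<bullet> b\<bar> \<le> r" if "b \<in> Basis" for b
          using \<open>y \<in> ?B\<close> that by (auto simp: mem_box abs_le_iff) 
        then have "norm y \<le> (\<Sum>b\<in>(Basis :: 'm hspace' set). r)"
          by (intro order.trans[OF norm_le_l1] sum_mono)
        then have "norm y \<le> R / 2" using r(2) by (simp add: N_def)
        moreover have "dist x0 x < R / 2" using \<open>x \<in> T\<close> by (simp add: T_def)
        moreover have "dist x0 (x + y) \<le> dist x0 x + norm y"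
          using norm_triangle_ineq4[of "x0 - x" y] by (simp add: dist_norm algebra_simps)
        ultimately show ?thesis using R(2) by (intro subsetD[OF R(2)]) simp
      qed
      have mean: "integral ?B (\<lambda>y. ball_kernel r y *\<^sub>R w (x + y)) = integral ?B (ball_kernel r) *\<^sub>R w x"
        if x: "x \<in> T" and w: "w = u \<or> w = v" for x w
      proof (rule ball_mean_eq[OF X in_X[OF x] r(1)])
        show "Ck_on 1 X w" using w u v by blast
        fix \<epsilon> :: real assume \<epsilon>: "0 < \<epsilon>" "\<epsilon> \<le> 1"
        let ?S = "{y. x + \<epsilon> *\<^sub>R y \<in> X}"
        have sub: "?B \<subseteq> ?S"
        proof
          fix y assume y: "y \<in> ?B"
          have "0 \<in> ?B" using r(1) by (intro mem_cbox_if_norm_le) simp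
          from convexD[OF convex_box(1) this y, of "1 - \<epsilon>" \<epsilon>] \<epsilon> have "\<epsilon> *\<^sub>R y \<in> ?B" by simp
          then show "y \<in> ?S" using in_X[OF x] by simp
        qed
        have eq': "nabla (frame' \<sigma>) P0 A (\<lambda>y. u (x + \<epsilon> *\<^sub>R y)) y + nabla (frame' \<sigma>) P1 A (\<lambda>y. v (x + \<epsilon> *\<^sub>R y)) y = 0"
          if "A \<in> {2..<2*n}" "y \<in> ?S" for A y
        proof -
          have z: "x + \<epsilon> *\<^sub>R y \<in> X" using that(2) by simp
          then have d: "u differentiable (at (x + \<epsilon> *\<^sub>R y))" "v differentiable (at (x + \<epsilon> *\<^sub>R y))"
            using u v by simp_all
          show ?thesis
            unfolding nabla_scaled[OF d(1)] nabla_scaled[OF d(2)] scaleR_add_right[symmetric]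
            by (simp add: eq[OF that(1) z])
        qed
        show "integral ?B (\<lambda>y. \<Sum>b\<in>Basis. frechet_derivative (ball_potential r) (at y) b *\<^sub>R
            frechet_derivative (\<lambda>y. w (x + \<epsilon> *\<^sub>R y)) (at y) b) = 0"
          using w
        proof
          assume "w = u"
          show ?thesis
            unfolding \<open>w = u\<close>
            by (rule integral_potential_zero(1)[OF r(1) Ck_on_1_scaled(1)[OF u X] sub Ck_on_1_scaled(2)[OF u X]
                Ck_on_1_scaled(2)[OF v X] \<sigma> eq'])
        next
          assume "w = v"
          show ?thesis
            unfolding \<open>w = v\<close>
            by (rule integral_potential_zero(2)[OF r(1) Ck_on_1_scaled(1)[OF u X] sub Ck_on_1_scaled(2)[OF u X]
                Ck_on_1_scaled(2)[OF v X] \<sigma> eq'])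
        qed
      qed
      have smooth: "smooth_on T w" if w: "w = u \<or> w = v" for w
      proof -
        have "Ck_on 1 X w" using w u v by blast
        then have cont: "continuous_on X w" using Ck_on_Suc_imp[of 0 X w] by simp
        have "open T" by (simp add: T_def)
        have "smooth_on T (\<lambda>x. integral ?B (\<lambda>y. ball_kernel r y *\<^sub>R w (x + y)))"
          by (rule smooth_on_ball_mean[OF r(1) X cont \<open>open T\<close> in_X])
        from smooth_on_linear[OF \<open>open T\<close> bounded_linear_scaleR_right this, of "inverse (integral ?B (ball_kernel r))"]
        have "smooth_on T (\<lambda>x. inverse (integral ?B (ball_kernel r)) *\<^sub>R integral ?B (\<lambda>y. ball_kernel r y *\<^sub>R w (x + y)))" .
        moreover have w_eq: "w x = inverse (integral ?B (ball_kernel r)) *\<^sub>R integral ?B (\<lambda>y. ball_kernel r y *\<^sub>R w (x + y))" if "x \<in> T" for x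
          using mean[OF that w] integral_ball_kernel_pos[OF r(1), where 'a="'m hspace'"] by simp
        ultimately show ?thesis using smooth_on_cong[OF \<open>open T\<close> w_eq] by simp
      qed
      have "open T" "x0 \<in> T" using R(1) by (simp_all add: T_def)
      then show ?thesis using smooth by blast
    qed
    note local = this
    have "smooth_on X u" by (rule smooth_on_local) (use local in blast)
    moreover have "smooth_on X v" by (rule smooth_on_local) (use local in blast)
    ultimately show ?thesis ..
  qed
  then show "smooth_on X u" "smooth_on X v" by auto
qed

text \<open>A component with \<open>k\<close> indices is one of the two with the same tail, and such
  a pair satisfies the system of \<open>smooth_pair\<close>.\<close>

lemma smooth_if_regular_on_slice:
  assumes "k \<ge> 1" "open X" and \<sigma>: "bij_betw \<sigma> {1..<n} UNIV" and f: "regular_on_slice n \<sigma> X k f"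
  shows "smooth_on X (\<lambda>y. f y B)"
proof (cases "length B = k")
  case True
  then obtain a C where B: "B = a # C" "length C = k - 1" using \<open>k \<ge> 1\<close> by (cases B) auto
  have "Ck_on 1 X (\<lambda>y. f y D)" for D using f by (simp add: regular_on_slice_def)
  then have "smooth_on X (\<lambda>y. f y (P0 # C))" "smooth_on X (\<lambda>y. f y (P1 # C))"
    using smooth_pair[OF assms(2), of "\<lambda>y. f y (P0 # C)" "\<lambda>y. f y (P1 # C)" \<sigma> n] \<sigma> f B(2)
    by (auto simp: regular_on_slice_def bij_betw_def)
  then show ?thesis unfolding B(1) by (cases a) auto
next
  case False
  have "f y B = 0" if "y \<in> X" for y
  proof -
    have "f y \<in> sym_tensors k" using f that by (simp add: regular_on_slice_def)
    then show ?thesis using False unfolding sym_tensors_def by blast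
  qed
  then show ?thesis using smooth_on_cong[OF assms(2), of "\<lambda>y. f y B" "\<lambda>y. 0"] by simp
qed

section \<open>Cutoff functions\<close>

text \<open>\<rho> is a sum of smoothed plateau functions of the distance to the complement. The
  \<open>i\<close>-th one is at least 1 up to distance \<open>(1/2) ^ i / 2\<close> and is 0 from
  distance \<open>3 * (1/2) ^ i\<close> on. So the sum is locally finite inside \<open>X\<close>,
  while near the complement arbitrarily many terms contribute at least 1.\<close>

lemma smooth_exhaustion:
  fixes X :: "'a::euclidean_space set"
  assumes "open X"
  obtains \<rho> :: "'a \<Rightarrow> real" where "smooth_on X \<rho>"
    "\<And>z M. z \<notin> X \<Longrightarrow> \<exists>U. open U \<and> z \<in> U \<and> (\<forall>y\<in>U \<inter> X. \<rho> y \<ge> M)"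
\<comment> \<open>The distance to the empty set is 0 by convention, so the construction below would
  not see that every point is interior.\<close>
proof (cases "X = UNIV")
  case True
  then show thesis using that[of "\<lambda>y. 0"] by simp
next
  case False
  define d where "d y = infdist y (- X)" for y
  have contd: "continuous_on UNIV d"
    unfolding d_def by (intro continuous_intros)
  have lip: "d x \<le> d y + dist x y" for x y
    unfolding d_def by (rule infdist_triangle)
  \<comment> \<open>Before averaging, \<open>h i\<close> is at least 1 up to distance
    \<open>(1/2) ^ i\<close> and 0 from \<open>2 * (1/2) ^ i\<close> on. Averaging over a ball of
    radius \<open>(1/2) ^ i / 4\<close> shifts distances by at most that radius, which the
    thresholds in \<open>v_ge\<close> and \<open>v_0\<close> absorb.\<close>
  define r where "r i = (1/2 :: real) ^ i / 4" for i :: nat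
  have r: "r i > 0" for i by (simp add: r_def)
  define B where "B i = cbox (- r i *\<^sub>R One) (r i *\<^sub>R One :: 'a)" for i
  define h where "h i y = max 0 (2 - 2 ^ i * d y)" for i y
  have conth: "continuous_on UNIV (h i)" for i
    unfolding h_def by (intro continuous_intros contd)
  define m where "m i y = integral (B i) (\<lambda>p. ball_kernel (r i) p *\<^sub>R h i (y + p))" for i y
  define c where "c i = integral (B i) (ball_kernel (r i))" for i
  define v where "v i y = m i y / c i" for i y
  have c: "c i > 0" for i unfolding c_def B_def by (rule integral_ball_kernel_pos[OF r])
  have sv: "smooth_on UNIV (v i)" for i
  proof -
    have "smooth_on UNIV (m i)"
      unfolding m_def B_def by (rule smooth_on_ball_mean[OF r open_UNIV conth]) simp_all
    then show ?thesis
      unfolding v_def divide_inverse by (intro smooth_on_mult smooth_on_const open_UNIV)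
  qed
  have contk: "continuous_on T (ball_kernel s)" for s and T :: "'a set"
    by (rule smooth_on_imp_continuous_on[OF smooth_on_subset[OF smooth_on_ball_kernel]]) simp
  have int: "(\<lambda>p. ball_kernel (r i) p *\<^sub>R h i (y + p)) integrable_on B i" "ball_kernel (r i) integrable_on B i" for i y
    unfolding B_def by (intro integrable_continuous continuous_intros contk continuous_on_compose2[OF conth]; simp)+
  have v_ge: "v i y \<ge> 1" if y: "d y \<le> (1/2) ^ i / 2" for i y
  proof -
    have "c i \<le> m i y"
      unfolding c_def m_def
    proof (rule integral_le[OF int(2,1)])
      fix p
      show "ball_kernel (r i) p \<le> ball_kernel (r i) p *\<^sub>R h i (y + p)"
      proof (cases "norm p < r i")
        case True
        have "d (y + p) \<le> d y + norm p" using lip[of "y + p" y] by (simp add: dist_norm)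
        then have "d (y + p) \<le> (1/2) ^ i"
          using y True zero_le_power[of "1/2 :: real" i] unfolding r_def by linarith
        then have "2 ^ i * d (y + p) \<le> 2 ^ i * (1/2) ^ i" by (intro mult_left_mono) auto
        then have "2 ^ i * d (y + p) \<le> 1" by (simp add: power_one_over)
        then have "h i (y + p) \<ge> 1" by (simp add: h_def)
        then show ?thesis using mult_left_mono[of 1 "h i (y + p)" "ball_kernel (r i) p"] ball_kernel_nonneg[of "r i" p] by simp
      next
        case False
        then have "ball_kernel (r i) p = 0" using r[of i] by (intro ball_kernel_eq_0) auto
        then show ?thesis by simp
      qed
    qed
    then show ?thesis using c[of i] by (simp add: v_def)
  qed
  have v_0: "v i y = 0" if y: "d y \<ge> 3 * (1/2) ^ i" for i y
  proof -
    have "ball_kernel (r i) p *\<^sub>R h i (y + p) = 0" for p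
    proof (cases "norm p < r i")
      case True
      have "d y \<le> d (y + p) + norm p" using lip[of y "y + p"] by (simp add: dist_norm)
      then have "2 * (1/2) ^ i \<le> d (y + p)" using y True zero_le_power[of "1/2 :: real" i] unfolding r_def by linarith
      then have "2 ^ i * (2 * (1/2) ^ i) \<le> 2 ^ i * d (y + p)" by (intro mult_left_mono) auto
      then have "2 \<le> 2 ^ i * d (y + p)" by (simp add: power_one_over)
      then show ?thesis by (simp add: h_def)
    next
      case False
      then have "ball_kernel (r i) p = 0" using r[of i] by (intro ball_kernel_eq_0) auto
      then show ?thesis by simp
    qed
    then have "m i y = 0" unfolding m_def by (simp only: integral_0)
    then show ?thesis by (simp add: v_def)
  qed
  have v_nonneg: "v i y \<ge> 0" for i y
  proof -
    have "m i y \<ge> 0"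
      unfolding m_def using int(1) by (intro integral_nonneg) (auto simp: ball_kernel_nonneg h_def)
    then show ?thesis using c[of i] by (simp add: v_def)
  qed
  define \<rho> where "\<rho> y = (\<Sum>i. v i y)" for y
  have \<rho>_eq: "\<rho> y = (\<Sum>i<j. v i y)" if "d y \<ge> 3 * (1/2) ^ j" for j y
    unfolding \<rho>_def
  proof (rule suminf_finite)
    fix i assume "i \<notin> {..<j}"
    then have "(1/2 :: real) ^ i \<le> (1/2) ^ j" by (intro power_decreasing) auto
    then show "v i y = 0" using that by (intro v_0) linarith
  qed simp
  have small: "\<exists>j\<ge>l. 3 * (1/2) ^ j < d y" if "y \<in> X" for y l
  proof -
    have "d y > 0"
      unfolding d_def using that assms False
      by (intro infdist_pos_not_in_closed) auto
    then obtain j where "(1/2 :: real) ^ j < d y / 3"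
      using real_arch_pow_inv[of "d y / 3" "1/2"] by auto
    moreover have "(1/2 :: real) ^ max l j \<le> (1/2) ^ j" by (intro power_decreasing) auto
    ultimately have "3 * (1/2) ^ max l j < d y" by linarith
    then show ?thesis using max.cobounded1 by blast
  qed
  show thesis
  proof
    show "smooth_on X \<rho>"
    proof (rule smooth_on_local)
      fix x assume "x \<in> X"
      then obtain j where j: "3 * (1/2) ^ j < d x" using small by blast
      let ?U = "{y. 3 * (1/2) ^ j < d y}"
      have "open ?U" by (intro open_Collect_less continuous_on_const contd)
      moreover have "smooth_on ?U (\<lambda>y. \<Sum>i<j. v i y)"
        using \<open>open ?U\<close> smooth_on_subset[OF sv] by (intro smooth_on_sum) auto
      then have "smooth_on ?U \<rho>"
        using smooth_on_cong[OF \<open>open ?U\<close>, of \<rho> "\<lambda>y. \<Sum>i<j. v i y"] \<rho>_eq by simp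
      ultimately show "\<exists>U. open U \<and> x \<in> U \<and> smooth_on U \<rho>" using j by blast
    qed
    fix z :: 'a and M :: real assume "z \<notin> X"
    obtain l :: nat where l: "M \<le> real l" using real_arch_simple by blast
    let ?U = "{y. d y < (1/2) ^ l / 2}"
    have "open ?U" by (intro open_Collect_less continuous_on_const contd)
    moreover have "z \<in> ?U" using \<open>z \<notin> X\<close> by (simp add: d_def)
    moreover have "\<rho> y \<ge> M" if y: "y \<in> ?U \<inter> X" for y
    proof -
      obtain j where j: "j \<ge> l" "3 * (1/2) ^ j < d y" using small y by blast
      have "real l = (\<Sum>i<l. 1)" by simp
      also have "\<dots> \<le> (\<Sum>i<l. v i y)"
      proof (rule sum_mono)
        fix i assume "i \<in> {..<l}"
        then have "(1/2 :: real) ^ l \<le> (1/2) ^ i" by (intro power_decreasing) auto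
        moreover have "d y < (1/2) ^ l / 2" using y by simp
        ultimately show "1 \<le> v i y" by (intro v_ge) linarith
      qed
      also have "\<dots> \<le> (\<Sum>i<j. v i y)" using j(1) v_nonneg by (intro sum_mono2) auto
      also have "\<dots> = \<rho> y" using \<rho>_eq[of j y] j(2) by simp
      finally show ?thesis using l by simp
    qed
    ultimately show "\<exists>U. open U \<and> z \<in> U \<and> (\<forall>y\<in>U \<inter> X. \<rho> y \<ge> M)" by blast
  qed
qed

definition smooth_step :: "real \<Rightarrow> real" where
  "smooth_step t = flat_exp 0 (1 - t) / (flat_exp 0 (1 - t) + flat_exp 0 (t - 1/2))"

lemma smooth_on_smooth_step: "smooth_on UNIV smooth_step"
proof -
  have lin: "smooth_on UNIV (\<lambda>t::real. t)"
    by (rule smooth_on_bounded_linear[OF bounded_linear_ident])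
  have 1: "smooth_on UNIV (\<lambda>t. flat_exp 0 (1 - t))"
    by (rule smooth_on_compose_real[OF open_UNIV smooth_on_flat_exp]) (intro smooth_on_diff smooth_on_const lin open_UNIV)
  have 2: "smooth_on UNIV (\<lambda>t. flat_exp 0 (t - 1/2))"
    by (rule smooth_on_compose_real[OF open_UNIV smooth_on_flat_exp]) (intro smooth_on_diff smooth_on_const lin open_UNIV)
  \<comment> \<open>The summands are positive for \<open>t < 1\<close> and for
    \<open>t > 1/2\<close> respectively, and these half-lines cover the line.\<close>
  have "flat_exp 0 (1 - t) + flat_exp 0 (t - 1/2) \<noteq> 0" for t
  proof (cases "t < 1")
    case True
    then show ?thesis using flat_exp_pos[of "1 - t" 0] flat_exp_nonneg[of 0 "t - 1/2"] by linarith
  next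
    case False
    then show ?thesis using flat_exp_pos[of "t - 1/2" 0] flat_exp_nonneg[of 0 "1 - t"] by linarith
  qed
  then show ?thesis
    unfolding smooth_step_def by (intro smooth_on_divide smooth_on_add 1 2 open_UNIV) auto
qed

lemma smooth_step_eq_1: "t \<le> 1/2 \<Longrightarrow> smooth_step t = 1"
  using flat_exp_pos[of "1 - t" 0] by (simp add: smooth_step_def flat_exp_nonpos)

lemma smooth_step_eq_0: "t \<ge> 1 \<Longrightarrow> smooth_step t = 0"
  by (simp add: smooth_step_def flat_exp_nonpos)

text \<open>The cutoff is a step function of \<bar>\<open>q\<^sub>0\<close>\<bar> squared times
  \<rho>. This product is 0 on the slice. Near a point of \<Omega> lying over no point of the slice
  it is at least 1 wherever \<rho> is defined, because there \<open>q\<^sub>0\<close> stays away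
  from 0 while \<rho> is large.\<close>

lemma cutoff_exists:
  fixes \<Omega> :: "'m::finite hspace set"
  assumes X: "open (slice \<Omega>)"
  obtains \<phi> :: "'m hspace \<Rightarrow> complex" and N1 N2 where "smooth_on \<Omega> \<phi>"
    "open N1" "\<And>x. x \<in> \<Omega> \<Longrightarrow> fst x = 0 \<Longrightarrow> x \<in> N1" "\<And>x. x \<in> \<Omega> \<inter> N1 \<Longrightarrow> \<phi> x = 1"
    "open N2" "\<And>x. x \<in> \<Omega> \<Longrightarrow> snd x \<notin> slice \<Omega> \<Longrightarrow> x \<in> N2" "\<And>x. x \<in> \<Omega> \<inter> N2 \<Longrightarrow> \<phi> x = 0"
proof -
  obtain \<rho> :: "'m hspace' \<Rightarrow> real" where \<rho>: "smooth_on (slice \<Omega>) \<rho>"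
    and bd: "\<And>z M. z \<notin> slice \<Omega> \<Longrightarrow> \<exists>U. open U \<and> z \<in> U \<and> (\<forall>y\<in>U \<inter> slice \<Omega>. \<rho> y \<ge> M)"
    using smooth_exhaustion[OF X] by blast
  define W where "W = {x :: 'm hspace. snd x \<in> slice \<Omega>}"
  have W: "open W" unfolding W_def using open_vimage_snd[OF X] by (simp add: vimage_def)
  define s where "s x = (fst x \<bullet> fst x) * \<rho> (snd x)" for x :: "'m hspace"
  have s: "smooth_on W s"
  proof -
    have "smooth_on W (\<lambda>x. fst x \<bullet> fst x)"
      by (rule smooth_on_compose_linear[OF W bounded_linear_fst smooth_on_inner_self[of UNIV]]) simp
    moreover have "smooth_on W (\<lambda>x. \<rho> (snd x))"
      by (rule smooth_on_compose_linear[OF W bounded_linear_snd \<rho>]) (auto simp: W_def)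
    ultimately show ?thesis unfolding s_def by (intro smooth_on_mult W)
  qed
  define \<phi> where "\<phi> x = (if x \<in> W then complex_of_real (smooth_step (s x)) else 0)" for x
  define N1 where "N1 = {x \<in> W. s x < 1/2}"
  define N2 where "N2 = interior {x. \<phi> x = 0}"
  have "open N1"
  proof -
    have "N1 = W \<inter> s -` {..<1/2}" by (auto simp: N1_def)
    then show ?thesis
      using continuous_open_preimage[OF smooth_on_imp_continuous_on[OF s] W, of "{..<1/2}"] by simp
  qed
  moreover have "x \<in> N1" if "x \<in> \<Omega>" "fst x = 0" for x
    using that by (cases x) (simp add: N1_def W_def s_def slice_def)
  moreover have "\<phi> x = 1" if "x \<in> \<Omega> \<inter> N1" for x
    using that by (simp add: \<phi>_def N1_def smooth_step_eq_1)
  moreover have "open N2" by (simp add: N2_def)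
  moreover have N2: "x \<in> N2" if x: "x \<in> \<Omega>" "snd x \<notin> slice \<Omega>" for x
  proof -
    have q: "fst x \<noteq> 0" using x by (cases x) (auto simp: slice_def)
    \<comment> \<open>Half of the value at \<open>x\<close> leaves room for a neighbourhood; on it
      the product is at least \<open>\<delta> * (1 / \<delta>) = 1\<close>, where the step function
      has reached 0.\<close>
    define \<delta> where "\<delta> = fst x \<bullet> fst x / 2"
    have \<delta>: "\<delta> > 0" using q by (simp add: \<delta>_def)
    obtain U where U: "open U" "snd x \<in> U" "\<And>y. y \<in> U \<inter> slice \<Omega> \<Longrightarrow> \<rho> y \<ge> 1 / \<delta>"
      using bd[OF x(2), of "1 / \<delta>"] by blast
    define V where "V = {q :: real^4. q \<bullet> q > \<delta>}"
    have "open V" unfolding V_def by (intro open_Collect_less continuous_intros)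
    moreover have "fst x \<in> V" using \<delta> by (simp add: V_def \<delta>_def)
    ultimately have "open (V \<times> U)" "x \<in> V \<times> U" using U by (auto simp: open_Times mem_Times_iff)
    moreover have "V \<times> U \<subseteq> {x. \<phi> x = 0}"
    proof
      fix p assume p: "p \<in> V \<times> U"
      show "p \<in> {x. \<phi> x = 0}"
      proof (cases "p \<in> W")
        case True
        then have "\<rho> (snd p) \<ge> 1 / \<delta>" using U(3) p by (auto simp: W_def)
        moreover have "fst p \<bullet> fst p \<ge> \<delta>" using p by (auto simp: V_def)
        ultimately have "\<delta> * (1 / \<delta>) \<le> s p"
          unfolding s_def using \<delta> by (intro mult_mono) auto
        then show ?thesis using \<delta> by (simp add: \<phi>_def smooth_step_eq_0)
      qed (simp add: \<phi>_def)
    qed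
    ultimately show ?thesis unfolding N2_def by (rule interiorI)
  qed
  moreover have "\<phi> x = 0" if "x \<in> \<Omega> \<inter> N2" for x
    using that interior_subset by (auto simp: N2_def)
  moreover have "smooth_on \<Omega> \<phi>"
  proof (rule smooth_on_local)
    fix x assume x: "x \<in> \<Omega>"
    show "\<exists>U. open U \<and> x \<in> U \<and> smooth_on U \<phi>"
    proof (cases "x \<in> W")
      case True
      have "smooth_on W (\<lambda>x. complex_of_real (smooth_step (s x)))"
        by (rule smooth_on_linear[OF W bounded_linear_of_real smooth_on_compose_real[OF W smooth_on_smooth_step s]])
      then have "smooth_on W \<phi>"
        using smooth_on_cong[OF W, of \<phi> "\<lambda>x. complex_of_real (smooth_step (s x))"] by (simp add: \<phi>_def)
      then show ?thesis using True W by blast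
    next
      case False
      then have "x \<in> N2" using x N2 by (simp add: W_def)
      moreover have "\<phi> y = 0" if "y \<in> N2" for y
        using that interior_subset by (auto simp: N2_def)
      then have "smooth_on N2 \<phi>"
        using smooth_on_cong[OF \<open>open N2\<close>, of \<phi> "\<lambda>x. 0"] by simp
      ultimately show ?thesis using \<open>open N2\<close> by blast
    qed
  qed
  ultimately show thesis using that by blast
qed

lemma open_slice:
  fixes \<Omega> :: "'m::finite hspace set"
  assumes "open \<Omega>"
  shows "open (slice \<Omega>)"
proof -
  have "continuous_on UNIV (\<lambda>y :: 'm hspace'. (0 :: real^4, y))" by (intro continuous_intros)
  from open_vimage[OF assms this] show ?thesis by (simp add: slice_def vimage_def)
qed

section \<open>Contraction with the coordinates\<close>

lemma bounded_linear_z_coord: "bounded_linear (z_coord A a)"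
proof -
  have "linear (z_coord A a)"
    by (rule linearI) (cases a; simp add: z_coord_def Let_def algebra_simps scaleR_conv_of_real[where 'a=complex])+
  then show ?thesis by (simp add: linear_conv_bounded_linear)
qed

lemmas smooth_on_z_coord = smooth_on_bounded_linear[OF bounded_linear_z_coord]

text \<open>Thus the contraction of \<open>d z\<^sub>A\<close> with a symmetric tensor vanishes.\<close>

lemma nabla_z_coord_antisymmetric:
  "nabla (frame \<sigma>) b K (z_coord A a) x = - nabla (frame \<sigma>) a K (z_coord A b) x"
proof -
  have D: "frechet_derivative (z_coord A a) (at x) = z_coord A a" for a
    by (rule frechet_derivative_at[symmetric]) (rule bounded_linear_imp_has_derivative[OF bounded_linear_z_coord])
  show ?thesis
  proof (cases "K < 2")
    case True
    then have "K = 0 \<or> K = 1" by auto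
    moreover have "fst (frame \<sigma> 0) = axis 0 1" "fst (frame \<sigma> 1) = axis 1 1"
      "fst (frame \<sigma> 2) = axis 2 1" "fst (frame \<sigma> 3) = axis 3 1"
      by (simp_all add: frame_def)
    then have "fst (frame \<sigma> 0) = axis 0 1" "fst (frame \<sigma> (Suc 0)) = axis 1 1"
      "fst (frame \<sigma> (Suc (Suc 0))) = axis 2 1" "fst (frame \<sigma> 3) = axis 3 1"
      by (simp_all add: numeral_2_eq_2)
    ultimately show ?thesis
      by (cases a; cases b) (auto simp: nabla_def Let_def D z_coord_def axis_def)
  next
    case False
    then obtain t where t: "K div 2 = Suc t" by (cases "K div 2") auto
    have "fst (frame \<sigma> m) = 0" if "4 \<le> m" for m
      using that by (simp add: frame_def)
    then show ?thesis
      by (simp add: nabla_def Let_def D z_coord_def t split: pidx.split)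
  qed
qed

text \<open>The first-order operator of all degrees \<open>j < m\<close> in one formula, freed of
  \<open>m\<close> and \<open>j\<close>, so that identities can be proved for arbitrary families and
  degrees enter only with the sections.\<close>

definition T_op ::
  "nat \<Rightarrow> (nat \<Rightarrow> 'm::finite) \<Rightarrow> ('m hspace \<Rightarrow> tensor_form) \<Rightarrow> 'm hspace \<Rightarrow> tensor_form" where
  "T_op n \<sigma> f x B I = d_op n \<sigma> P0 (\<lambda>y. f y (P0 # B)) x I + d_op n \<sigma> P1 (\<lambda>y. f y (P1 # B)) x I"

definition contr :: "nat \<Rightarrow> ('m::finite hspace \<Rightarrow> tensor_form) \<Rightarrow> 'm hspace \<Rightarrow> tensor_form" where
  "contr A h x B I = z_coord A P0 x * h x (P0 # B) I + z_coord A P1 x * h x (P1 # B) I"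

lemma L1_eq_contr: "L1 h x B I = - contr 1 h x B I"
  by (simp add: L1_def contr_def)

lemma L2_eq_contr: "L2 h x B I = contr 0 h x B I"
  by (simp add: L2_def contr_def)

definition smooth_tf :: "'m::finite hspace set \<Rightarrow> ('m hspace \<Rightarrow> tensor_form) \<Rightarrow> bool" where
  "smooth_tf S f \<longleftrightarrow> (\<forall>B I. smooth_on S (\<lambda>x. f x B I))"

text \<open>The identities below exchange only the first two indices, so the symmetry is stated in
  this form, for strings of any length.\<close>

definition swap_sym :: "'m::finite hspace set \<Rightarrow> ('m hspace \<Rightarrow> tensor_form) \<Rightarrow> bool" where
  "swap_sym S f \<longleftrightarrow> (\<forall>x\<in>S. \<forall>a b B I. f x (a # b # B) I = f x (b # a # B) I)"

lemma D_op_less: "j < m \<Longrightarrow> D_op n \<sigma> m j f x B I = T_op n \<sigma> f x B I"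
  by (simp add: D_op_def T_op_def)

lemma T_op_cong:
  assumes "open S" "x \<in> S" "\<And>y B I. y \<in> S \<Longrightarrow> f y B I = g y B I"
  shows "T_op n \<sigma> f x B I = T_op n \<sigma> g x B I"
proof -
  have "d_op n \<sigma> a (\<lambda>y. f y (a # B)) x I = d_op n \<sigma> a (\<lambda>y. g y (a # B)) x I" for a
    by (rule d_op_cong[OF assms(1,2)]) (rule assms(3))
  then show ?thesis by (simp add: T_op_def)
qed

lemma T_op_zero: "T_op n \<sigma> (\<lambda>x B I. 0) x B I = 0"
  by (simp add: T_op_def d_op_zero)

lemma smooth_tf_T_op: "open S \<Longrightarrow> smooth_tf S f \<Longrightarrow> smooth_tf S (T_op n \<sigma> f)"
  unfolding smooth_tf_def T_op_def by (auto intro!: smooth_on_add smooth_on_d_op)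

lemma smooth_tf_contr: "open S \<Longrightarrow> smooth_tf S f \<Longrightarrow> smooth_tf S (contr A f)"
  unfolding smooth_tf_def contr_def by (auto intro!: smooth_on_add smooth_on_mult smooth_on_z_coord)

lemma T_op_combination:
  assumes "x \<in> S" "smooth_tf S f" "smooth_tf S g"
  shows "T_op n \<sigma> (\<lambda>y B I. c * f y B I + d * g y B I) x B I = c * T_op n \<sigma> f x B I + d * T_op n \<sigma> g x B I"
proof -
  have diff: "(\<lambda>y. f y B I) differentiable (at x)" "(\<lambda>y. g y B I) differentiable (at x)" for B I
    using assms by (auto simp: smooth_tf_def intro!: smooth_on_imp_differentiable[OF _ assms(1)])
  show ?thesis
    by (simp add: T_op_def d_op_add d_op_cmult diff differentiable_mult algebra_simps)
qed

lemma T_op_add: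
  assumes "x \<in> S" "smooth_tf S f" "smooth_tf S g"
  shows "T_op n \<sigma> (\<lambda>y B I. f y B I + g y B I) x B I = T_op n \<sigma> f x B I + T_op n \<sigma> g x B I"
  using T_op_combination[OF assms, where c=1 and d=1] by simp

lemma T_op_diff:
  assumes "x \<in> S" "smooth_tf S f" "smooth_tf S g"
  shows "T_op n \<sigma> (\<lambda>y B I. f y B I - g y B I) x B I = T_op n \<sigma> f x B I - T_op n \<sigma> g x B I"
  using T_op_combination[OF assms, where c=1 and d="-1"] by simp

lemma T_op_minus:
  assumes "x \<in> S" "smooth_tf S f"
  shows "T_op n \<sigma> (\<lambda>y B I. - f y B I) x B I = - T_op n \<sigma> f x B I"
  using T_op_combination[OF assms assms(2), where c="-1" and d="0"] by simp

text \<open>The composites \<open>d_op P0 (d_op P1)\<close> and \<open>d_op P1 (d_op P0)\<close> are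
  opposite, the squares vanish, and the tensor to which they are applied is symmetric in the two
  indices.\<close>

lemma T_op_T_op:
  assumes S: "open S" "x \<in> S" and f: "smooth_tf S f" and sym: "swap_sym S f"
  shows "T_op n \<sigma> (T_op n \<sigma> f) x B I = 0"
proof -
  let ?d = "\<lambda>a b. d_op n \<sigma> a (d_op n \<sigma> b (\<lambda>y. f y (b # a # B))) x I"
  have sm: "smooth_on S (\<lambda>y. f y C J)" for C J using f by (simp add: smooth_tf_def)
  have diff: "(\<lambda>y. d_op n \<sigma> b (\<lambda>y. f y C) y J) differentiable (at x)" for b C J
    using smooth_on_imp_differentiable[OF smooth_on_d_op[OF S(1) sm] S(2)] .
  have "T_op n \<sigma> (T_op n \<sigma> f) x B I = ?d P0 P0 + ?d P0 P1 + (?d P1 P0 + ?d P1 P1)"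
    unfolding T_op_def[abs_def] by (simp add: d_op_add diff)
  moreover have "?d P0 P0 = 0" "?d P1 P1 = 0"
    using d_op_d_op_same[OF S sm] by auto
  moreover have "?d P0 P1 = - ?d P1 P0"
  proof -
    have "?d P0 P1 = - d_op n \<sigma> P1 (d_op n \<sigma> P0 (\<lambda>y. f y (P1 # P0 # B))) x I"
      by (rule d_op_anticommute[OF S sm])
    also have "d_op n \<sigma> P1 (d_op n \<sigma> P0 (\<lambda>y. f y (P1 # P0 # B))) x I = ?d P1 P0"
      using sym by (intro d_op_cong[OF S] d_op_cong[OF S(1)]) (auto simp: swap_sym_def)
    finally show ?thesis .
  qed
  ultimately show ?thesis by simp
qed

text \<open>The complex property at the passage to the second-order operator: in each summand one of
  the two anticommuting operators occurs twice.\<close>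

lemma d_op_d_op_T_op:
  assumes S: "open S" "x \<in> S" and f: "smooth_tf S f"
  shows "d_op n \<sigma> P0 (d_op n \<sigma> P1 (\<lambda>y. T_op n \<sigma> f y B)) x I = 0"
proof -
  have sm: "smooth_on S (\<lambda>y. f y C J)" for C J using f by (simp add: smooth_tf_def)
  have diff: "(\<lambda>y. d_op n \<sigma> b (\<lambda>y. f y C) y J) differentiable (at y)" if "y \<in> S" for b C J y
    using smooth_on_imp_differentiable[OF smooth_on_d_op[OF S(1) sm] that] .
  have 1: "d_op n \<sigma> P1 (\<lambda>y. T_op n \<sigma> f y B) y J = d_op n \<sigma> P1 (d_op n \<sigma> P0 (\<lambda>y. f y (P0 # B))) y J"
    if "y \<in> S" for y J
    unfolding T_op_def[abs_def]
    using d_op_d_op_same[OF S(1) that sm] by (simp add: d_op_add diff[OF that])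
  have "d_op n \<sigma> P0 (d_op n \<sigma> P1 (\<lambda>y. T_op n \<sigma> f y B)) x I =
      d_op n \<sigma> P0 (d_op n \<sigma> P1 (d_op n \<sigma> P0 (\<lambda>y. f y (P0 # B)))) x I"
    by (rule d_op_cong[OF S]) (rule 1)
  also have "\<dots> = - d_op n \<sigma> P1 (d_op n \<sigma> P0 (d_op n \<sigma> P0 (\<lambda>y. f y (P0 # B)))) x I"
    by (rule d_op_anticommute[OF S]) (rule smooth_on_d_op[OF S(1) sm])
  also have "d_op n \<sigma> P1 (d_op n \<sigma> P0 (d_op n \<sigma> P0 (\<lambda>y. f y (P0 # B)))) x I = d_op n \<sigma> P1 (\<lambda>y J. 0) x I"
    by (rule d_op_cong[OF S]) (rule d_op_d_op_same[OF S(1) _ sm])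
  finally show ?thesis by (simp add: d_op_zero)
qed

text \<open>By the Leibniz rule the two sides differ by the derivatives of the coordinates
  contracted with two indices of \<open>f\<close>. The derivatives are antisymmetric in these
  indices and \<open>f\<close> is symmetric: the mixed terms cancel, and each diagonal term equals
  its own negative.\<close>

lemma T_op_contr:
  assumes S: "open S" "x \<in> S" and f: "smooth_tf S f" and sym: "swap_sym S f"
  shows "T_op n \<sigma> (contr A f) x B I = contr A (T_op n \<sigma> f) x B I"
proof -
  have sm: "smooth_on S (\<lambda>y. f y C J)" for C J using f by (simp add: smooth_tf_def)
  have diff: "(\<lambda>y. f y C J) differentiable (at x)" for C J
    using smooth_on_imp_differentiable[OF sm S(2)] .
  have zdiff: "z_coord A a differentiable (at x)" for a
    using smooth_on_imp_differentiable[OF smooth_on_z_coord] by blast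
  let ?r = "\<lambda>a b. if I \<subseteq> {..<2*n} then \<Sum>K\<in>I. wsign I K *
      (nabla (frame \<sigma>) b K (z_coord A a) x * f x (a # b # B) (I - {K})) else 0"
  have d: "d_op n \<sigma> b (\<lambda>y. contr A f y (b # B)) x I =
     z_coord A P0 x * d_op n \<sigma> b (\<lambda>y. f y (P0 # b # B)) x I + ?r P0 b +
     (z_coord A P1 x * d_op n \<sigma> b (\<lambda>y. f y (P1 # b # B)) x I + ?r P1 b)" for b
    unfolding contr_def[abs_def]
    by (simp add: d_op_add d_op_mult diff zdiff differentiable_mult)
  have comm: "d_op n \<sigma> b (\<lambda>y. f y (a # b # B)) x I = d_op n \<sigma> b (\<lambda>y. f y (b # a # B)) x I" for a b
    using sym by (intro d_op_cong[OF S]) (auto simp: swap_sym_def)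
  have anti: "?r a b = - ?r b a" for a b
  proof -
    have "nabla (frame \<sigma>) b K (z_coord A a) x * f x (a # b # B) J =
        - (nabla (frame \<sigma>) a K (z_coord A b) x * f x (b # a # B) J)" for K J
      using sym S(2) nabla_z_coord_antisymmetric[of \<sigma> b K A a x] by (simp add: swap_sym_def)
    then show ?thesis by (simp add: sum_negf[symmetric])
  qed
  have "z = 0" if "z = - z" for z :: complex
    using that by (simp add: complex_eq_iff)
  note zero = this[OF anti[of P0 P0]] this[OF anti[of P1 P1]]
  have "?r P1 P0 = - ?r P0 P1" by (rule anti)
  note zero this
  then show ?thesis
    unfolding T_op_def[of _ _ "contr A f"] d
    by (simp only: contr_def T_op_def comm[of P0 P1] comm[of P1 P0]) (simp add: algebra_simps)
qed

text \<open>This is the reason for \<open>M \<circ> L = 0\<close>, where the two iterated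
  contractions occur with opposite signs.\<close>

lemma contr_swap:
  assumes "x \<in> S" "swap_sym S f"
  shows "contr A (contr A' f) x B I = contr A' (contr A f) x B I"
  using assms by (simp add: contr_def swap_sym_def algebra_simps)

section \<open>Smooth sections\<close>

lemma sections_tf: "f \<in> smooth_sections n S m j \<Longrightarrow> smooth_tf S f"
  by (simp add: smooth_sections_def smooth_tf_def)

lemma sections_sym:
  "f \<in> smooth_sections n S m j \<Longrightarrow> x \<in> S \<Longrightarrow> mset B = mset C \<Longrightarrow> f x B I = f x C I"
  unfolding smooth_sections_def V_space_def sym_tensors_def by blast

lemma sections_swap: "f \<in> smooth_sections n S m j \<Longrightarrow> swap_sym S f"
  unfolding swap_sym_def using sections_sym[of f n S m j] by (simp add: add_mset_commute)

lemma sections_length: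
  "f \<in> smooth_sections n S m j \<Longrightarrow> x \<in> S \<Longrightarrow> length B \<noteq> m - j \<Longrightarrow> f x B I = 0"
  unfolding smooth_sections_def V_space_def sym_tensors_def by blast

lemma sections_degree:
  assumes "f \<in> smooth_sections n S m j" "x \<in> S" "j \<le> m" "\<not> (I \<subseteq> {..<2*n} \<and> card I = j)"
  shows "f x B I = 0"
proof -
  have "\<forall>B I. \<not> (I \<subseteq> {..<2*n} \<and> card I = (if j \<le> m then j else m + 2)) \<longrightarrow> f x B I = 0"
    using assms(1,2) unfolding smooth_sections_def V_space_def by blast
  then show ?thesis using assms(3,4) by simp
qed

lemma smooth_sectionsI:
  assumes "j \<le> m" "smooth_tf S f"
    and "\<And>x B C I. x \<in> S \<Longrightarrow> mset B = mset C \<Longrightarrow> f x B I = f x C I"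
    and "\<And>x B I. x \<in> S \<Longrightarrow> length B \<noteq> m - j \<Longrightarrow> f x B I = 0"
    and "\<And>x B I. x \<in> S \<Longrightarrow> \<not> (I \<subseteq> {..<2*n} \<and> card I = j) \<Longrightarrow> f x B I = 0"
  shows "f \<in> smooth_sections n S m j"
  unfolding smooth_sections_def V_space_def sym_tensors_def mem_Collect_eq
proof (intro conjI ballI allI impI)
  show "smooth_on S (\<lambda>x. f x B I)" for B I
    using assms(2) by (simp add: smooth_tf_def)
next
  fix x I and B C :: "pidx list"
  assume "x \<in> S" "mset B = mset C"
  then show "f x B I = f x C I" by (rule assms(3))
qed (use assms(1,4,5) in auto)

lemma sections_T_op:
  assumes "f \<in> smooth_sections n S m j" "j < m" "open S"
  shows "T_op n \<sigma> f \<in> smooth_sections n S m (Suc j)"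
proof (rule smooth_sectionsI)
  show "smooth_tf S (T_op n \<sigma> f)"
    by (intro smooth_tf_T_op sections_tf[OF assms(1)] assms)
next
  fix x and B C :: "pidx list" and I
  assume x: "x \<in> S" and BC: "mset B = mset C"
  have "d_op n \<sigma> a (\<lambda>y. f y (a # B)) x I = d_op n \<sigma> a (\<lambda>y. f y (a # C)) x I" for a
    by (rule d_op_cong[OF assms(3) x], rule sections_sym[OF assms(1)]) (use BC in auto)
  then show "T_op n \<sigma> f x B I = T_op n \<sigma> f x C I" by (simp add: T_op_def)
next
  fix x and B :: "pidx list" and I
  assume x: "x \<in> S" and B: "length B \<noteq> m - Suc j"
  have "d_op n \<sigma> a (\<lambda>y. f y (a # B)) x I = d_op n \<sigma> a (\<lambda>y I. 0) x I" for a
    by (rule d_op_cong[OF assms(3) x], rule sections_length[OF assms(1)]) (use B assms(2) in auto)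
  then show "T_op n \<sigma> f x B I = 0" by (simp add: T_op_def d_op_zero)
next
  fix x and B :: "pidx list" and I
  assume x: "x \<in> S" and I: "\<not> (I \<subseteq> {..<2 * n} \<and> card I = Suc j)"
  have zero: "nabla (frame \<sigma>) a K (\<lambda>y. f y (a # B) (I - {K})) x = 0"
    if K: "K \<in> I" "I \<subseteq> {..<2*n}" for a K
  proof -
    have "finite I" using K(2) finite_subset by blast
    then have "card I = Suc (card (I - {K}))" using K(1) by (rule card.remove)
    then have deg: "\<not> (I - {K} \<subseteq> {..<2 * n} \<and> card (I - {K}) = j)" using I K(2) by auto
    have "nabla (frame \<sigma>) a K (\<lambda>y. f y (a # B) (I - {K})) x = nabla (frame \<sigma>) a K (\<lambda>y. 0) x"
      by (rule nabla_cong[OF assms(3) x], rule sections_degree[OF assms(1) _ _ deg])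
        (use assms(2) in auto)
    then show ?thesis by simp
  qed
  have "d_op n \<sigma> a (\<lambda>y. f y (a # B)) x I = 0" for a
  proof (cases "I \<subseteq> {..<2*n}")
    case True
    have "(\<Sum>K\<in>I. wsign I K * nabla (frame \<sigma>) a K (\<lambda>y. f y (a # B) (I - {K})) x) = 0"
      by (rule sum.neutral) (simp add: zero[OF _ True])
    then show ?thesis by (simp add: d_op_eq)
  qed (simp add: d_op_eq)
  then show "T_op n \<sigma> f x B I = 0" by (simp add: T_op_def)
qed (use assms(2) in auto)

lemma sections_contr:
  assumes "f \<in> smooth_sections n S (Suc m) j" "j \<le> m" "open S"
  shows "contr A f \<in> smooth_sections n S m j"
proof (rule smooth_sectionsI)
  show "smooth_tf S (contr A f)"
    by (intro smooth_tf_contr sections_tf[OF assms(1)] assms)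
next
  fix x I and B C :: "pidx list"
  assume "x \<in> S" "mset B = mset C"
  then have "f x (a # B) I = f x (a # C) I" for a
    by (intro sections_sym[OF assms(1)]) auto
  then show "contr A f x B I = contr A f x C I" by (simp add: contr_def)
qed (use assms in \<open>auto simp: contr_def sections_length[OF assms(1)] sections_degree[OF assms(1)]\<close>)

lemma sections_combination:
  assumes "f \<in> smooth_sections n S m j" "g \<in> smooth_sections n S m j" "j \<le> m" "open S"
  shows "(\<lambda>x B I. c * f x B I + d * g x B I) \<in> smooth_sections n S m j"
proof (rule smooth_sectionsI)
  show "smooth_tf S (\<lambda>x B I. c * f x B I + d * g x B I)"
    using assms by (auto simp: smooth_tf_def smooth_sections_def intro!: smooth_on_add smooth_on_mult)
next
  fix x I and B C :: "pidx list"
  assume "x \<in> S" "mset B = mset C"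
  from sections_sym[OF assms(1) this] sections_sym[OF assms(2) this]
  show "c * f x B I + d * g x B I = c * f x C I + d * g x C I" by simp
qed (use assms(3) in \<open>simp_all add: sections_length[OF assms(1)] sections_degree[OF assms(1)]
  sections_length[OF assms(2)] sections_degree[OF assms(2)]\<close>)

lemma sections_add:
  assumes "f \<in> smooth_sections n S m j" "g \<in> smooth_sections n S m j" "j \<le> m" "open S"
  shows "(\<lambda>x B I. f x B I + g x B I) \<in> smooth_sections n S m j"
  using sections_combination[OF assms, of 1 1] by simp

lemma sections_diff:
  assumes "f \<in> smooth_sections n S m j" "g \<in> smooth_sections n S m j" "j \<le> m" "open S"
  shows "(\<lambda>x B I. f x B I - g x B I) \<in> smooth_sections n S m j"
  using sections_combination[OF assms, of 1 "-1"] by simp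

lemma sections_minus:
  assumes "f \<in> smooth_sections n S m j" "j \<le> m" "open S"
  shows "(\<lambda>x B I. - f x B I) \<in> smooth_sections n S m j"
  using sections_combination[OF assms(1,1,2,3), of "-1" 0] by simp

lemma sections_zero: "(\<lambda>x B I. 0) \<in> smooth_sections n S m j"
  by (simp add: smooth_sections_def V_space_def sym_tensors_def)

lemma sections_mult:
  assumes "f \<in> smooth_sections n S m j" "smooth_on S \<phi>" "j \<le> m" "open S"
  shows "(\<lambda>x B I. \<phi> x * f x B I) \<in> smooth_sections n S m j"
proof (rule smooth_sectionsI)
  show "smooth_tf S (\<lambda>x B I. \<phi> x * f x B I)"
    using assms by (auto simp: smooth_tf_def smooth_sections_def intro!: smooth_on_mult)
next
  fix x I and B C :: "pidx list"
  assume "x \<in> S" "mset B = mset C"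
  from sections_sym[OF assms(1) this]
  show "\<phi> x * f x B I = \<phi> x * f x C I" by simp
qed (use assms(3) in \<open>simp_all add: sections_length[OF assms(1)] sections_degree[OF assms(1)]\<close>)

lemma sections_local:
  assumes "\<And>x. x \<in> S \<Longrightarrow> \<exists>U. open U \<and> x \<in> U \<and> f \<in> smooth_sections n U m j"
  shows "f \<in> smooth_sections n S m j"
proof -
  have "f x \<in> V_space n m j" if "x \<in> S" for x
    using assms[OF that] by (auto simp: smooth_sections_def)
  moreover have "smooth_on S (\<lambda>x. f x B I)" for B I
    by (rule smooth_on_local) (use assms in \<open>fastforce simp: smooth_sections_def\<close>)
  ultimately show ?thesis by (simp add: smooth_sections_def)
qed

lemma sections_subset:
  "f \<in> smooth_sections n S m j \<Longrightarrow> U \<subseteq> S \<Longrightarrow> f \<in> smooth_sections n U m j"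
  unfolding smooth_sections_def using smooth_on_subset by blast

lemma sections_cong:
  assumes "open S" "\<And>x B I. x \<in> S \<Longrightarrow> f x B I = g x B I" "g \<in> smooth_sections n S m j"
  shows "f \<in> smooth_sections n S m j"
proof -
  have "f x = g x" if "x \<in> S" for x using assms(2)[OF that] by (intro ext)
  moreover have "smooth_on S (\<lambda>x. f x B I)" for B I
    using smooth_on_cong[OF assms(1), of "\<lambda>x. f x B I" "\<lambda>x. g x B I"] assms by (simp add: smooth_sections_def)
  ultimately show ?thesis using assms(3) by (simp add: smooth_sections_def)
qed

section \<open>Cohomology classes\<close>

text \<open>A common form of the two components of \<open>L\<close>, so that the statements on
  classes are proved once for both.\<close>

definition L_op :: "complex \<Rightarrow> nat \<Rightarrow> ('m::finite hspace \<Rightarrow> tensor_form) \<Rightarrow> 'm hspace \<Rightarrow> tensor_form" where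
  "L_op c A h = (\<lambda>x B I. c * contr A h x B I)"

lemma L1_eq_L_op: "L1 = L_op (-1) 1"
  by (intro ext) (simp add: L1_eq_contr L_op_def)

lemma L2_eq_L_op: "L2 = L_op 1 0"
  by (intro ext) (simp add: L2_eq_contr L_op_def)

lemma sections_cmult:
  "f \<in> smooth_sections n S m j \<Longrightarrow> j \<le> m \<Longrightarrow> open S \<Longrightarrow> (\<lambda>x B I. c * f x B I) \<in> smooth_sections n S m j"
  using sections_mult[of f n S m j "\<lambda>x. c"] by simp

lemma sections_L_op:
  "f \<in> smooth_sections n S (Suc m) j \<Longrightarrow> j \<le> m \<Longrightarrow> open S \<Longrightarrow> L_op c A f \<in> smooth_sections n S m j"
  unfolding L_op_def by (intro sections_cmult sections_contr)

lemma L_op_diff: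
  "L_op c A (\<lambda>x B I. f x B I - g x B I) x B I = L_op c A f x B I - L_op c A g x B I"
  by (simp add: L_op_def contr_def algebra_simps)

lemma L_op_cong:
  "(\<And>B I. f x B I = g x B I) \<Longrightarrow> L_op c A f x B I = L_op c A g x B I"
  by (simp add: L_op_def contr_def)

lemma T_op_L_op:
  assumes "open S" "x \<in> S" "f \<in> smooth_sections n S m j"
  shows "T_op n \<sigma> (L_op c A f) x B I = L_op c A (T_op n \<sigma> f) x B I"
proof -
  have tf: "smooth_tf S (contr A f)"
    by (rule smooth_tf_contr[OF assms(1) sections_tf[OF assms(3)]])
  have "T_op n \<sigma> (contr A f) x B I = contr A (T_op n \<sigma> f) x B I"
    by (rule T_op_contr[OF assms(1,2) sections_tf[OF assms(3)] sections_swap[OF assms(3)]])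
  then show ?thesis
    using T_op_combination[OF assms(2) tf tf, where c=c and d=0] by (simp add: L_op_def)
qed

lemma T_op_T_op_section:
  "open S \<Longrightarrow> x \<in> S \<Longrightarrow> f \<in> smooth_sections n S m j \<Longrightarrow> T_op n \<sigma> (T_op n \<sigma> f) x B I = 0"
  by (intro T_op_T_op sections_tf sections_swap)

lemma T_op_diff_section:
  "x \<in> S \<Longrightarrow> f \<in> smooth_sections n S m j \<Longrightarrow> g \<in> smooth_sections n S m' j' \<Longrightarrow>
    T_op n \<sigma> (\<lambda>y B I. f y B I - g y B I) x B I = T_op n \<sigma> f x B I - T_op n \<sigma> g x B I"
  by (intro T_op_diff sections_tf)

lemma T_op_add_section:
  "x \<in> S \<Longrightarrow> f \<in> smooth_sections n S m j \<Longrightarrow> g \<in> smooth_sections n S m' j' \<Longrightarrow>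
    T_op n \<sigma> (\<lambda>y B I. f y B I + g y B I) x B I = T_op n \<sigma> f x B I + T_op n \<sigma> g x B I"
  by (intro T_op_add sections_tf)

lemma cocycles_iff:
  "j < m \<Longrightarrow> f \<in> cocycles n \<sigma> \<Omega> m j \<longleftrightarrow>
    f \<in> smooth_sections n \<Omega> m j \<and> (\<forall>x\<in>\<Omega>. \<forall>B I. T_op n \<sigma> f x B I = 0)"
  by (simp add: cocycles_def D_op_less)

lemma cocycles_zero: "(\<lambda>x B I. 0) \<in> cocycles n \<sigma> \<Omega> m j"
proof -
  have *: "d_op n \<sigma> P1 (\<lambda>y I. 0) = (\<lambda>x I. 0)"
    by (intro ext d_op_zero)
  have "D_op n \<sigma> m j (\<lambda>x B I. 0) x B I = 0" for x B I
    by (simp add: D_op_def d_op_zero *)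
  then show ?thesis by (simp add: cocycles_def sections_zero)
qed

text \<open>Both cases of \<open>D_op\<close> occur for an image under \<open>T_op\<close>.\<close>

lemma T_op_in_cocycles:
  assumes "open \<Omega>" "g \<in> smooth_sections n \<Omega> m j" "j < m" "f \<in> smooth_sections n \<Omega> m (Suc j)"
    and f: "\<And>x B I. x \<in> \<Omega> \<Longrightarrow> f x B I = T_op n \<sigma> g x B I"
  shows "f \<in> cocycles n \<sigma> \<Omega> m (Suc j)"
proof -
  have "D_op n \<sigma> m (Suc j) f x B I = 0" if x: "x \<in> \<Omega>" for x B I
  proof (cases "Suc j < m")
    case True
    have "T_op n \<sigma> f x B I = T_op n \<sigma> (T_op n \<sigma> g) x B I"
      by (rule T_op_cong[OF assms(1) x f])
    with True show ?thesis
      using T_op_T_op_section[OF assms(1) x assms(2)] by (simp add: D_op_less)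
  next
    \<comment> \<open>Here \<open>Suc j = m\<close>. This happens for \<open>k = 1\<close>: the
      image of a degree 2 class for \<open>k + 2\<close> lies in degree 2 for
      \<open>k + 1 = 2\<close>, where the operator is of second order.\<close>
    case False
    have "d_op n \<sigma> P0 (d_op n \<sigma> P1 (\<lambda>y. f y [])) x I = d_op n \<sigma> P0 (d_op n \<sigma> P1 (\<lambda>y. T_op n \<sigma> g y [])) x I"
      by (intro d_op_cong[OF assms(1)] x) (simp_all add: f)
    also have "\<dots> = 0"
      by (rule d_op_d_op_T_op[OF assms(1) x sections_tf[OF assms(2)]])
    finally show ?thesis using False by (simp add: D_op_def)
  qed
  then show ?thesis using assms(4) by (simp add: cocycles_def)
qed

section \<open>Using the hypotheses on the induced maps at the level of forms\<close>

lemma cohomologous_Suc_iff: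
  assumes "j < m"
  shows "(f, g) \<in> cohomologous n \<sigma> \<Omega> m (Suc j) \<longleftrightarrow>
    f \<in> cocycles n \<sigma> \<Omega> m (Suc j) \<and> g \<in> cocycles n \<sigma> \<Omega> m (Suc j) \<and>
    (\<exists>u\<in>smooth_sections n \<Omega> m j. \<forall>x\<in>\<Omega>. \<forall>B I. f x B I - g x B I = T_op n \<sigma> u x B I)"
  using assms by (simp add: cohomologous_def D_op_less)

lemma cohomologous_refl:
  "j < m \<Longrightarrow> f \<in> cocycles n \<sigma> \<Omega> m (Suc j) \<Longrightarrow> (f, f) \<in> cohomologous n \<sigma> \<Omega> m (Suc j)"
  unfolding cohomologous_Suc_iff
  by (auto intro!: bexI[of _ "\<lambda>x B I. 0"] sections_zero simp: T_op_zero)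

text \<open>If one representative has exact image, the induced map sends its class to the zero
  class. Since \<open>L_coh\<close> is formed from all representatives, another one
  \<open>h1\<close> has to be considered too: it differs from \<open>h\<close> by some
  \<open>T_op w\<close>, and applying \<open>L_op\<close> to this gives the exact form
  \<open>T_op (L_op w)\<close>.\<close>

lemma class_of_exact_image:
  assumes "open \<Omega>" "j < m" "h \<in> cocycles n \<sigma> \<Omega> (Suc m) (Suc j)"
    and g: "g \<in> smooth_sections n \<Omega> m j"
    and hg: "\<And>x B I. x \<in> \<Omega> \<Longrightarrow> L_op c A h x B I = T_op n \<sigma> g x B I"
  shows "cohomologous n \<sigma> \<Omega> m (Suc j) `` (L_op c A ` (cohomologous n \<sigma> \<Omega> (Suc m) (Suc j) `` {h})) =
    cohomologous n \<sigma> \<Omega> m (Suc j) `` {\<lambda>x B I. 0}"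
proof (intro subset_antisym subsetI)
  fix v assume "v \<in> cohomologous n \<sigma> \<Omega> m (Suc j) `` (L_op c A ` (cohomologous n \<sigma> \<Omega> (Suc m) (Suc j) `` {h}))"
  then obtain h1 where h1: "(h, h1) \<in> cohomologous n \<sigma> \<Omega> (Suc m) (Suc j)"
    and v: "(L_op c A h1, v) \<in> cohomologous n \<sigma> \<Omega> m (Suc j)" by auto
  from h1 assms(2) obtain w where w: "w \<in> smooth_sections n \<Omega> (Suc m) j"
    and hw: "\<And>x B I. x \<in> \<Omega> \<Longrightarrow> h x B I - h1 x B I = T_op n \<sigma> w x B I"
    by (auto simp: cohomologous_Suc_iff)
  from v assms(2) obtain w2 where w2: "w2 \<in> smooth_sections n \<Omega> m j"
    and vw: "\<And>x B I. x \<in> \<Omega> \<Longrightarrow> L_op c A h1 x B I - v x B I = T_op n \<sigma> w2 x B I"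
    and v: "v \<in> cocycles n \<sigma> \<Omega> m (Suc j)"
    by (auto simp: cohomologous_Suc_iff)
  have Lw: "L_op c A w \<in> smooth_sections n \<Omega> m j"
    using w assms(1,2) by (intro sections_L_op) auto
  have gLw: "(\<lambda>x B I. g x B I - L_op c A w x B I) \<in> smooth_sections n \<Omega> m j"
    using assms(1,2) by (intro sections_diff g Lw) auto
  have "0 - v x B I = T_op n \<sigma> (\<lambda>x B I. w2 x B I - (g x B I - L_op c A w x B I)) x B I"
    if x: "x \<in> \<Omega>" for x B I
  proof -
    have "L_op c A h x B I - L_op c A h1 x B I = L_op c A (T_op n \<sigma> w) x B I"
      using L_op_diff[of c A h h1 x B I] L_op_cong[of "\<lambda>x B I. h x B I - h1 x B I" x "T_op n \<sigma> w"] hw[OF x]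
      by simp
    then have L: "L_op c A h1 x B I = T_op n \<sigma> g x B I - T_op n \<sigma> (L_op c A w) x B I"
      using hg[OF x] T_op_L_op[OF assms(1) x w] by (simp add: algebra_simps)
    have lin: "a = c - d \<Longrightarrow> e = d \<Longrightarrow> e - f = c \<Longrightarrow> 0 - f = a" for a c d e f :: complex
      by auto
    have "T_op n \<sigma> (\<lambda>x B I. w2 x B I - (g x B I - L_op c A w x B I)) x B I =
        T_op n \<sigma> w2 x B I - (T_op n \<sigma> g x B I - T_op n \<sigma> (L_op c A w) x B I)"
      by (simp only: T_op_diff_section[OF x w2 gLw] T_op_diff_section[OF x g Lw])
    then show ?thesis using L vw[OF x] by (rule lin)
  qed
  moreover have "(\<lambda>x B I. w2 x B I - (g x B I - L_op c A w x B I)) \<in> smooth_sections n \<Omega> m j"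
    using assms(1,2) by (intro sections_diff w2 gLw) auto
  ultimately show "v \<in> cohomologous n \<sigma> \<Omega> m (Suc j) `` {\<lambda>x B I. 0}"
    using v cocycles_zero[of n \<sigma> \<Omega> m "Suc j"] by (auto simp: cohomologous_Suc_iff[OF assms(2)])
next
  fix v assume "v \<in> cohomologous n \<sigma> \<Omega> m (Suc j) `` {\<lambda>x B I. 0}"
  then obtain w where w: "w \<in> smooth_sections n \<Omega> m j"
    and vw: "\<And>x B I. x \<in> \<Omega> \<Longrightarrow> - v x B I = T_op n \<sigma> w x B I"
    and v: "v \<in> cocycles n \<sigma> \<Omega> m (Suc j)"
    using assms(2) by (auto simp: cohomologous_Suc_iff)
  have "h \<in> smooth_sections n \<Omega> (Suc m) (Suc j)" using assms(3) by (simp add: cocycles_def)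
  then have "L_op c A h \<in> smooth_sections n \<Omega> m (Suc j)"
    using assms(1,2) by (intro sections_L_op) auto
  then have Lh: "L_op c A h \<in> cocycles n \<sigma> \<Omega> m (Suc j)"
    by (rule T_op_in_cocycles[OF assms(1) g assms(2) _ hg])
  have "(\<lambda>x B I. g x B I + w x B I) \<in> smooth_sections n \<Omega> m j"
    using assms(1,2) by (intro sections_add g w) auto
  moreover have "L_op c A h x B I - v x B I = T_op n \<sigma> (\<lambda>x B I. g x B I + w x B I) x B I"
    if x: "x \<in> \<Omega>" for x B I
    using hg[OF x] vw[OF x, symmetric] by (simp add: T_op_add_section[OF x g w])
  ultimately have "(L_op c A h, v) \<in> cohomologous n \<sigma> \<Omega> m (Suc j)"
    using Lh v by (auto simp: cohomologous_Suc_iff[OF assms(2)])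
  moreover have "(h, h) \<in> cohomologous n \<sigma> \<Omega> (Suc m) (Suc j)"
    using assms(2,3) by (intro cohomologous_refl) auto
  ultimately show "v \<in> cohomologous n \<sigma> \<Omega> m (Suc j) `` (L_op c A ` (cohomologous n \<sigma> \<Omega> (Suc m) (Suc j) `` {h}))"
    by blast
qed

text \<open>Injectivity is applied to the classes of \<open>h\<close> and of the zero form, which
  both go to the pair of zero classes; thus it can be used without a linear structure on the set of
  classes.\<close>

lemma exact_if_L_coh_injective:
  assumes "k \<ge> 1" "open \<Omega>"
    and inj: "inj_on (L_coh n \<sigma> \<Omega> k 2) (cohomology n \<sigma> \<Omega> (k + 2) 2)"
    and h: "h \<in> cocycles n \<sigma> \<Omega> (k + 2) 2"
    and g: "g1 \<in> smooth_sections n \<Omega> (k + 1) 1" "g2 \<in> smooth_sections n \<Omega> (k + 1) 1"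
    and L1: "\<And>x B I. x \<in> \<Omega> \<Longrightarrow> L1 h x B I = T_op n \<sigma> g1 x B I"
    and L2: "\<And>x B I. x \<in> \<Omega> \<Longrightarrow> L2 h x B I = T_op n \<sigma> g2 x B I"
  obtains u where "u \<in> smooth_sections n \<Omega> (k + 2) 1"
    "\<And>x B I. x \<in> \<Omega> \<Longrightarrow> h x B I = T_op n \<sigma> u x B I"
proof -
  let ?R = "cohomologous n \<sigma> \<Omega> (k + 2) 2"
  let ?z = "\<lambda>x B I. 0 :: complex"
  have k: "Suc (k + 1) = k + 2" "Suc 1 = 2" by auto
  have zero: "?z \<in> cocycles n \<sigma> \<Omega> (k + 2) 2" by (rule cocycles_zero)
  have Lz: "L_op c A ?z x B I = T_op n \<sigma> ?z x B I" for c A x B I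
    by (simp add: L_op_def contr_def T_op_zero)
  have "L_coh n \<sigma> \<Omega> k 2 (?R `` {h}) = L_coh n \<sigma> \<Omega> k 2 (?R `` {?z})"
    using class_of_exact_image[of \<Omega> 1 "k + 1" h n \<sigma> g1 "-1" 1]
      class_of_exact_image[of \<Omega> 1 "k + 1" h n \<sigma> g2 1 0]
      class_of_exact_image[of \<Omega> 1 "k + 1" ?z n \<sigma> ?z "-1" 1]
      class_of_exact_image[of \<Omega> 1 "k + 1" ?z n \<sigma> ?z 1 0]
      assms(1,2) h g L1 L2 zero Lz sections_zero[of n \<Omega> "k + 1" 1]
    unfolding L_coh_def L1_eq_L_op L2_eq_L_op k by simp
  then have "?R `` {h} = ?R `` {?z}"
    by (rule inj_onD[OF inj]) (use h zero in \<open>auto simp: cohomology_def intro: quotientI\<close>)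
  moreover have "(?z, ?z) \<in> ?R"
    using cohomologous_refl[of 1 "k + 2" ?z n \<sigma> \<Omega>] zero by (simp add: numeral_2_eq_2)
  ultimately have "(h, ?z) \<in> ?R" by auto
  then show ?thesis
    using that cohomologous_Suc_iff[of 1 "k + 2" h ?z n \<sigma> \<Omega>] by (auto simp: numeral_2_eq_2)
qed

lemma preimage_if_L_coh_surjective:
  assumes "k \<ge> 1" "open \<Omega>"
    and surj: "L_coh n \<sigma> \<Omega> k 1 ` cohomology n \<sigma> \<Omega> (k + 2) 1 =
         cohomology n \<sigma> \<Omega> (k + 1) 1 \<times> cohomology n \<sigma> \<Omega> (k + 1) 1"
    and c: "c1 \<in> cocycles n \<sigma> \<Omega> (k + 1) 1" "c2 \<in> cocycles n \<sigma> \<Omega> (k + 1) 1"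
  obtains h u1 u2 where "h \<in> smooth_sections n \<Omega> (k + 2) 1"
    "u1 \<in> smooth_sections n \<Omega> (k + 1) 0" "u2 \<in> smooth_sections n \<Omega> (k + 1) 0"
    "\<And>x B I. x \<in> \<Omega> \<Longrightarrow> L1 h x B I - c1 x B I = T_op n \<sigma> u1 x B I"
    "\<And>x B I. x \<in> \<Omega> \<Longrightarrow> L2 h x B I - c2 x B I = T_op n \<sigma> u2 x B I"
proof -
  let ?R = "cohomologous n \<sigma> \<Omega> (k + 2) 1" and ?R' = "cohomologous n \<sigma> \<Omega> (k + 1) 1"
  have "(?R' `` {c1}, ?R' `` {c2}) \<in> cohomology n \<sigma> \<Omega> (k + 1) 1 \<times> cohomology n \<sigma> \<Omega> (k + 1) 1"
    using c by (auto simp: cohomology_def intro: quotientI)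
  then obtain C where C: "C \<in> cohomology n \<sigma> \<Omega> (k + 2) 1"
    and eq: "?R' `` (L1 ` C) = ?R' `` {c1}" "?R' `` (L2 ` C) = ?R' `` {c2}"
    unfolding surj[symmetric] by (auto simp: L_coh_def)
  have "(c, c) \<in> ?R'" if "c \<in> cocycles n \<sigma> \<Omega> (k + 1) 1" for c
    using cohomologous_refl[of 0 "k + 1" c n \<sigma> \<Omega>] that by simp
  then have "c1 \<in> ?R' `` (L1 ` C)" "c2 \<in> ?R' `` (L2 ` C)"
    unfolding eq using c by auto
  \<comment> \<open>The two components may provide different representatives \<open>h\<close> and
    \<open>h2\<close> of the class. They differ by an exact form \<open>T_op d\<close>, so
    \<open>h\<close> serves for both once \<open>L2 d\<close> is added to \<open>u2\<close>.\<close>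
  then obtain h h2 where h: "h \<in> C" "(L1 h, c1) \<in> ?R'" and h2: "h2 \<in> C" "(L2 h2, c2) \<in> ?R'"
    by blast
  obtain u1 where u1: "u1 \<in> smooth_sections n \<Omega> (k + 1) 0"
    "\<And>x B I. x \<in> \<Omega> \<Longrightarrow> L1 h x B I - c1 x B I = T_op n \<sigma> u1 x B I"
    using h(2) cohomologous_Suc_iff[of 0 "k + 1" "L1 h" c1 n \<sigma> \<Omega>] by auto
  obtain u2 where u2: "u2 \<in> smooth_sections n \<Omega> (k + 1) 0"
    "\<And>x B I. x \<in> \<Omega> \<Longrightarrow> L2 h2 x B I - c2 x B I = T_op n \<sigma> u2 x B I"
    using h2(2) cohomologous_Suc_iff[of 0 "k + 1" "L2 h2" c2 n \<sigma> \<Omega>] by auto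
  from C obtain h0 where "C = ?R `` {h0}" by (auto simp: cohomology_def elim: quotientE)
  with h(1) h2(1) have R: "(h0, h) \<in> ?R" "(h0, h2) \<in> ?R" by auto
  then have hs: "h \<in> smooth_sections n \<Omega> (k + 2) 1"
    by (simp add: cohomologous_def cocycles_def)
  obtain v where v: "v \<in> smooth_sections n \<Omega> (k + 2) 0"
    "\<And>x B I. x \<in> \<Omega> \<Longrightarrow> h0 x B I - h x B I = T_op n \<sigma> v x B I"
    using R(1) cohomologous_Suc_iff[of 0 "k + 2" h0 h n \<sigma> \<Omega>] by auto
  obtain v2 where v2: "v2 \<in> smooth_sections n \<Omega> (k + 2) 0"
    "\<And>x B I. x \<in> \<Omega> \<Longrightarrow> h0 x B I - h2 x B I = T_op n \<sigma> v2 x B I"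
    using R(2) cohomologous_Suc_iff[of 0 "k + 2" h0 h2 n \<sigma> \<Omega>] by auto
  define d where "d = (\<lambda>x B I. v2 x B I - v x B I)"
  have d: "d \<in> smooth_sections n \<Omega> (k + 2) 0"
    unfolding d_def using assms(2) by (intro sections_diff v2 v) auto
  have Ld: "L2 d \<in> smooth_sections n \<Omega> (k + 1) 0"
    unfolding L2_eq_L_op using d assms(2) by (intro sections_L_op) auto
  have "L2 h x B I - c2 x B I = T_op n \<sigma> (\<lambda>x B I. u2 x B I + L2 d x B I) x B I" if x: "x \<in> \<Omega>" for x B I
  proof -
    have "h x B I - h2 x B I = T_op n \<sigma> d x B I" for B I
      unfolding d_def T_op_diff_section[OF x v2(1) v(1)] v2(2)[OF x, symmetric] v(2)[OF x, symmetric] by simp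
    then have "L2 h x B I - L2 h2 x B I = L2 (T_op n \<sigma> d) x B I"
      using L_op_diff[of 1 0 h h2 x B I] L_op_cong[of "\<lambda>x B I. h x B I - h2 x B I" x "T_op n \<sigma> d"]
      by (simp add: L2_eq_L_op)
    also have "\<dots> = T_op n \<sigma> (L2 d) x B I"
      unfolding L2_eq_L_op by (rule T_op_L_op[OF assms(2) x d, symmetric])
    finally show ?thesis
      using u2(2)[OF x, of B I] by (simp add: T_op_add_section[OF x u2(1) Ld] algebra_simps)
  qed
  moreover have "(\<lambda>x B I. u2 x B I + L2 d x B I) \<in> smooth_sections n \<Omega> (k + 1) 0"
    using assms(2) by (intro sections_add u2 Ld) auto
  ultimately show ?thesis using that hs u1 by blast
qed

section \<open>Inverting the contractions off \<open>q\<^sub>0 = 0\<close>\<close>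

definition zdet :: "'m::finite hspace \<Rightarrow> complex" where
  "zdet x = z_coord 0 P0 x * z_coord 1 P1 x - z_coord 0 P1 x * z_coord 1 P0 x"

lemma zdet_nonzero: "fst x \<noteq> 0 \<Longrightarrow> zdet x \<noteq> 0"
proof
  assume "zdet x = 0"
  moreover have "zdet x = complex_of_real ((fst x $ 0)\<^sup>2 + (fst x $ 1)\<^sup>2 + (fst x $ 2)\<^sup>2 + (fst x $ 3)\<^sup>2)"
    by (simp add: zdet_def z_coord_def Let_def complex_eq_iff power2_eq_square algebra_simps)
  ultimately have "(fst x $ 0)\<^sup>2 + (fst x $ 1)\<^sup>2 + (fst x $ 2)\<^sup>2 + (fst x $ 3)\<^sup>2 = 0"
    by (simp only: of_real_eq_0_iff)
  then have "(fst x $ 0)\<^sup>2 = 0 \<and> (fst x $ 1)\<^sup>2 = 0 \<and> (fst x $ 2)\<^sup>2 = 0 \<and> (fst x $ 3)\<^sup>2 = 0"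
    by (smt (verit) zero_le_power2)
  \<comment> \<open>\<open>forall_4\<close> speaks of the components 1 to 4, the last being
    component 0.\<close>
  moreover have "fst x $ 4 = fst x $ 0" by (rule arg_cong[of "4::4" 0]) simp
  ultimately have "fst x = 0"
    by (simp add: vec_eq_iff forall_4)
  moreover assume "fst x \<noteq> 0"
  ultimately show False by simp
qed

text \<open>The inverse of the matrix \<open>z\<close> as adjugate over determinant;
  \<open>s\<close> is the unprimed and \<open>a\<close> the primed index.\<close>

definition zinv :: "nat \<Rightarrow> pidx \<Rightarrow> 'm::finite hspace \<Rightarrow> complex" where
  "zinv s a x = (case a of
      P0 \<Rightarrow> if s = 0 then z_coord 1 P1 x else - z_coord 0 P1 x
    | P1 \<Rightarrow> if s = 0 then - z_coord 1 P0 x else z_coord 0 P0 x) * inverse (zdet x)"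

lemma smooth_on_zinv:
  assumes "open S" "\<And>x. x \<in> S \<Longrightarrow> fst x \<noteq> 0"
  shows "smooth_on S (zinv s a)"
proof -
  have "smooth_on S (\<lambda>x. inverse (zdet x))"
    unfolding zdet_def using assms zdet_nonzero
    by (intro smooth_on_inverse smooth_on_diff smooth_on_mult smooth_on_z_coord) (auto simp: zdet_def)
  moreover have "smooth_on S (\<lambda>x. case a of
      P0 \<Rightarrow> if s = 0 then z_coord 1 P1 x else - z_coord 0 P1 x
    | P1 \<Rightarrow> if s = 0 then - z_coord 1 P0 x else z_coord 0 P0 x)"
    using assms(1) by (cases a; cases "s = 0") (auto intro!: smooth_on_minus smooth_on_z_coord)
  ultimately show ?thesis
    unfolding zinv_def using assms(1) by (intro smooth_on_mult)
qed

lemma zinv_row: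
  assumes "fst x \<noteq> 0"
  shows "z_coord 0 P0 x * zinv 0 P0 x + z_coord 0 P1 x * zinv 0 P1 x = 1"
    "z_coord 1 P0 x * zinv 1 P0 x + z_coord 1 P1 x * zinv 1 P1 x = 1"
    "z_coord 0 P0 x * zinv 1 P0 x + z_coord 0 P1 x * zinv 1 P1 x = 0"
    "z_coord 1 P0 x * zinv 0 P0 x + z_coord 1 P1 x * zinv 0 P1 x = 0"
  using zdet_nonzero[OF assms] by (simp_all add: zinv_def field_simps) (simp_all add: zdet_def algebra_simps)

lemma zinv_column:
  assumes "fst x \<noteq> 0"
  shows "z_coord 0 P0 x * zinv 0 P0 x + z_coord 1 P0 x * zinv 1 P0 x = 1"
    "z_coord 0 P1 x * zinv 0 P1 x + z_coord 1 P1 x * zinv 1 P1 x = 1"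
    "z_coord 0 P0 x * zinv 0 P1 x + z_coord 1 P0 x * zinv 1 P1 x = 0"
    "z_coord 0 P1 x * zinv 0 P0 x + z_coord 1 P1 x * zinv 1 P0 x = 0"
  using zdet_nonzero[OF assms] by (simp_all add: zinv_def field_simps) (simp_all add: zdet_def algebra_simps)

text \<open>The inverse matrix applied in the first index, which solves for a tensor with both
  contractions prescribed. Nothing in the formula makes it symmetric in that index and the others;
  this depends on \<open>r0\<close> and \<open>r1\<close>.\<close>

definition contr_solution ::
  "('m::finite hspace \<Rightarrow> tensor_form) \<Rightarrow> ('m hspace \<Rightarrow> tensor_form) \<Rightarrow> 'm hspace \<Rightarrow> tensor_form" where
  "contr_solution r0 r1 x C I =
    (case C of [] \<Rightarrow> 0 | a # B \<Rightarrow> zinv 0 a x * r0 x B I + zinv 1 a x * r1 x B I)"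

lemma contr_contr_solution:
  assumes "fst x \<noteq> 0"
  shows "contr 0 (contr_solution r0 r1) x B I = r0 x B I"
    "contr 1 (contr_solution r0 r1) x B I = r1 x B I"
proof -
  have eq: "contr A (contr_solution r0 r1) x B I =
      (z_coord A P0 x * zinv 0 P0 x + z_coord A P1 x * zinv 0 P1 x) * r0 x B I +
      (z_coord A P0 x * zinv 1 P0 x + z_coord A P1 x * zinv 1 P1 x) * r1 x B I" for A
    by (simp add: contr_def contr_solution_def algebra_simps)
  show "contr 0 (contr_solution r0 r1) x B I = r0 x B I"
    "contr 1 (contr_solution r0 r1) x B I = r1 x B I"
    unfolding eq zinv_row[OF assms] by simp_all
qed

lemma contr_injective:
  assumes "fst x \<noteq> 0" "contr 0 h x B I = 0" "contr 1 h x B I = 0"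
  shows "h x (a # B) I = 0"
proof -
  have "zinv 0 a x * contr 0 h x B I + zinv 1 a x * contr 1 h x B I =
      (z_coord 0 P0 x * zinv 0 a x + z_coord 1 P0 x * zinv 1 a x) * h x (P0 # B) I +
      (z_coord 0 P1 x * zinv 0 a x + z_coord 1 P1 x * zinv 1 a x) * h x (P1 # B) I"
    by (simp add: contr_def algebra_simps)
  also have "\<dots> = h x (a # B) I"
    by (cases a) (simp_all add: zinv_column[OF assms(1)] del: One_nat_def)
  finally show ?thesis using assms(2,3) by simp
qed

text \<open>The condition \<open>eq\<close>, which the two contractions of a symmetric tensor must
  satisfy, is what makes the solution symmetric in its first two indices. Together with the symmetry
  of \<open>r0\<close> and \<open>r1\<close> in the tail this yields all permutations.\<close>

lemma sections_contr_solution: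
  assumes "open S" and S: "\<And>x. x \<in> S \<Longrightarrow> fst x \<noteq> 0"
    and r: "r0 \<in> smooth_sections n S m j" "r1 \<in> smooth_sections n S m j" and "j \<le> m"
    and eq: "\<And>x B I. x \<in> S \<Longrightarrow> contr 1 r0 x B I = contr 0 r1 x B I"
  shows "contr_solution r0 r1 \<in> smooth_sections n S (Suc m) j"
proof (rule smooth_sectionsI)
  show "smooth_tf S (contr_solution r0 r1)"
    unfolding smooth_tf_def
  proof (intro allI)
    fix C I
    show "smooth_on S (\<lambda>x. contr_solution r0 r1 x C I)"
    proof (cases C)
      case (Cons a B)
      have "smooth_on S (\<lambda>x. zinv 0 a x * r0 x B I + zinv 1 a x * r1 x B I)"
        using r by (intro smooth_on_add smooth_on_mult smooth_on_zinv assms(1) S)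
          (simp_all add: smooth_sections_def)
      then show ?thesis by (simp add: contr_solution_def Cons)
    qed (simp add: contr_solution_def)
  qed
next
  fix x I and B C :: "pidx list"
  assume x: "x \<in> S" and BC: "mset B = mset C"
  have swap: "contr_solution r0 r1 x (P0 # P1 # D) I = contr_solution r0 r1 x (P1 # P0 # D) I" for D
  proof -
    have "contr_solution r0 r1 x (P0 # P1 # D) I =
        (z_coord 1 P1 x * r0 x (P1 # D) I - z_coord 0 P1 x * r1 x (P1 # D) I) * inverse (zdet x)"
      by (simp add: contr_solution_def zinv_def left_diff_distrib)
    also have "z_coord 1 P1 x * r0 x (P1 # D) I - z_coord 0 P1 x * r1 x (P1 # D) I =
        - z_coord 1 P0 x * r0 x (P0 # D) I + z_coord 0 P0 x * r1 x (P0 # D) I"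
      using eq[OF x, of D I] by (simp add: contr_def algebra_simps)
    also have "(- z_coord 1 P0 x * r0 x (P0 # D) I + z_coord 0 P0 x * r1 x (P0 # D) I) * inverse (zdet x) =
        contr_solution r0 r1 x (P1 # P0 # D) I"
      by (simp add: contr_solution_def zinv_def algebra_simps)
    finally show ?thesis .
  qed
  have tail: "contr_solution r0 r1 x (a # D) I = contr_solution r0 r1 x (a # E) I" if "mset D = mset E" for a D E
    using sections_sym[OF r(1) x that] sections_sym[OF r(2) x that]
    by (simp add: contr_solution_def)
  show "contr_solution r0 r1 x B I = contr_solution r0 r1 x C I"
  proof (cases B)
    case Nil
    then show ?thesis using BC by simp
  next
    case (Cons b B')
    then obtain c C' where C: "C = c # C'" using BC by (cases C) auto
    show ?thesis
    proof (cases "b = c")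
      case True
      then have "mset B' = mset C'" using BC Cons C by simp
      from tail[OF this, of b] show ?thesis by (simp only: Cons C True)
    next
      case False
      \<comment> \<open>With different heads, \<open>C\<close> contains \<open>b\<close> and
        \<open>B\<close> contains \<open>c\<close>. Permuting the tails brings the strings to the
        forms \<open>b # c # D\<close> and \<open>c # b # D\<close>, to which \<open>swap\<close>
        applies.\<close>
      have "add_mset b (mset B') = add_mset c (mset C')" using BC Cons C by simp
      from insert_noteq_member[OF this False] have "c \<in># mset B'" .
      then obtain M where M: "mset B' = add_mset c M" by (blast dest: multi_member_split)
      obtain D where "mset D = M" using ex_mset by blast
      with M have D: "mset B' = mset (c # D)" by simp
      then have "mset C' = mset (b # D)" using BC Cons C by simp
      from tail[OF D, of b] tail[OF this, of c]
      have "contr_solution r0 r1 x B I = contr_solution r0 r1 x (b # c # D) I"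
        "contr_solution r0 r1 x C I = contr_solution r0 r1 x (c # b # D) I"
        by (simp_all only: Cons C)
      then show ?thesis using swap False by (cases b; cases c) auto
    qed
  qed
next
  fix x I and B :: "pidx list"
  assume x: "x \<in> S" and "length B \<noteq> Suc m - j"
  then show "contr_solution r0 r1 x B I = 0"
    using \<open>j \<le> m\<close>
    by (cases B) (simp_all add: contr_solution_def Suc_diff_le
      sections_length[OF r(1) x] sections_length[OF r(2) x])
next
  fix x I and B :: "pidx list"
  assume x: "x \<in> S" and I: "\<not> (I \<subseteq> {..<2 * n} \<and> card I = j)"
  show "contr_solution r0 r1 x B I = 0"
    using sections_degree[OF r(1) x \<open>j \<le> m\<close> I] sections_degree[OF r(2) x \<open>j \<le> m\<close> I]
    by (cases B) (auto simp: contr_solution_def)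
qed (use \<open>j \<le> m\<close> in auto)

text \<open>The symmetrization of \<open>z\<^sup>-\<^sup>1 \<otimes> f\<close>, up to a factor: a right inverse of \<open>(u\<^sub>0, u\<^sub>1) \<mapsto> z\<^sub>0 u\<^sub>0 + z\<^sub>1 u\<^sub>1\<close>.\<close>

definition sym_lift :: "nat \<Rightarrow> ('m::finite hspace \<Rightarrow> tensor_form) \<Rightarrow> nat \<Rightarrow> 'm hspace \<Rightarrow> tensor_form" where
  "sym_lift k f s x C I = inverse (of_nat (k + 2)) * 
    (of_nat (count (mset C) P0) * zinv s P0 x * f x (remove1 P0 C) I +
     of_nat (count (mset C) P1) * zinv s P1 x * f x (remove1 P1 C) I)"

lemma count_pidx: "count (mset B) P0 + count (mset B) P1 = length B"
proof (induction B)
  case (Cons a B)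
  then show ?case by (cases a) auto
qed simp

text \<open>By the column relations only terms with matching primed indices survive. They contribute
  \<open>f x B I\<close> with the weights 1 plus the number of \<open>P0\<close> in \<open>B\<close>
  and 1 plus the number of \<open>P1\<close> in \<open>B\<close>; the total \<open>k + 2\<close>
  explains the normalization of \<open>sym_lift\<close>.\<close>

lemma contr_sym_lift:
  assumes "fst x \<noteq> 0" "length B = k"
  shows "contr 0 (sym_lift k f 0) x B I + contr 1 (sym_lift k f 1) x B I = f x B I"
proof -
  let ?n = "\<lambda>a. complex_of_nat (count (mset B) a)"
  let ?e = "\<lambda>a b. z_coord 0 a x * zinv 0 b x + z_coord 1 a x * zinv 1 b x"
  have "contr 0 (sym_lift k f 0) x B I + contr 1 (sym_lift k f 1) x B I =
    inverse (of_nat (k + 2)) * (?e P0 P0 * (1 + ?n P0) * f x B I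
      + ?e P0 P1 * ?n P1 * f x (remove1 P1 (P0 # B)) I
      + ?e P1 P0 * ?n P0 * f x (remove1 P0 (P1 # B)) I + ?e P1 P1 * (1 + ?n P1) * f x B I)"
    unfolding contr_def sym_lift_def by (simp add: algebra_simps del: One_nat_def)
  also have "\<dots> = inverse (of_nat (k + 2)) * ((2 + (?n P0 + ?n P1)) * f x B I)"
    by (simp only: zinv_column[OF assms(1)]) (simp add: algebra_simps)
  also have "?n P0 + ?n P1 = of_nat k"
    using count_pidx[of B] assms(2) by (metis of_nat_add)
  also have "inverse (of_nat (k + 2)) * ((2 + of_nat k) * f x B I) = f x B I"
  proof -
    have "complex_of_nat (k + 2) \<noteq> 0" by (simp only: of_nat_eq_0_iff)
    then show ?thesis by (simp add: add.commute)
  qed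
  finally show ?thesis .
qed

lemma sections_sym_lift:
  assumes "open S" "\<And>x. x \<in> S \<Longrightarrow> fst x \<noteq> 0"
    and f: "f \<in> smooth_sections n S k 0"
  shows "sym_lift k f s \<in> smooth_sections n S (Suc k) 0"
proof (rule smooth_sectionsI)
  show "smooth_tf S (sym_lift k f s)"
    unfolding smooth_tf_def sym_lift_def using f
    by (intro allI smooth_on_add smooth_on_mult smooth_on_zinv smooth_on_const assms(1,2))
      (simp_all add: smooth_sections_def)
next
  fix x I and B C :: "pidx list"
  assume x: "x \<in> S" and BC: "mset B = mset C"
  have "f x (remove1 a B) I = f x (remove1 a C) I" for a
    by (rule sections_sym[OF f x]) (simp add: BC)
  then show "sym_lift k f s x B I = sym_lift k f s x C I"
    by (simp add: sym_lift_def BC)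
next
  fix x I and B :: "pidx list"
  assume x: "x \<in> S" and B: "length B \<noteq> Suc k - 0"
  \<comment> \<open>If \<open>a\<close> does not occur in \<open>B\<close>, \<open>remove1\<close>
    keeps the full length, which might be \<open>k\<close>; then the factor \<open>count\<close> is
    0.\<close>
  have "count (mset B) a = 0 \<or> f x (remove1 a B) I = 0" for a
  proof (cases "a \<in> set B")
    case True
    then have "length (remove1 a B) \<noteq> k - 0" using B by (auto simp: length_remove1 dest: length_pos_if_in_set)
    then show ?thesis using sections_length[OF f x] by blast
  next
    case False
    then show ?thesis by (simp add: count_eq_zero_iff)
  qed
  then have zero: "of_nat (count (mset B) a) * z * f x (remove1 a B) I = 0" for a z
    by (metis mult_eq_0_iff of_nat_0)
  then show "sym_lift k f s x B I = 0" unfolding sym_lift_def zero by simp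
next
  fix x I and B :: "pidx list"
  assume x: "x \<in> S" and I: "\<not> (I \<subseteq> {..<2 * n} \<and> card I = 0)"
  show "sym_lift k f s x B I = 0"
    by (simp add: sym_lift_def sections_degree[OF f x _ I])
qed simp

section \<open>The extension\<close>

definition const_ext :: "('m::finite hspace' \<Rightarrow> pidx list \<Rightarrow> complex) \<Rightarrow> 'm hspace \<Rightarrow> tensor_form" where
  "const_ext f x B I = (if I = {} then f (snd x) B else 0)"

lemma nabla_frame_snd:
  assumes "f differentiable (at (snd x))"
  shows "nabla (frame \<sigma>) a A (\<lambda>x. f (snd x)) x = (if A < 2 then 0 else nabla (frame' \<sigma>) a A f (snd x))"
proof -
  let ?D = "frechet_derivative f (at (snd x))"
  have f: "(f has_derivative ?D) (at (snd x))"
    using assms frechet_derivative_works by blast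
  have "((\<lambda>x. f (snd x)) has_derivative (\<lambda>v. ?D (snd v))) (at x)"
    by (rule has_derivative_compose[where g=f, OF has_derivative_snd[OF has_derivative_ident] f])
  then have D: "frechet_derivative (\<lambda>x. f (snd x)) (at x) v = ?D (snd v)" for v
    by (rule frechet_derivative_eqI)
  have D0: "?D 0 = 0" using has_derivative_scaleR_arg[OF f, of 0 0] by simp
  show ?thesis
  proof (cases "A < 2")
    case True
    then have "A div 2 = 0" by simp
    with True show ?thesis
      by (simp add: nabla_def Let_def D frame_def D0 split: pidx.split)
  next
    case False
    then obtain t where "A div 2 = Suc t" by (cases "A div 2") auto
    with False show ?thesis
      by (simp add: nabla_def Let_def D frame_def split: pidx.split)
  qed
qed

lemma sections_const_ext:
  assumes "open S" "open X" "snd ` S \<subseteq> X" "\<And>B. smooth_on X (\<lambda>y. f y B)"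
    and f: "\<And>y. y \<in> X \<Longrightarrow> f y \<in> sym_tensors k"
  shows "const_ext f \<in> smooth_sections n S k 0"
proof (rule smooth_sectionsI)
  have "smooth_on S (\<lambda>x. f (snd x) B)" for B
    by (rule smooth_on_compose_linear[OF assms(1) bounded_linear_snd assms(4,3)])
  then have "smooth_on S (\<lambda>x. const_ext f x B I)" for B I
    by (cases "I = {}") (simp_all add: const_ext_def)
  then show "smooth_tf S (const_ext f)"
    by (simp add: smooth_tf_def)
next
  fix x I and B C :: "pidx list"
  assume "x \<in> S" and BC: "mset B = mset C"
  then have "f (snd x) \<in> sym_tensors k" using assms(3) f by blast
  then have "f (snd x) B = f (snd x) C"
    using BC unfolding sym_tensors_def by blast
  then show "const_ext f x B I = const_ext f x C I"
    by (simp add: const_ext_def)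
next
  fix x I and B :: "pidx list"
  assume "x \<in> S" and B: "length B \<noteq> k - 0"
  then have "f (snd x) \<in> sym_tensors k" using assms(3) f by blast
  then have "f (snd x) B = 0"
    using B unfolding sym_tensors_def by auto
  then show "const_ext f x B I = 0"
    by (simp add: const_ext_def)
next
  fix x I and B :: "pidx list"
  assume "\<not> (I \<subseteq> {..<2 * n} \<and> card I = 0)"
  then have "I \<noteq> {}" by auto
  then show "const_ext f x B I = 0" by (simp add: const_ext_def)
qed simp

lemma T_op_const_ext:
  assumes "k \<ge> 1" "open X" "\<And>B. smooth_on X (\<lambda>y. f y B)" and f: "regular_on_slice n \<sigma> X k f"
    and x: "snd x \<in> X"
  shows "T_op n \<sigma> (const_ext f) x B I = 0"
proof -
  have diff: "(\<lambda>y. f y C) differentiable (at (snd x))" for C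
    by (rule smooth_on_imp_differentiable[OF assms(3) x])
  have ext: "nabla (frame \<sigma>) a A (\<lambda>y. const_ext f y (a # B) J) x =
      (if J = {} \<and> \<not> A < 2 then nabla (frame' \<sigma>) a A (\<lambda>y. f y (a # B)) (snd x) else 0)" for a A J
    using nabla_frame_snd[of "\<lambda>y. f y (a # B)" x \<sigma> a A, OF diff]
    by (cases "J = {}") (simp_all add: const_ext_def)
  have reg: "nabla (frame' \<sigma>) P0 A (\<lambda>y. f y (P0 # B)) (snd x) +
      nabla (frame' \<sigma>) P1 A (\<lambda>y. f y (P1 # B)) (snd x) = 0" if A: "A < 2 * n" "\<not> A < 2" for A
  proof (cases "length B = k - 1")
    case True
    then show ?thesis using f x A by (simp add: regular_on_slice_def)
  next
    case False
    have "f y (a # B) = 0" if "y \<in> X" for a y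
    proof -
      have "f y \<in> sym_tensors k" using f that by (simp add: regular_on_slice_def)
      moreover have "length (a # B) \<noteq> k" using False assms(1) by auto
      ultimately show ?thesis unfolding sym_tensors_def by blast
    qed
    then have "nabla (frame' \<sigma>) a A (\<lambda>y. f y (a # B)) (snd x) = nabla (frame' \<sigma>) a A (\<lambda>y. 0) (snd x)" for a
      by (intro nabla_cong[OF assms(2) x])
    then show ?thesis by simp
  qed
  show ?thesis
  proof (cases "I \<subseteq> {..<2 * n}")
    case True
    have "T_op n \<sigma> (const_ext f) x B I = (\<Sum>A\<in>I. wsign I A * (if I - {A} = {} \<and> \<not> A < 2 then
        nabla (frame' \<sigma>) P0 A (\<lambda>y. f y (P0 # B)) (snd x) + nabla (frame' \<sigma>) P1 A (\<lambda>y. f y (P1 # B)) (snd x)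
        else 0))"
      using True by (simp add: T_op_def d_op_eq ext sum.distrib[symmetric] distrib_left[symmetric] if_distrib cong: if_cong)
    \<comment> \<open>Only \<open>I = {A}\<close> with \<open>A \<ge> 2\<close> survives the
      condition, and there the equation on the slice applies.\<close>
    also have "\<dots> = 0"
      using True reg by (intro sum.neutral) auto
    finally show ?thesis .
  next
    case False
    then show ?thesis by (simp add: T_op_def d_op_eq)
  qed
qed

text \<open>Extension by zero across the boundary of \<open>W\<close>: outside \<open>W\<close> the
  values of \<open>g\<close> are arbitrary, but there the factor \<phi> is 0 on a whole
  neighbourhood.\<close>

lemma sections_cutoff:
  assumes "open \<Omega>" "open W" "open N" "\<Omega> \<subseteq> W \<union> N"
    and g: "g \<in> smooth_sections n (\<Omega> \<inter> W) m j" and "j \<le> m"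
    and \<phi>: "smooth_on \<Omega> \<phi>" "\<And>x. x \<in> \<Omega> \<inter> N \<Longrightarrow> \<phi> x = 0"
  shows "(\<lambda>x B I. \<phi> x * g x B I) \<in> smooth_sections n \<Omega> m j"
proof (rule sections_local)
  fix x assume "x \<in> \<Omega>"
  then consider "x \<in> \<Omega> \<inter> W" | "x \<in> \<Omega> \<inter> N" using assms(4) by blast
  then show "\<exists>U. open U \<and> x \<in> U \<and> (\<lambda>x B I. \<phi> x * g x B I) \<in> smooth_sections n U m j"
  proof cases
    case 1
    have "(\<lambda>x B I. \<phi> x * g x B I) \<in> smooth_sections n (\<Omega> \<inter> W) m j"
      using assms(1,2,6) smooth_on_subset[OF \<phi>(1), of "\<Omega> \<inter> W"] by (intro sections_mult g) auto
    then show ?thesis using 1 assms(1,2) by blast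
  next
    case 2
    have "(\<lambda>x B I. \<phi> x * g x B I) \<in> smooth_sections n (\<Omega> \<inter> N) m j"
      using assms(1,3) \<phi>(2) by (intro sections_cong[OF _ _ sections_zero]) auto
    then show ?thesis using 2 assms(1,3) by blast
  qed
qed

text \<open>Points with \<open>q\<^sub>0 = 0\<close> are limits of points with
  \<open>q\<^sub>0 \<noteq> 0\<close>; the sequence \<open>s\<close> approaches \<open>x\<close>
  along the direction of \<open>x\<^sub>0\<close>.\<close>

lemma zero_on_fst_zero:
  fixes u :: "'m::finite hspace \<Rightarrow> complex"
  assumes "open \<Omega>" "continuous_on \<Omega> u" "\<And>x. x \<in> \<Omega> \<Longrightarrow> fst x \<noteq> 0 \<Longrightarrow> u x = 0" "x \<in> \<Omega>"
  shows "u x = 0"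
proof (cases "fst x = 0")
  case True
  define e where "e = (axis 0 1 :: real^4, 0 :: 'm hspace')"
  define s where "s m = x + (1 / real (Suc m)) *\<^sub>R e" for m
  have "(\<lambda>m. (1 / real (Suc m)) *\<^sub>R e) \<longlonglongrightarrow> 0 *\<^sub>R e"
    by (intro tendsto_intros LIMSEQ_Suc[OF lim_1_over_n])
  then have s: "s \<longlonglongrightarrow> x"
    unfolding s_def[abs_def] using tendsto_add[OF tendsto_const] by fastforce
  then have "\<forall>\<^sub>F m in sequentially. s m \<in> \<Omega>"
    using assms(1,4) by (rule topological_tendstoD)
  moreover have "fst (s m) \<noteq> 0" for m
    using True by (simp add: s_def e_def axis_eq_0_iff)
  ultimately have ev: "\<forall>\<^sub>F m in sequentially. u (s m) = 0"
    using eventually_mono[of "\<lambda>m. s m \<in> \<Omega>" sequentially "\<lambda>m. u (s m) = 0"] assms(3)[of "s _"] by blast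
  have "isCont u x" using assms(1,2,4) continuous_on_eq_continuous_at by blast
  then have "(\<lambda>m. u (s m)) \<longlonglongrightarrow> u x" using s by (rule isCont_tendsto_compose)
  moreover have "(\<lambda>m. u (s m)) \<longlonglongrightarrow> 0" using ev by (rule tendsto_eventually)
  ultimately show ?thesis by (rule LIMSEQ_unique)
qed (use assms in auto)

lemma extension_if_cutoff:
  fixes f :: "'m::finite hspace' \<Rightarrow> pidx list \<Rightarrow> complex" and \<phi> :: "'m hspace \<Rightarrow> complex"
  assumes k: "k \<ge> 1" and \<Omega>: "open \<Omega>"
    and surj: "L_coh n \<sigma> \<Omega> k 1 ` cohomology n \<sigma> \<Omega> (k + 2) 1 =
         cohomology n \<sigma> \<Omega> (k + 1) 1 \<times> cohomology n \<sigma> \<Omega> (k + 1) 1"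
    and inj: "inj_on (L_coh n \<sigma> \<Omega> k 2) (cohomology n \<sigma> \<Omega> (k + 2) 2)"
    and f: "regular_on_slice n \<sigma> (slice \<Omega>) k f" "\<And>B. smooth_on (slice \<Omega>) (\<lambda>y. f y B)"
    and X: "open (slice \<Omega>)"
    and \<phi>: "smooth_on \<Omega> \<phi>"
    and N1: "open N1" "\<And>x. x \<in> \<Omega> \<Longrightarrow> fst x = 0 \<Longrightarrow> x \<in> N1" "\<And>x. x \<in> \<Omega> \<inter> N1 \<Longrightarrow> \<phi> x = 1"
    and N2: "open N2" "\<And>x. x \<in> \<Omega> \<Longrightarrow> snd x \<notin> slice \<Omega> \<Longrightarrow> x \<in> N2" "\<And>x. x \<in> \<Omega> \<inter> N2 \<Longrightarrow> \<phi> x = 0"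
  shows "\<exists>F. regular_extension n \<sigma> \<Omega> k f F"
proof -
  let ?T = "T_op n \<sigma>" and ?S = "smooth_sections n"
  define W where "W = {x :: 'm hspace. snd x \<in> slice \<Omega>}"
  define P where "P = {x :: 'm hspace. fst x \<noteq> 0}"
  have W: "open W" unfolding W_def using open_vimage_snd[OF X] by (simp add: vimage_def)
  have P: "open P" unfolding P_def using open_vimage_fst[OF open_Compl[OF closed_singleton[of "0 :: real^4"]]]
    by (simp add: vimage_def)
  \<comment> \<open>The lifts \<open>u\<close> and \<open>w\<close> make sense on \<open>Wp\<close>,
    and their products with \<phi> on \<open>\<Omega>p\<close>. Since \<open>\<Omega>p\<close> and
    \<open>N\<close> cover \<Omega>, a section on \<open>\<Omega>p\<close> that vanishes on
    \<open>N\<close> extends to \<Omega>.\<close>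
  define \<Omega>p where "\<Omega>p = \<Omega> \<inter> P"
  define Wp where "Wp = \<Omega>p \<inter> W"
  define N where "N = \<Omega> \<inter> W \<inter> N1"
  have o: "open \<Omega>p" "open Wp" "open N" "open (\<Omega> \<inter> W)"
    unfolding \<Omega>p_def Wp_def N_def using \<Omega> W P N1(1) by (auto intro!: open_Int)
  have nz: "fst x \<noteq> 0" if "x \<in> Wp \<or> x \<in> \<Omega>p" for x using that by (auto simp: Wp_def \<Omega>p_def P_def)
  have cover: "x \<in> \<Omega>p \<or> x \<in> N" if "x \<in> \<Omega>" for x
  proof (cases "fst x = 0")
    case True
    then have "snd x \<in> slice \<Omega>" using that by (cases x) (simp add: slice_def)
    then show ?thesis using N1(2)[OF that True] that by (simp add: N_def W_def)
  qed (use that in \<open>auto simp: \<Omega>p_def P_def\<close>)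
  have cut: "(\<lambda>x B I. \<phi> x * g x B I) \<in> ?S \<Omega>p m j"
    if "g \<in> ?S Wp m j" "j \<le> m" for g m j
  proof (rule sections_cutoff[OF o(1) W N2(1)])
    show "\<Omega>p \<subseteq> W \<union> N2" using N2(2) by (auto simp: \<Omega>p_def W_def)
    show "smooth_on \<Omega>p \<phi>" using \<phi> by (rule smooth_on_subset) (auto simp: \<Omega>p_def)
  qed (use that N2(3) in \<open>auto simp: Wp_def \<Omega>p_def\<close>)

  define ft where "ft = const_ext f"
  have sym: "\<And>y. y \<in> slice \<Omega> \<Longrightarrow> f y \<in> sym_tensors k"
    using f(1) by (simp add: regular_on_slice_def)
  have ft: "ft \<in> ?S (\<Omega> \<inter> W) k 0"
    unfolding ft_def by (rule sections_const_ext[OF o(4) X _ f(2) sym]) (auto simp: W_def)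
  have ftp: "ft \<in> ?S Wp k 0"
    by (rule sections_subset[OF ft]) (auto simp: Wp_def \<Omega>p_def)
  have Tft: "?T ft x B I = 0" if "x \<in> W" for x B I
    unfolding ft_def using that by (intro T_op_const_ext[OF k X f(2,1)]) (simp add: W_def)

  define u where "u s = sym_lift k ft s" for s
  have u: "u s \<in> ?S Wp (k + 1) 0" for s
    unfolding u_def using sections_sym_lift[OF o(2) _ ftp, of s] nz by simp
  have Mu: "contr 0 (u 0) x B I + contr 1 (u 1) x B I = ft x B I" if x: "x \<in> Wp" for x B I
  proof (cases "length B = k")
    case True
    then show ?thesis unfolding u_def using nz x by (intro contr_sym_lift) auto
  next
    case False
    have "contr s (u s) \<in> ?S Wp k 0" for s
      using u o(2) by (intro sections_contr) auto
    from sections_length[OF this x] sections_length[OF ftp x] False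
    show ?thesis by simp
  qed
  have Tu: "?T (u s) \<in> ?S Wp (k + 1) 1" for s
    using sections_T_op[OF u _ o(2)] by simp
  have mTu: "(\<lambda>x B I. - ?T (u s) x B I) \<in> ?S Wp (k + 1) 1" for s
    using Tu o(2) by (intro sections_minus) auto
  have contr_Tu: "?T (contr A (u s)) x B I = contr A (?T (u s)) x B I" if "x \<in> Wp" for A s x B I
    by (rule T_op_contr[OF o(2) that sections_tf[OF u] sections_swap[OF u]])
  have cu: "contr A (u s) \<in> ?S Wp k 0" for A s
    using u o(2) by (intro sections_contr) auto
  \<comment> \<open>As \<open>L w\<close> is \<open>(- contr 1 w, contr 0 w)\<close>, the equation
    \<open>L w = D u\<close> prescribes \<open>contr 0 w\<close> by \<open>u 1\<close> and
    \<open>contr 1 w\<close> by \<open>u 0\<close> with a minus sign. The compatibility required for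
    a symmetric solution is exactly \<open>M (D u) = 0\<close>.\<close>
  define w where "w = contr_solution (?T (u 1)) (\<lambda>x B I. - ?T (u 0) x B I)"
  have w: "w \<in> ?S Wp (k + 2) 1"
  proof -
    have "contr_solution (?T (u 1)) (\<lambda>x B I. - ?T (u 0) x B I) \<in> ?S Wp (Suc (k + 1)) 1"
    proof (rule sections_contr_solution[OF o(2) _ Tu mTu])
      fix x B I assume x: "x \<in> Wp"
      have "?T (contr 0 (u 0)) x B I + ?T (contr 1 (u 1)) x B I =
          ?T (\<lambda>x B I. contr 0 (u 0) x B I + contr 1 (u 1) x B I) x B I"
        by (rule T_op_add_section[OF x cu cu, symmetric])
      also have "\<dots> = ?T ft x B I"
        by (rule T_op_cong[OF o(2) x Mu])
      also have "\<dots> = 0" using x by (intro Tft) (simp add: Wp_def)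
      finally have "contr 0 (?T (u 0)) x B I + contr 1 (?T (u 1)) x B I = 0"
        by (simp only: contr_Tu[OF x])
      then show "contr 1 (?T (u 1)) x B I = contr 0 (\<lambda>x B I. - ?T (u 0) x B I) x B I"
        by (simp add: contr_def add_eq_0_iff algebra_simps)
    qed (use nz in auto)
    then show ?thesis by (simp add: w_def)
  qed
  have cw: "contr 0 w x B I = ?T (u 1) x B I" "contr 1 w x B I = - ?T (u 0) x B I" if "x \<in> Wp" for x B I
    unfolding w_def using nz that contr_contr_solution[of x] by blast+
  have TTu: "?T (?T (u s)) x B I = 0" if "x \<in> Wp" for s x B I
    by (rule T_op_T_op_section[OF o(2) that u])
  \<comment> \<open>Both contractions of \<open>?T w\<close> are, up to sign, second applications of
    \<open>?T\<close> to \<open>u\<close>, hence 0, and jointly they determine all entries at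
    nonempty strings. At the empty string the entry is 0 because sections of degree 2 for
    \<open>k + 2\<close> have \<open>k \<ge> 1\<close> indices.\<close>
  have Tw: "?T w x B I = 0" if x: "x \<in> Wp" for x B I
  proof (cases B)
    case Nil
    have "?T w \<in> ?S Wp (k + 2) (Suc 1)"
      using w k o(2) by (intro sections_T_op) auto
    from sections_length[OF this x] Nil k show ?thesis by simp
  next
    case (Cons a C)
    have comm: "contr A (?T w) x C I = ?T (contr A w) x C I" for A
      by (rule T_op_contr[OF o(2) x sections_tf[OF w] sections_swap[OF w], symmetric])
    have "contr 0 (?T w) x C I = 0"
      unfolding comm using T_op_cong[OF o(2) x cw(1)] TTu[OF x] by simp
    moreover have "contr 1 (?T w) x C I = 0"
      unfolding comm using T_op_cong[OF o(2) x cw(2)] T_op_minus[OF x sections_tf[OF Tu]] TTu[OF x] by simp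
    ultimately show ?thesis
      unfolding Cons by (rule contr_injective[OF nz, OF disjI1[OF x]])
  qed

  define w' where "w' = (\<lambda>x B I. \<phi> x * w x B I)"
  define u' where "u' s = (\<lambda>x B I. \<phi> x * u s x B I)" for s
  have w': "w' \<in> ?S \<Omega>p (k + 2) 1" unfolding w'_def using w by (rule cut) simp
  have u': "u' s \<in> ?S \<Omega>p (k + 1) 0" for s unfolding u'_def using u by (rule cut) simp
  have \<phi>Tu: "(\<lambda>x B I. \<phi> x * ?T (u s) x B I) \<in> ?S \<Omega>p (k + 1) 1" for s
    using Tu by (rule cut) simp
  have Tw': "?T w' \<in> ?S \<Omega>p (k + 2) 2"
    using sections_T_op[OF w' _ o(1)] by (simp add: numeral_2_eq_2)
  have Tu': "?T (u' s) \<in> ?S \<Omega>p (k + 1) 1" for s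
    using sections_T_op[OF u' _ o(1)] by simp

  \<comment> \<open>On \<open>q\<^sub>0 = 0\<close> the formulas with \<open>u\<close> and
    \<open>w\<close> carry no information, so the value is set to 0. This fits smoothly: on
    \<open>N\<close> off \<open>q\<^sub>0 = 0\<close>, \<phi> is 1 and the formulas give
    \<open>?T w = 0\<close> and \<open>?T (u s) - ?T (u s) = 0\<close>.\<close>
  define h where "h = (\<lambda>x B I. if fst x = 0 then 0 else ?T w' x B I)"
  define g where "g s = (\<lambda>x B I. if fst x = 0 then 0 else \<phi> x * ?T (u s) x B I - ?T (u' s) x B I)" for s
  have onN: "?T w' x B I = 0" "?T (u' s) x B I = ?T (u s) x B I" "\<phi> x = 1"
    if x: "x \<in> N" "fst x \<noteq> 0" for x B I s
  proof -
    have oN: "open (N \<inter> Wp)" using o by auto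
    have xN: "x \<in> N \<inter> Wp" using x by (auto simp: N_def Wp_def \<Omega>p_def P_def)
    have one: "\<phi> y = 1" if "y \<in> N \<inter> Wp" for y using that N1(3) by (auto simp: N_def)
    show "\<phi> x = 1" using one xN by blast
    have "?T w' x B I = ?T w x B I"
      by (rule T_op_cong[OF oN xN]) (simp add: w'_def one)
    then show "?T w' x B I = 0" using Tw xN by simp
    show "?T (u' s) x B I = ?T (u s) x B I"
      by (rule T_op_cong[OF oN xN]) (simp add: u'_def one)
  qed
  have hN: "h x B I = 0" and gN: "g s x B I = 0" if "x \<in> N" for x B I s
    using onN[OF that] by (auto simp: h_def g_def)
  have h\<Omega>p: "h x B I = ?T w' x B I"
    and g\<Omega>p: "g s x B I = \<phi> x * ?T (u s) x B I - ?T (u' s) x B I" if "x \<in> \<Omega>p" for x B I s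
    using nz[of x] that by (auto simp: h_def g_def)
  have glue: "q \<in> ?S \<Omega> m j"
    if "q \<in> ?S \<Omega>p m j" "\<And>x B I. x \<in> N \<Longrightarrow> q x B I = 0" for q m j
  proof (rule sections_local)
    fix x assume "x \<in> \<Omega>"
    have "q \<in> ?S N m j"
      by (rule sections_cong[OF o(3) _ sections_zero]) (rule that(2))
    with that(1) cover[OF \<open>x \<in> \<Omega>\<close>] o
    show "\<exists>U. open U \<and> x \<in> U \<and> q \<in> ?S U m j" by blast
  qed
  have h: "h \<in> ?S \<Omega> (k + 2) 2"
    by (intro glue sections_cong[OF o(1) _ Tw']) (simp_all add: h\<Omega>p hN)
  have gp: "(\<lambda>x B I. \<phi> x * ?T (u s) x B I - ?T (u' s) x B I) \<in> ?S \<Omega>p (k + 1) 1" for s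
    using o(1) by (intro sections_diff \<phi>Tu Tu') auto
  have g: "g s \<in> ?S \<Omega> (k + 1) 1" for s
    by (intro glue sections_cong[OF o(1) _ gp[of s]]) (simp_all add: g\<Omega>p gN)
  have TN: "?T q x B I = 0" if "x \<in> N" "\<And>x B I. x \<in> N \<Longrightarrow> q x B I = 0" for q x B I
    using T_op_cong[OF o(3) that(1), of q "\<lambda>x B I. 0"] that(2) by (simp add: T_op_zero)
  have Th: "?T h x B I = 0" if x: "x \<in> \<Omega>" for x B I
    using cover[OF x]
  proof
    assume xp: "x \<in> \<Omega>p"
    have "?T h x B I = ?T (?T w') x B I"
      by (rule T_op_cong[OF o(1) xp h\<Omega>p])
    then show ?thesis using T_op_T_op_section[OF o(1) xp w'] by simp
  qed (rule TN[OF _ hN])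
  \<comment> \<open>As \<open>k \<ge> 1\<close>, degree 2 is below \<open>k + 2\<close>, so the
    cocycle condition is still the first-order one.\<close>
  have h_coc: "h \<in> cocycles n \<sigma> \<Omega> (k + 2) 2"
    using k h Th by (simp add: cocycles_iff)

  have Lw': "L_op c A w' x B I = c * d * (\<phi> x * ?T (u s) x B I)"
    if x: "x \<in> \<Omega>p" and d: "\<And>y B I. y \<in> Wp \<Longrightarrow> contr A w y B I = d * ?T (u s) y B I" for c A d s x B I
  proof -
    have L: "L_op c A w' x B I = c * (\<phi> x * contr A w x B I)"
      by (simp add: L_op_def contr_def w'_def algebra_simps)
    show ?thesis
    proof (cases "x \<in> W")
      case True
      then show ?thesis using x d by (simp add: L Wp_def)
    next
      case False
      then have "\<phi> x = 0" using x N2 by (auto simp: \<Omega>p_def W_def)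
      then show ?thesis by (simp add: L)
    qed
  qed
  have L1w': "L1 w' x B I = \<phi> x * ?T (u 0) x B I"
    and L2w': "L2 w' x B I = \<phi> x * ?T (u 1) x B I" if "x \<in> \<Omega>p" for x B I
    using Lw'[OF that, of 1 "-1" 0 "-1"] Lw'[OF that, of 0 1 1 1] cw
    by (simp_all add: L1_eq_L_op L2_eq_L_op)
  have Lh: "L_op c A h x B I = ?T (g s) x B I"
    if x: "x \<in> \<Omega>" and L: "\<And>x B I. x \<in> \<Omega>p \<Longrightarrow> L_op c A w' x B I = \<phi> x * ?T (u s) x B I" for c A s x B I
    using cover[OF x]
  proof
    assume xp: "x \<in> \<Omega>p"
    have "L_op c A h x B I = L_op c A (?T w') x B I"
      by (rule L_op_cong) (rule h\<Omega>p[OF xp])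
    also have "\<dots> = ?T (L_op c A w') x B I"
      by (rule T_op_L_op[OF o(1) xp w', symmetric])
    also have "\<dots> = ?T (\<lambda>x B I. \<phi> x * ?T (u s) x B I) x B I"
      by (rule T_op_cong[OF o(1) xp L])
    \<comment> \<open>Subtracting \<open>?T (u' s)\<close> does not change the image, as
      \<open>?T\<close> squares to zero; it is this term that makes \<open>g s\<close> vanish near
      the slice.\<close>
    also have "\<dots> = ?T (\<lambda>x B I. \<phi> x * ?T (u s) x B I - ?T (u' s) x B I) x B I"
      by (simp add: T_op_diff_section[OF xp \<phi>Tu Tu'] T_op_T_op_section[OF o(1) xp u'])
    also have "\<dots> = ?T (g s) x B I"
      by (rule T_op_cong[OF o(1) xp g\<Omega>p, symmetric])
    finally show ?thesis .
  next
    assume xN: "x \<in> N"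
    then show ?thesis by (simp add: L_op_def contr_def hN TN[OF xN gN])
  qed
  have L1h: "L1 h x B I = ?T (g 0) x B I" and L2h: "L2 h x B I = ?T (g 1) x B I"
    if "x \<in> \<Omega>" for x B I
    using Lh[OF that] L1w' L2w' unfolding L1_eq_L_op L2_eq_L_op by blast+
  obtain h' where h': "h' \<in> ?S \<Omega> (k + 2) 1"
    and hh': "\<And>x B I. x \<in> \<Omega> \<Longrightarrow> h x B I = ?T h' x B I"
    using exact_if_L_coh_injective[OF k \<Omega> inj h_coc g[of 0] g[of 1] L1h L2h] by blast

  have Lc: "L_op c A h' \<in> ?S \<Omega> (k + 1) 1" for c A
    using h' \<Omega> by (intro sections_L_op) auto
  \<comment> \<open>Here \<open>D g = L h = L (D h') = D (L h')\<close>, so the difference is closed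
    and surjectivity can be applied to it.\<close>
  have coc: "(\<lambda>x B I. g s x B I - L_op c A h' x B I) \<in> cocycles n \<sigma> \<Omega> (k + 1) 1"
    if L: "\<And>x B I. x \<in> \<Omega> \<Longrightarrow> L_op c A h x B I = ?T (g s) x B I" for c A s
  proof -
    have "?T (\<lambda>x B I. g s x B I - L_op c A h' x B I) x B I = 0" if x: "x \<in> \<Omega>" for x B I
    proof -
      have "L_op c A h x B I = L_op c A (?T h') x B I"
        by (rule L_op_cong) (rule hh'[OF x])
      then show ?thesis
        by (simp add: T_op_diff_section[OF x g Lc] T_op_L_op[OF \<Omega> x h'] L[OF x, symmetric])
    qed
    moreover have "(\<lambda>x B I. g s x B I - L_op c A h' x B I) \<in> ?S \<Omega> (k + 1) 1"
      using \<Omega> by (intro sections_diff g Lc) auto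
    ultimately show ?thesis using k by (simp add: cocycles_iff)
  qed
  obtain h'' v0 v1 where h'': "h'' \<in> ?S \<Omega> (k + 2) 1"
    and v: "v0 \<in> ?S \<Omega> (k + 1) 0" "v1 \<in> ?S \<Omega> (k + 1) 0"
    and v0: "\<And>x B I. x \<in> \<Omega> \<Longrightarrow> L1 h'' x B I - (g 0 x B I - L1 h' x B I) = ?T v0 x B I"
    and v1: "\<And>x B I. x \<in> \<Omega> \<Longrightarrow> L2 h'' x B I - (g 1 x B I - L2 h' x B I) = ?T v1 x B I"
    using preimage_if_L_coh_surjective[OF k \<Omega> surj coc[of "-1" 1 0] coc[of 1 0 1]] L1h L2h
    unfolding L1_eq_L_op L2_eq_L_op by blast

  \<comment> \<open>Off \<open>q\<^sub>0 = 0\<close> this is \<open>M (\<phi> u - v)\<close>, but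
    written with \<open>ft\<close> it is also smooth across the slice, where \<open>u\<close> is
    singular.\<close>
  define F where "F = (\<lambda>x B I. \<phi> x * ft x B I - (contr 0 v0 x B I + contr 1 v1 x B I))"
  have \<phi>ft: "(\<lambda>x B I. \<phi> x * ft x B I) \<in> ?S \<Omega> k 0"
    by (rule sections_cutoff[OF \<Omega> W N2(1) _ ft _ \<phi> N2(3)]) (use N2(2) in \<open>auto simp: W_def\<close>)
  have cv: "contr A v0 \<in> ?S \<Omega> k 0" "contr A v1 \<in> ?S \<Omega> k 0" for A
    using v \<Omega> by (auto intro!: sections_contr)
  have F: "F \<in> ?S \<Omega> k 0"
    unfolding F_def using \<Omega> by (intro sections_diff sections_add \<phi>ft cv) auto
  have TF: "?T F x B I = 0" if x: "x \<in> \<Omega>p" for x B I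
  proof -
    have x\<Omega>: "x \<in> \<Omega>" using x by (simp add: \<Omega>p_def)
    define p where "p = (\<lambda>x B I. w' x B I - (h' x B I + h'' x B I))"
    have vp: "v0 \<in> ?S \<Omega>p (k + 1) 0" "v1 \<in> ?S \<Omega>p (k + 1) 0"
      and h'p: "h' \<in> ?S \<Omega>p (k + 2) 1" "h'' \<in> ?S \<Omega>p (k + 2) 1"
      by (rule v[THEN sections_subset] h'[THEN sections_subset]
          h''[THEN sections_subset], simp add: \<Omega>p_def)+
    have p: "p \<in> ?S \<Omega>p (k + 2) 1"
      unfolding p_def using o(1) by (intro sections_diff sections_add w' h'p) auto
    have Lp: "L_op c A p x B I = L_op c A w' x B I - L_op c A h' x B I - L_op c A h'' x B I" for c A B I
      by (simp add: p_def L_op_def contr_def algebra_simps)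
    define d0 where "d0 = (\<lambda>x B I. u' 0 x B I - v0 x B I)"
    define d1 where "d1 = (\<lambda>x B I. u' 1 x B I - v1 x B I)"
    have d: "d0 \<in> ?S \<Omega>p (k + 1) 0" "d1 \<in> ?S \<Omega>p (k + 1) 0"
      unfolding d0_def d1_def
      by (rule sections_diff[OF u' vp(1) _ o(1)], simp) (rule sections_diff[OF u' vp(2) _ o(1)], simp)
    \<comment> \<open>The choice of \<open>v\<close> gives \<open>D v = L h'' + L h' - g\<close>,
      and \<open>g = L w' - D u'\<close>; hence
      \<open>D (u' - v) = L (w' - h' - h'')\<close>.\<close>
    have Td0: "?T d0 x B I = L1 p x B I" for B I
      using v0[OF x\<Omega>, of B I, symmetric] unfolding d0_def T_op_diff_section[OF x u' vp(1)] L1_eq_L_op Lp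
      using L1w'[OF x, of B I] by (simp add: L1_eq_L_op g\<Omega>p[OF x])
    have Td1: "?T d1 x B I = L2 p x B I" for B I
      using v1[OF x\<Omega>, of B I, symmetric] unfolding d1_def T_op_diff_section[OF x u' vp(2)] L2_eq_L_op Lp
      using L2w'[OF x, of B I] by (simp add: L2_eq_L_op g\<Omega>p[OF x])
    have cd: "contr A d0 \<in> ?S \<Omega>p k 0" "contr A d1 \<in> ?S \<Omega>p k 0" for A
      using d o(1) by (auto intro!: sections_contr)
    have eqF: "F y B I = contr 0 d0 y B I + contr 1 d1 y B I" if y: "y \<in> \<Omega>p" for y B I
    proof -
      have "contr 0 d0 y B I + contr 1 d1 y B I =
          \<phi> y * (contr 0 (u 0) y B I + contr 1 (u 1) y B I) - (contr 0 v0 y B I + contr 1 v1 y B I)"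
        by (simp add: d0_def d1_def u'_def contr_def algebra_simps)
      also have "\<phi> y * (contr 0 (u 0) y B I + contr 1 (u 1) y B I) = \<phi> y * ft y B I"
      proof (cases "y \<in> W")
        case True
        then show ?thesis using Mu[of y] y by (simp add: Wp_def)
      next
        case False
        then have "\<phi> y = 0" using y N2 by (auto simp: \<Omega>p_def W_def)
        then show ?thesis by simp
      qed
      finally show ?thesis by (simp add: F_def)
    qed
    have "?T F x B I = ?T (\<lambda>y B I. contr 0 d0 y B I + contr 1 d1 y B I) x B I"
      by (rule T_op_cong[OF o(1) x eqF])
    also have "\<dots> = contr 0 (?T d0) x B I + contr 1 (?T d1) x B I"
      using T_op_contr[OF o(1) x sections_tf sections_swap, OF d(1) d(1)]
        T_op_contr[OF o(1) x sections_tf sections_swap, OF d(2) d(2)]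
      by (simp add: T_op_add_section[OF x cd(1) cd(2)])
    also have "\<dots> = contr 0 (L1 p) x B I + contr 1 (L2 p) x B I"
      by (simp add: contr_def Td0 Td1)
    also have "\<dots> = - contr 0 (contr 1 p) x B I + contr 1 (contr 0 p) x B I"
      by (simp add: contr_def L1_eq_contr L2_eq_contr algebra_simps)
    also have "\<dots> = 0"
      using contr_swap[OF x sections_swap[OF p], of 0 1 B I] by simp
    finally show ?thesis .
  qed
  have "?T F x B I = 0" if "x \<in> \<Omega>" for x B I
  proof (rule zero_on_fst_zero[OF \<Omega> _ _ that])
    have "smooth_tf \<Omega> (?T F)"
      by (rule smooth_tf_T_op[OF \<Omega> sections_tf[OF F]])
    then show "continuous_on \<Omega> (\<lambda>x. ?T F x B I)"
      by (auto simp: smooth_tf_def intro: smooth_on_imp_continuous_on)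
  qed (use TF in \<open>auto simp: \<Omega>p_def P_def\<close>)
  then have "F \<in> regular_functions n \<sigma> \<Omega> k"
    using F k by (simp add: regular_functions_def cocycles_iff)
  moreover have "F (0, y) B {} = f y B" if y: "y \<in> slice \<Omega>" for y B
  proof -
    have "(0, y) \<in> \<Omega>" using y by (simp add: slice_def)
    then have "\<phi> (0, y) = 1" using N1(2,3) by auto
    moreover have "z_coord A a (0, y) = 0" for A a
      by (simp add: z_coord_def split: pidx.split)
    ultimately show ?thesis by (simp add: F_def ft_def const_ext_def contr_def)
  qed
  ultimately show ?thesis unfolding regular_extension_def by blast
qed

theorem corollary1p8:
  fixes n k :: nat
    and \<sigma> :: "nat \<Rightarrow> 'm::finite"
    and \<Omega> :: "'m hspace set"
  assumes "k \<ge> 1"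
    and "n \<ge> 2"
    and "bij_betw \<sigma> {1..<n} UNIV"
    and "open \<Omega>" and "connected \<Omega>"
    and "slice \<Omega> \<noteq> {}"
    and "L_coh n \<sigma> \<Omega> k 1 ` cohomology n \<sigma> \<Omega> (k + 2) 1 =
         cohomology n \<sigma> \<Omega> (k + 1) 1 \<times> cohomology n \<sigma> \<Omega> (k + 1) 1"
    and "inj_on (L_coh n \<sigma> \<Omega> k 2) (cohomology n \<sigma> \<Omega> (k + 2) 2)"
  shows "\<forall>f. regular_on_slice n \<sigma> (slice \<Omega>) k f \<longrightarrow> (\<exists>F. regular_extension n \<sigma> \<Omega> k f F)"
proof (intro allI impI)
  fix f assume f: "regular_on_slice n \<sigma> (slice \<Omega>) k f"
  have X: "open (slice \<Omega>)" by (rule open_slice[OF assms(4)])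
  have smooth: "smooth_on (slice \<Omega>) (\<lambda>y. f y B)" for B
    by (rule smooth_if_regular_on_slice[OF assms(1) X assms(3) f])
  obtain \<phi> :: "'m hspace \<Rightarrow> complex" and N1 N2 where "smooth_on \<Omega> \<phi>"
    "open N1" "\<And>x. x \<in> \<Omega> \<Longrightarrow> fst x = 0 \<Longrightarrow> x \<in> N1" "\<And>x. x \<in> \<Omega> \<inter> N1 \<Longrightarrow> \<phi> x = 1"
    "open N2" "\<And>x. x \<in> \<Omega> \<Longrightarrow> snd x \<notin> slice \<Omega> \<Longrightarrow> x \<in> N2" "\<And>x. x \<in> \<Omega> \<inter> N2 \<Longrightarrow> \<phi> x = 0"
    using cutoff_exists[OF X] by blast
  from extension_if_cutoff[OF assms(1,4,7,8) f smooth X this]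
  show "\<exists>F. regular_extension n \<sigma> \<Omega> k f F" .
qed

end
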